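(* Let $k$ be a finite field of characteristic $3$. Every ordinary genus $2$ curve defined over $k$ (i.e. every genus $2$ curve over $k$ of $3$-rank $2$) has absolute invariants $(g_1,g_2,g_3)$ with $g_1\in k^\times$ and $g_2,g_3\in k$.
   Context: Curves are smooth, projective and geometrically irreducible; $k^{\mathrm{alg}}$ denotes an algebraic closure of $k$. $p$-rank: for a genus $2$ curve $C$ over a field $k$ of characteristic $p$, the $p$-rank of $C$ is the integer $f \in \{0,1,2\}$ with $\mathrm{Jac}(C)[p](k^{\mathrm{alg}}) \cong (\mathbb{Z}/p\mathbb{Z})^f$. The curve $C$ is called ordinary if $f=2$, non-ordinary if $f=1$ (exactly), and supersingular if $f=0$. Igusa invariants: in characteristic different from $2$, let $C$ be given by $y^2 = F(x)$ with $F = c_6x^6+\dots+c_0$ separable of degree $5$ or $6$ (viewed as a binary sextic form, with a root at infinity if $c_6=0$). The Igusa invariants $[J_2:J_4:J_6:J_8:J_{10}]$ are a point of the weighted projective space $\mathbb{P}(2,4,6,8,10)$, where the $J_{2i}$ are the polynomials in $c_0,\dots,c_6$ with coefficients in $\mathbb{Z}[1/2]$ defined as follows. Over characteristic $0$, for $F$ of degree $6$ with roots $x_1,\dots,x_6$ and $(ij)=x_i-x_j$, put $I_2 = c_6^2\sum_{15}(12)^2(34)^2(56)^2$, $I_4 = c_6^4\sum_{10}(12)^2(23)^2(31)^2(45)^2(56)^2(64)^2$, $I_6 = c_6^6\sum_{60}(12)^2(23)^2(31)^2(45)^2(56)^2(64)^2(14)^2(25)^2(36)^2$, $I_{10} =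 c_6^{10}\prod_{i<j}(ij)^2$ (the discriminant), where each sum is over the indicated number of distinct expressions obtained by permuting the indices. Then $J_2 = I_2/8$, $J_4=(4J_2^2-I_4)/96$, $J_6 = (8J_2^3-160J_2J_4-I_6)/576$, $J_8=(J_2J_6-J_4^2)/4$, $J_{10}=I_{10}/2^{12}$. These are polynomials in the $c_i$ over $\mathbb{Z}[1/2]$ and hence make sense in every characteristic different from $2$. Absolute invariants: $(g_1,g_2,g_3)$ is defined by $\left(\frac{J_2^5}{J_{10}}, \frac{J_2^3J_4}{J_{10}}, \frac{J_2^2J_6}{J_{10}}\right)$ if $J_2\neq 0$; $\left(0,\frac{J_4^5}{J_{10}^2},\frac{J_4J_6}{J_{10}}\right)$ if $J_2=0$, $J_4\ne 0$; $\left(0,0,\frac{J_6^5}{J_{10}^3}\right)$ if $J_2=J_4=0$. Two genus $2$ curves are isomorphic over $k^{\mathrm{alg}}$ if and only if their absolute invariants coincide. *)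

theory Defs
  imports
    "HOL-Algebra.Algebra"
    "HOL-Algebra.Algebraic_Closure_Type"
    "HOL-Algebra.Free_Abelian_Groups"
    "HOL-Combinatorics.Permutations"
    "HOL-Computational_Algebra.Computational_Algebra"
    Complex_Main
begin

section \<open>Genus 2 curves and their function fields\<close>

text \<open>
  In characteristic different from 2, a genus 2 curve over \<open>k\<close> is the smooth projective model of
  \<open>y\<^sup>2 = F(x)\<close> with \<open>F \<in> k[x]\<close> separable (no multiple root in the algebraic closure)
  of degree 5 or 6. The curve is represented by \<open>F\<close>.
\<close>

definition genus2_model :: "'k::field poly \<Rightarrow> bool" where
  "genus2_model F \<longleftrightarrow> rsquarefree (map_poly to_ac F) \<and> (degree F = 5 \<or> degree F = 6)"

text \<open>The function field \<open>K(x)[y]/(y\<^sup>2 - F)\<close>; the pair \<open>(a, b)\<close> stands for \<open>a + b y\<close>.\<close>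

definition function_field :: "'a::field poly \<Rightarrow> ('a poly fract \<times> 'a poly fract) ring" where
  "function_field F =
     \<lparr>carrier = UNIV,
      monoid.mult = (\<lambda>(a, b) (c, d). (a * c + b * d * to_fract F, a * d + b * c)),
      one = (1, 0),
      ring.zero = (0, 0),
      add = (\<lambda>(a, b) (c, d). (a + c, b + d))\<rparr>"

definition constants :: "('a::field poly fract \<times> 'a poly fract) set" where
  "constants = range (\<lambda>c. (to_fract [:c:], 0))"

section \<open>Places, divisors and the divisor class group\<close>

text \<open>
  The closed points of the smooth projective curve with function field \<open>L\<close> over the constant field
  \<open>k\<close> are the normalized discrete valuations of \<open>L\<close> that are trivial on \<open>k\<close>. A valuation is a
  function on the nonzero elements of \<open>L\<close>; extensionality makes it determined by its values there.
\<close>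

definition places :: "('a, 'm) ring_scheme \<Rightarrow> 'a set \<Rightarrow> ('a \<Rightarrow> int) set" where
  "places L k =
     {v. v \<in> extensional (carrier L - {\<zero>\<^bsub>L\<^esub>}) \<and>
         v ` (carrier L - {\<zero>\<^bsub>L\<^esub>}) = UNIV \<and>
         (\<forall>f \<in> carrier L - {\<zero>\<^bsub>L\<^esub>}. \<forall>g \<in> carrier L - {\<zero>\<^bsub>L\<^esub>}.
            v (f \<otimes>\<^bsub>L\<^esub> g) = v f + v g \<and>
            (f \<oplus>\<^bsub>L\<^esub> g \<noteq> \<zero>\<^bsub>L\<^esub> \<longrightarrow> v (f \<oplus>\<^bsub>L\<^esub> g) \<ge> min (v f) (v g))) \<and>
         (\<forall>c \<in> k - {\<zero>\<^bsub>L\<^esub>}. v c = 0)}"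

definition div_group :: "('a, 'm) ring_scheme \<Rightarrow> 'a set \<Rightarrow> (('a \<Rightarrow> int) \<Rightarrow>\<^sub>0 int) monoid" where
  "div_group L k = free_Abelian_group (places L k)"

definition principal_divisors ::
    "('a, 'm) ring_scheme \<Rightarrow> 'a set \<Rightarrow> (('a \<Rightarrow> int) \<Rightarrow>\<^sub>0 int) set" where
  "principal_divisors L k =
     {D \<in> carrier (div_group L k).
        \<exists>f \<in> carrier L - {\<zero>\<^bsub>L\<^esub>}. \<forall>v \<in> places L k. Poly_Mapping.lookup D v = v f}"

text \<open>Only used over an algebraically closed constant field, where every place has degree 1.\<close>

definition div_degree :: "(('a \<Rightarrow> int) \<Rightarrow>\<^sub>0 int) \<Rightarrow> int" where
  "div_degree D = (\<Sum>v \<in> Poly_Mapping.keys D. Poly_Mapping.lookup D v)"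

definition class_group ::
    "('a, 'm) ring_scheme \<Rightarrow> 'a set \<Rightarrow> (('a \<Rightarrow> int) \<Rightarrow>\<^sub>0 int) set monoid" where
  "class_group L k = div_group L k Mod principal_divisors L k"

definition class_group0 ::
    "('a, 'm) ring_scheme \<Rightarrow> 'a set \<Rightarrow> (('a \<Rightarrow> int) \<Rightarrow>\<^sub>0 int) set monoid" where
  "class_group0 L k =
     (class_group L k)
       \<lparr>carrier := {principal_divisors L k #>\<^bsub>div_group L k\<^esub> D | D.
                     D \<in> carrier (div_group L k) \<and> div_degree D = 0}\<rparr>"

section \<open>The p-rank\<close>

text \<open>
  The group of geometric points of the Jacobian, as the degree 0 divisor class group of the curve
  base changed to the algebraic closure.
\<close>

definition jacobian_points ::
    "'k::field poly \<Rightarrow>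
     (('k alg_closure poly fract \<times> 'k alg_closure poly fract \<Rightarrow> int) \<Rightarrow>\<^sub>0 int) set monoid" where
  "jacobian_points F = class_group0 (function_field (map_poly to_ac F)) constants"

definition torsion_part :: "('a, 'm) monoid_scheme \<Rightarrow> nat \<Rightarrow> ('a, 'm) monoid_scheme" where
  "torsion_part G n = G\<lparr>carrier := {x \<in> carrier G. x [^]\<^bsub>G\<^esub> n = \<one>\<^bsub>G\<^esub>}\<rparr>"

definition has_p_rank :: "'k::field poly \<Rightarrow> nat \<Rightarrow> bool" where
  "has_p_rank F f \<longleftrightarrow>
     f \<in> {0, 1, 2} \<and>
     torsion_part (jacobian_points F) CHAR('k)
       \<cong> product_group {..<f} (\<lambda>_. integer_mod_group CHAR('k))"

definition ordinary :: "'k::field poly \<Rightarrow> bool" where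
  "ordinary F \<longleftrightarrow> has_p_rank F 2"

section \<open>Igusa invariants\<close>

text \<open>
  Polynomials over \<open>\<rat>\<close> in variables indexed by \<open>nat\<close> are finitely supported maps from exponent
  vectors to coefficients. They are evaluated in any field in which the denominators of their
  coefficients are invertible.
\<close>

type_synonym rat_mpoly = "(nat \<Rightarrow>\<^sub>0 nat) \<Rightarrow>\<^sub>0 rat"

definition rat_to_field :: "rat \<Rightarrow> 'a::field" where
  "rat_to_field q = of_int (fst (quotient_of q)) / of_int (snd (quotient_of q))"

definition eval_mpoly :: "(nat \<Rightarrow> 'a::field) \<Rightarrow> rat_mpoly \<Rightarrow> 'a" where
  "eval_mpoly c P =
     (\<Sum>m \<in> Poly_Mapping.keys P. rat_to_field (Poly_Mapping.lookup P m) *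
        (\<Prod>i \<in> Poly_Mapping.keys m. c i ^ Poly_Mapping.lookup m i))"

definition half_integers :: "rat set" where
  "half_integers = {of_int a / 2 ^ n | a n. True}"

definition half_integer_sextic_mpolys :: "rat_mpoly set" where
  "half_integer_sextic_mpolys =
     {P. (\<forall>m \<in> Poly_Mapping.keys P. Poly_Mapping.keys m \<subseteq> {..6}) \<and>
         (\<forall>m. Poly_Mapping.lookup P m \<in> half_integers)}"

text \<open>
  An expression such as \<open>(12)\<^sup>2(34)\<^sup>2(56)\<^sup>2\<close> is encoded by its set of index pairs
  \<open>{{1,2},{3,4},{5,6}}\<close>; distinct expressions obtained by permuting the indices correspond to distinct
  such sets.
\<close>

definition permuted_expressions :: "nat set set \<Rightarrow> nat set set set" where
  "permuted_expressions E = {(\<lambda>e. \<pi> ` e) ` E | \<pi>. \<pi> permutes {1..6}}"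

definition expression_sum :: "nat set set \<Rightarrow> (nat \<Rightarrow> complex) \<Rightarrow> complex" where
  "expression_sum E x = (\<Sum>G \<in> permuted_expressions E. \<Prod>e \<in> G. (x (Min e) - x (Max e))\<^sup>2)"

text \<open>The arguments are the leading coefficient \<open>a = c\<^sub>6\<close> and the roots \<open>x 1, \<dots>, x 6\<close>.\<close>

definition I2_roots :: "complex \<Rightarrow> (nat \<Rightarrow> complex) \<Rightarrow> complex" where
  "I2_roots a x = a ^ 2 * expression_sum {{1,2},{3,4},{5,6}} x"

definition I4_roots :: "complex \<Rightarrow> (nat \<Rightarrow> complex) \<Rightarrow> complex" where
  "I4_roots a x = a ^ 4 * expression_sum {{1,2},{2,3},{3,1},{4,5},{5,6},{6,4}} x"

definition I6_roots :: "complex \<Rightarrow> (nat \<Rightarrow> complex) \<Rightarrow> complex" where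
  "I6_roots a x =
     a ^ 6 * expression_sum {{1,2},{2,3},{3,1},{4,5},{5,6},{6,4},{1,4},{2,5},{3,6}} x"

definition I10_roots :: "complex \<Rightarrow> (nat \<Rightarrow> complex) \<Rightarrow> complex" where
  "I10_roots a x = a ^ 10 * (\<Prod>j \<in> {1..6}. \<Prod>i \<in> {1..<j}. (x i - x j)\<^sup>2)"

definition J2_roots :: "complex \<Rightarrow> (nat \<Rightarrow> complex) \<Rightarrow> complex" where
  "J2_roots a x = I2_roots a x / 8"

definition J4_roots :: "complex \<Rightarrow> (nat \<Rightarrow> complex) \<Rightarrow> complex" where
  "J4_roots a x = (4 * J2_roots a x ^ 2 - I4_roots a x) / 96"

definition J6_roots :: "complex \<Rightarrow> (nat \<Rightarrow> complex) \<Rightarrow> complex" where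
  "J6_roots a x =
     (8 * J2_roots a x ^ 3 - 160 * J2_roots a x * J4_roots a x - I6_roots a x) / 576"

definition J10_roots :: "complex \<Rightarrow> (nat \<Rightarrow> complex) \<Rightarrow> complex" where
  "J10_roots a x = I10_roots a x / 2 ^ 12"

text \<open>
  The polynomial over \<open>\<int>[1/2]\<close> in \<open>c\<^sub>0, \<dots>, c\<^sub>6\<close> which expresses the function \<open>J\<close> of the leading
  coefficient and the roots through the coefficients of the sextic.
\<close>

definition coefficient_mpoly ::
    "(complex \<Rightarrow> (nat \<Rightarrow> complex) \<Rightarrow> complex) \<Rightarrow> rat_mpoly" where
  "coefficient_mpoly J =
     (THE P. P \<in> half_integer_sextic_mpolys \<and>
        (\<forall>a x. a \<noteq> 0 \<longrightarrow>
           eval_mpoly (coeff (smult a (\<Prod>i \<in> {1..6}. [:- x i, 1:]))) P = J a x))"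

definition igusa_J2 :: "'a::field poly \<Rightarrow> 'a" where
  "igusa_J2 F = eval_mpoly (coeff F) (coefficient_mpoly J2_roots)"

definition igusa_J4 :: "'a::field poly \<Rightarrow> 'a" where
  "igusa_J4 F = eval_mpoly (coeff F) (coefficient_mpoly J4_roots)"

definition igusa_J6 :: "'a::field poly \<Rightarrow> 'a" where
  "igusa_J6 F = eval_mpoly (coeff F) (coefficient_mpoly J6_roots)"

definition igusa_J10 :: "'a::field poly \<Rightarrow> 'a" where
  "igusa_J10 F = eval_mpoly (coeff F) (coefficient_mpoly J10_roots)"

definition absolute_invariants :: "'a::field poly \<Rightarrow> 'a \<times> 'a \<times> 'a" where
  "absolute_invariants F =
     (let J2 = igusa_J2 F; J4 = igusa_J4 F; J6 = igusa_J6 F; J10 = igusa_J10 F in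
      if J2 \<noteq> 0 then (J2 ^ 5 / J10, J2 ^ 3 * J4 / J10, J2 ^ 2 * J6 / J10)
      else if J4 \<noteq> 0 then (0, J4 ^ 5 / J10 ^ 2, J4 * J6 / J10)
      else (0, 0, J6 ^ 5 / J10 ^ 3))"

end

theory Submission
  imports Defs "Jordan_Normal_Form.Determinant"
begin

text \<open>
  The three quotients are values of polynomials over \<open>\<int>[1/2]\<close> at the coefficients of \<open>F\<close>, and evaluation
  of such polynomials commutes with the embedding of \<open>k\<close> into its algebraic closure \<open>K\<close>. Hence the
  absolute invariants come from \<open>k\<close>, and the content of the theorem is that \<open>g\<^sub>1 \<noteq> 0\<close>, that is, that
  \<open>J\<^sub>2\<close> and \<open>J\<^sub>1\<^sub>0\<close> do not vanish.

  For \<open>J\<^sub>1\<^sub>0\<close> this is separability. The discriminant is written as a \<open>6 \<times> 6\<close> determinant in the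
  coefficients, the Bezoutian of \<open>F\<close> and \<open>F'\<close> with the superfluous factor \<open>c\<^sub>6\<^sup>2\<close> removed
  (\<open>det_bezout_mat_discriminant\<close>). The determinant makes sense in all characteristics and stays nonzero
  for separable quintics and sextics (\<open>det_bezout_mat_nonzero\<close>).

  For \<open>J\<^sub>2\<close>, modulo 3 the classical formula becomes \<open>J\<^sub>2 = c\<^sub>2c\<^sub>4 - c\<^sub>1c\<^sub>5\<close> (\<open>igusa_J2_char_3\<close>), which is the
  determinant of the Hasse-Witt matrix of \<open>y\<^sup>2 = F(x)\<close>. If a divisor class is killed by 3, say
  \<open>3D = div f\<close>, then the logarithmic differential \<open>df/f\<close> is regular everywhere: the orders of
  \<open>f\<close> are divisible by 3, so that its zeros and poles cause no poles of \<open>df/f\<close>. So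
  \<open>df/f = (\<alpha> + \<beta>x) dx/y\<close> with constants \<open>\<alpha>, \<beta>\<close>. Logarithmic differentials are fixed by the Cartier
  operator, which in coordinates reads
  \<open>\<alpha>\<^sup>3 = c\<^sub>2\<alpha> + c\<^sub>1\<beta>\<close> and \<open>\<beta>\<^sup>3 = c\<^sub>5\<alpha> + c\<^sub>4\<beta>\<close>. Two functions with the same logarithmic differential have
  a quotient with derivative 0, hence differ by a cube, and their classes coincide. Thus the 3-torsion
  embeds into the solutions of the Cartier equations. When the Hasse-Witt determinant vanishes these
  equations have at most 3 solutions (\<open>frobenius_linear_solutions\<close>), so the 3-torsion has at most 3
  elements (\<open>card_three_torsion_le\<close>), whereas an ordinary curve has 9.

  Two devices keep this elementary. In characteristic 3 the element \<open>w = y\<^sup>3 = Fy\<close> has derivative 0 and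
  generates the function field over \<open>K(x)\<close>, so differentiation acts on the two coordinates of
  \<open>a + bw\<close> separately; up to cubes every function has polynomial \<open>a\<close> and \<open>b\<close>. Points of the curve with
  coordinates in the field of Laurent series provide enough places: orders of Laurent series are the
  valuations, and the formal derivative controls the poles of \<open>df/f\<close>.
\<close>

section \<open>Cubes and derivatives in characteristic 3\<close>

lemma three_eq_0:
  assumes "CHAR('a::comm_ring_1) = 3"
  shows "(3::'a) = 0"
  using of_nat_CHAR[where ?'a = 'a] assms by simp

lemma two_neq_0:
  assumes "CHAR('a::comm_ring_1) = 3"
  shows "(2::'a) \<noteq> 0"
proof
  assume "(2::'a) = 0"
  then have "of_nat 2 = (0::'a)" by simp
  then have "CHAR('a) dvd 2" by (simp only: of_nat_eq_0_iff_char_dvd)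
  then show False using assms by simp
qed

lemma freshmans_dream_3:
  fixes a b :: "'a::comm_ring_1"
  assumes "(3::'a) = 0"
  shows "(a + b) ^ 3 = a ^ 3 + b ^ 3"
proof -
  have "(a + b) ^ 3 = a ^ 3 + b ^ 3 + 3 * (a\<^sup>2 * b + a * b\<^sup>2)"
    by (simp add: algebra_simps power2_eq_square power3_eq_cube)
  then show ?thesis using assms by simp
qed

lemma poly_three_eq_0: "(3::'a::comm_ring_1) = 0 \<Longrightarrow> (3::'a poly) = 0"
  by (metis numeral_poly pCons_0_0)

lemma pderiv_cube_eq_0:
  fixes p :: "'a::field poly"
  assumes "(3::'a) = 0"
  shows "pderiv (p ^ 3) = 0"
  by (simp add: pderiv_power assms)

text \<open>
  A vanishing derivative leaves only exponents divisible by 3, so \<open>p\<close> is a constant plus \<open>x\<^sup>3\<close> times a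
  polynomial with the same property. Coefficients have cube roots, and cubing is additive.
\<close>

lemma pderiv_0_imp_cube:
  fixes p :: "'a::alg_closed_field poly"
  assumes char: "CHAR('a) = 3" and "pderiv p = 0"
  shows "\<exists>q. p = q ^ 3"
  using assms(2)
proof (induction "degree p" arbitrary: p rule: less_induct)
  case less
  have 3: "(3::'a) = 0" using char by (rule three_eq_0)
  show ?case
  proof (cases "degree p = 0")
    case True
    then obtain c where c: "p = [:c:]" by (rule degree_eq_zeroE)
    obtain d where "d ^ 3 = c" using nth_root_exists[of 3 c] by auto
    then have "p = [:d:] ^ 3" using c by (simp add: power3_eq_cube mult.assoc)
    then show ?thesis by blast
  next
    case False
    have c0: "coeff p n = 0" if "\<not> 3 dvd n" for n
    proof -
      have "n \<noteq> 0" using that by (cases n) auto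
      then have "of_nat n * coeff p n = coeff (pderiv p) (n - 1)"
        by (simp add: coeff_pderiv)
      moreover have "of_nat n \<noteq> (0::'a)" using that char by (simp add: of_nat_eq_0_iff_char_dvd)
      ultimately show ?thesis using less.prems by simp
    qed
    obtain d where d: "d ^ 3 = coeff p 0" using nth_root_exists[of 3 "coeff p 0"] by auto
    define r where "r = poly_shift 3 p"
    have p: "p = [:coeff p 0:] + monom 1 3 * r"
    proof (rule poly_eqI)
      fix n show "coeff p n = coeff ([:coeff p 0:] + monom 1 3 * r) n"
      proof (cases "n = 0 \<or> 3 \<le> n")
        case True
        then show ?thesis
          by (auto simp: r_def coeff_monom_mult coeff_poly_shift coeff_pCons split: nat.split)
      next
        case False
        then have "n = 1 \<or> n = 2" by auto
        then have "\<not> 3 dvd n" by auto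
        then show ?thesis using c0[of n] False
          by (auto simp: coeff_monom_mult coeff_pCons split: nat.split)
      qed
    qed
    have "r \<noteq> 0" using p False by (metis add.right_neutral degree_pCons_0 mult_zero_right)
    have "pderiv p = monom 1 3 * pderiv r"
      by (subst p) (simp add: pderiv_mult pderiv_add pderiv_monom pderiv_pCons 3)
    then have "pderiv r = 0" using less.prems by simp
    moreover have "degree r < degree p"
    proof -
      have "degree p = degree (monom 1 3 * r)"
        by (subst p, rule degree_add_eq_right) (use \<open>r \<noteq> 0\<close> in \<open>simp add: degree_mult_eq degree_monom_eq\<close>)
      then show ?thesis using \<open>r \<noteq> 0\<close> by (simp add: degree_mult_eq degree_monom_eq)
    qed
    ultimately obtain q where q: "r = q ^ 3" using less.hyps by blast
    have "(monom 1 1 * q) ^ 3 = monom 1 3 * q ^ 3"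
      by (simp add: power_mult_distrib monom_power)
    moreover have "[:d:] ^ 3 = [:coeff p 0:]"
      by (simp add: d[symmetric] power3_eq_cube mult.assoc)
    ultimately have "p = [:d:] ^ 3 + (monom 1 1 * q) ^ 3"
      using p q by simp
    also have "\<dots> = ([:d:] + monom 1 1 * q) ^ 3"
      by (rule freshmans_dream_3[symmetric], rule poly_three_eq_0, rule 3)
    finally show ?thesis by blast
  qed
qed

section \<open>Logarithmic derivatives and the Cartier equation\<close>

text \<open>
  Let \<open>f = a + bw\<close> with \<open>w\<^sup>2 = \<phi>\<close> and \<open>w' = 0\<close>. The norm of \<open>f\<close> is \<open>N\<close>, and multiplying
  \<open>f' = a' + b'w\<close> by the conjugate of \<open>f\<close> gives \<open>(aa' - \<phi>bb') + Ww\<close>. Under the hypothesis \<open>tr\<close>, the vanishing of the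
  trace part, this means \<open>f' = (Ww/N)f\<close>, whose coordinates are the first two claims; moreover \<open>N' = 2(aa' - \<phi>bb')\<close>.
\<close>

lemma
  fixes a b \<phi> :: "'a::idom poly"
  assumes phi: "pderiv \<phi> = 0"
    and tr: "a * pderiv a = \<phi> * (b * pderiv b)"
  defines "N \<equiv> a\<^sup>2 - b\<^sup>2 * \<phi>" and "W \<equiv> a * pderiv b - pderiv a * b"
  shows norm_mult_pderiv_fst: "N * pderiv a = \<phi> * b * W"
    and norm_mult_pderiv_snd: "N * pderiv b = a * W"
    and norm_pderiv_eq_0: "pderiv N = 0"
proof -
  show "N * pderiv a = \<phi> * b * W" and "N * pderiv b = a * W"
    using tr unfolding N_def W_def by Groebner_Basis.algebra+
  show "pderiv N = 0" 
    using tr phi unfolding N_def by (simp add: pderiv_mult pderiv_diff power2_eq_square algebra_simps)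
qed

text \<open>
  This is the identity \<open>D\<^sup>2h + h\<^sup>3 = 0\<close> for the logarithmic derivative \<open>h = Df/f\<close> of \<open>f = a + bw\<close> with
  \<open>w\<^sup>2 = \<phi>\<close> and \<open>Dw = 0\<close>, valid because \<open>D\<^sup>3 = 0\<close>. By the hypothesis \<open>tr\<close> the norm \<open>N\<close> has
  derivative 0 and \<open>h = Ww/N\<close>; clearing denominators gives a statement about polynomials.
\<close>

lemma wronskian_second_derivative:
  fixes a b \<phi> :: "'a::idom poly"
  assumes phi: "pderiv \<phi> = 0"
    and tr: "a * pderiv a = \<phi> * (b * pderiv b)"
    and d3: "\<And>p :: 'a poly. pderiv (pderiv (pderiv p)) = 0"
  defines "N \<equiv> a\<^sup>2 - b\<^sup>2 * \<phi>" and "W \<equiv> a * pderiv b - pderiv a * b"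
  assumes N0: "N \<noteq> 0"
  shows "N\<^sup>2 * pderiv (pderiv W) = - \<phi> * W ^ 3"
proof -
  note 1 = norm_mult_pderiv_fst[OF phi tr, folded N_def W_def]
  note 2 = norm_mult_pderiv_snd[OF phi tr, folded N_def W_def]
  note 0 = norm_pderiv_eq_0[OF phi tr, folded N_def W_def]
  have 11: "N * pderiv (pderiv a) = \<phi> * (pderiv b * W + b * pderiv W)"
    using arg_cong[OF 1, of pderiv] by (simp add: pderiv_mult 0 phi algebra_simps)
  \<comment> \<open>\<open>N\<close> and \<open>\<phi>\<close> have derivative 0 and act as constants.\<close>
  have 22: "N * pderiv (pderiv b) = pderiv a * W + a * pderiv W"
    using arg_cong[OF 2, of pderiv] by (simp add: pderiv_mult 0 algebra_simps)
  have W2: "pderiv (pderiv W) = pderiv a * pderiv (pderiv b) - pderiv (pderiv a) * pderiv b"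
    unfolding W_def by (simp add: pderiv_mult pderiv_diff pderiv_add d3 algebra_simps)
  have "N * (N\<^sup>2 * pderiv (pderiv W)) = N\<^sup>2 * (pderiv a * (N * pderiv (pderiv b)) - (N * pderiv (pderiv a)) * pderiv b)"
    unfolding W2 by Groebner_Basis.algebra
  also have "\<dots> = W * ((N * pderiv a)\<^sup>2 - \<phi> * (N * pderiv b)\<^sup>2) + N\<^sup>2 * pderiv W * (a * pderiv a - \<phi> * (b * pderiv b))"
    unfolding 11 22 by Groebner_Basis.algebra
  also have "\<dots> = W * ((\<phi> * b * W)\<^sup>2 - \<phi> * (a * W)\<^sup>2)"
    unfolding 1 2 tr by simp
  also have "\<dots> = N * (- \<phi> * W ^ 3)" unfolding N_def by Groebner_Basis.algebra
  finally show ?thesis using N0 mult_cancel_left by blast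
qed

lemma pderiv3_eq_0:
  fixes p :: "'a::field poly"
  assumes 3: "(3::'a) = 0"
  shows "pderiv (pderiv (pderiv p)) = 0"
proof (induction p)
  case (pCons c p)
  have "pderiv (pderiv (pderiv (pCons c p))) = 3 * pderiv (pderiv p) + pCons 0 (pderiv (pderiv (pderiv p)))"
    by (simp add: pderiv_pCons pderiv_add pderiv_mult)
  then show ?case using pCons poly_three_eq_0[OF 3] by simp
qed simp
text \<open>
  Here \<open>\<phi> = F\<^sup>3\<close> and \<open>w = Fy\<close>, so that \<open>df/f = (Ww/N) dx = u dx/y\<close>. The conclusion expresses that \<open>u dx/y\<close> is
  fixed by the Cartier operator.
\<close>

lemma cartier_equation:
  fixes a b F u :: "'a::field poly"
  assumes 3: "(3::'a) = 0"
    and tr: "a * pderiv a = F ^ 3 * (b * pderiv b)"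
    and N0: "a\<^sup>2 - b\<^sup>2 * F ^ 3 \<noteq> 0"
    and u: "(a\<^sup>2 - b\<^sup>2 * F ^ 3) * u = (a * pderiv b - pderiv a * b) * F\<^sup>2"
  shows "pderiv (pderiv (u * F)) = - (u ^ 3)"
proof -
  define N W where "N = a\<^sup>2 - b\<^sup>2 * F ^ 3" and "W = a * pderiv b - pderiv a * b"
  have phi: "pderiv (F ^ 3) = 0" by (rule pderiv_cube_eq_0[OF 3])
  have dN: "pderiv N = 0" unfolding N_def by (rule norm_pderiv_eq_0[OF phi tr])
  have W2: "N\<^sup>2 * pderiv (pderiv W) = - (F ^ 3) * W ^ 3"
    unfolding N_def W_def
    by (rule wronskian_second_derivative[OF phi tr pderiv3_eq_0[OF 3] N0])
  have uN: "N * u = W * F\<^sup>2" using u unfolding N_def W_def .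
  then have "N * (u * F) = W * F ^ 3" by Groebner_Basis.algebra
  moreover have "pderiv (pderiv (N * (u * F))) = N * pderiv (pderiv (u * F))"
    by (simp add: pderiv_mult[of N] dN)
  moreover have "pderiv (pderiv (W * F ^ 3)) = pderiv (pderiv W) * F ^ 3"
    by (simp add: pderiv_mult[of _ "F ^ 3"] phi mult.commute)
  ultimately have "N * pderiv (pderiv (u * F)) = pderiv (pderiv W) * F ^ 3" by simp
  then have "N ^ 3 * pderiv (pderiv (u * F)) = (N\<^sup>2 * pderiv (pderiv W)) * F ^ 3" by Groebner_Basis.algebra
  also have "\<dots> = - ((W * F\<^sup>2) ^ 3)" unfolding W2 by Groebner_Basis.algebra
  also have "\<dots> = N ^ 3 * (- (u ^ 3))" unfolding uN[symmetric] by Groebner_Basis.algebra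
  finally have "N ^ 3 * pderiv (pderiv (u * F)) = N ^ 3 * (- (u ^ 3))" .
  moreover have "N ^ 3 \<noteq> 0" using N0 unfolding N_def by simp
  ultimately show ?thesis using mult_cancel_left by blast
qed

text \<open>
  The two conclusions are the coordinates of the derivative of \<open>f\<^sub>1\<close> times the conjugate of \<open>f\<^sub>2\<close>. As the norm of
  \<open>f\<^sub>2\<close> has derivative 0, this product has the same logarithmic derivative as \<open>f\<^sub>1/f\<^sub>2\<close>, namely the
  difference of the two, which is 0.
\<close>

lemma quotient_derivative_0:
  fixes a1 b1 a2 b2 \<phi> u F :: "'a::idom poly"
  assumes phi: "pderiv \<phi> = 0"
    and tr1: "a1 * pderiv a1 = \<phi> * (b1 * pderiv b1)"
    and tr2: "a2 * pderiv a2 = \<phi> * (b2 * pderiv b2)"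
    and N1: "a1\<^sup>2 - b1\<^sup>2 * \<phi> \<noteq> 0" and N2: "a2\<^sup>2 - b2\<^sup>2 * \<phi> \<noteq> 0" and F: "F \<noteq> 0"
    and u1: "(a1\<^sup>2 - b1\<^sup>2 * \<phi>) * u = (a1 * pderiv b1 - pderiv a1 * b1) * F\<^sup>2"
    and u2: "(a2\<^sup>2 - b2\<^sup>2 * \<phi>) * u = (a2 * pderiv b2 - pderiv a2 * b2) * F\<^sup>2"
  shows "pderiv (a1 * a2 - b1 * b2 * \<phi>) = 0" "pderiv (b1 * a2 - a1 * b2) = 0"
proof -
  have key: "F\<^sup>2 * pderiv a = \<phi> * b * u \<and> F\<^sup>2 * pderiv b = a * u"
    if tr: "a * pderiv a = \<phi> * (b * pderiv b)" and N: "a\<^sup>2 - b\<^sup>2 * \<phi> \<noteq> 0"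
      and u: "(a\<^sup>2 - b\<^sup>2 * \<phi>) * u = (a * pderiv b - pderiv a * b) * F\<^sup>2" for a b
  proof -
    note 1 = norm_mult_pderiv_fst[OF phi tr] and 2 = norm_mult_pderiv_snd[OF phi tr]
    have "(a\<^sup>2 - b\<^sup>2 * \<phi>) * (F\<^sup>2 * pderiv a) = (a\<^sup>2 - b\<^sup>2 * \<phi>) * (\<phi> * b * u)"
      using 1 u by Groebner_Basis.algebra
    moreover have "(a\<^sup>2 - b\<^sup>2 * \<phi>) * (F\<^sup>2 * pderiv b) = (a\<^sup>2 - b\<^sup>2 * \<phi>) * (a * u)"
      using 2 u by Groebner_Basis.algebra
    ultimately show ?thesis using N by simp
  qed
  note k1 = key[OF tr1 N1 u1] and k2 = key[OF tr2 N2 u2]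
  have "F\<^sup>2 * pderiv (a1 * a2 - b1 * b2 * \<phi>) = (F\<^sup>2 * pderiv a1) * a2 + a1 * (F\<^sup>2 * pderiv a2)
          - \<phi> * ((F\<^sup>2 * pderiv b1) * b2 + b1 * (F\<^sup>2 * pderiv b2))"
    by (simp add: pderiv_mult pderiv_diff phi algebra_simps)
  also have "\<dots> = 0" using k1 k2 by Groebner_Basis.algebra
  finally show "pderiv (a1 * a2 - b1 * b2 * \<phi>) = 0" using F by simp
  have "F\<^sup>2 * pderiv (b1 * a2 - a1 * b2) = (F\<^sup>2 * pderiv b1) * a2 + b1 * (F\<^sup>2 * pderiv a2)
          - ((F\<^sup>2 * pderiv a1) * b2 + a1 * (F\<^sup>2 * pderiv b2))"
    by (simp add: pderiv_mult pderiv_diff algebra_simps)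
  also have "\<dots> = 0" using k1 k2 by Groebner_Basis.algebra
  finally show "pderiv (b1 * a2 - a1 * b2) = 0" using F by simp
qed

section \<open>Places from points over Laurent series\<close>

text \<open>
  The coefficients of the square root with constant term \<open>s\<close>, obtained by comparing the coefficients of
  \<open>r\<^sup>2 = g\<close>. Only division by \<open>2s\<close> occurs, so this works in every characteristic other than 2.
\<close>

fun sqrt_coeff :: "'a::field fps \<Rightarrow> 'a \<Rightarrow> nat \<Rightarrow> 'a" where
  "sqrt_coeff g s n =
     (if n = 0 then s
      else (fps_nth g n - (\<Sum>i\<in>{1..<n}. sqrt_coeff g s i * sqrt_coeff g s (n - i))) / (2 * s))"

declare sqrt_coeff.simps [simp del]

lemma fps_sqrt_exists:
  fixes g :: "'a::field fps"
  assumes "(2::'a) \<noteq> 0" "s\<^sup>2 = fps_nth g 0" "s \<noteq> 0"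
  shows "\<exists>r. r\<^sup>2 = g \<and> fps_nth r 0 = s"
proof -
  define r where "r = Abs_fps (sqrt_coeff g s)"
  have r0: "fps_nth r 0 = s"
    by (simp add: r_def sqrt_coeff.simps)
  have "fps_nth (r * r) n = fps_nth g n" for n
  proof (cases "n = 0")
    case True
    then show ?thesis using r0 assms(2) by (simp add: power2_eq_square)
  next
    case False
    have "{0..n} = insert 0 (insert n {1..<n})" using False by auto
    then have "fps_nth (r * r) n =
        2 * s * fps_nth r n + (\<Sum>i\<in>{1..<n}. fps_nth r i * fps_nth r (n - i))"
      using False r0 by (simp add: fps_mult_nth)
    also have "fps_nth r n = (fps_nth g n - (\<Sum>i\<in>{1..<n}. fps_nth r i * fps_nth r (n - i))) / (2 * s)"
      using False by (simp add: r_def sqrt_coeff.simps[of g s n])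
    finally show ?thesis using assms by simp
  qed
  then show ?thesis using r0 by (auto simp: power2_eq_square fps_eq_iff)
qed

lemma fls_sqrt_of_unit_exists:
  fixes g :: "'a::alg_closed_field fls"
  assumes "(2::'a) \<noteq> 0" "g \<noteq> 0" "fls_subdegree g = 0"
  shows "\<exists>r. r\<^sup>2 = g \<and> r \<noteq> 0 \<and> fls_subdegree r = 0"
proof -
  define h where "h = fls_regpart g"
  have g: "g = fps_to_fls h" unfolding h_def
    using assms(3) by (intro fls_eqI) (auto simp: fls_eq0_below_subdegree)
  have h0: "fps_nth h 0 \<noteq> 0" unfolding h_def using assms by (metis fls_regpart_nth nth_fls_subdegree_nonzero of_nat_0)
  obtain s where s: "s\<^sup>2 = fps_nth h 0"
    using nth_root_exists[of 2 "fps_nth h 0"] by auto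
  then have "s \<noteq> 0" using h0 by auto
  then obtain r where r: "r\<^sup>2 = h" "fps_nth r 0 = s"
    using fps_sqrt_exists[OF assms(1) s] by blast
  have "subdegree r = 0" using r \<open>s \<noteq> 0\<close> by (simp add: subdegree_eq_0_iff)
  moreover have "r \<noteq> 0" using r \<open>s \<noteq> 0\<close> by auto
  ultimately show ?thesis using r g
    by (intro exI[of _ "fps_to_fls r"])
       (simp add: fps_to_fls_power[symmetric] fls_subdegree_fls_to_fps)
qed

definition laurent_eval :: "'a::field fls \<Rightarrow> 'a poly \<Rightarrow> 'a fls" where
  "laurent_eval x p = poly (map_poly fls_const p) x"

lemma laurent_eval_0 [simp]: "laurent_eval x 0 = 0"
  by (simp add: laurent_eval_def)

lemma laurent_eval_pCons [simp]: "laurent_eval x (pCons c p) = fls_const c + x * laurent_eval x p"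
  by (simp add: laurent_eval_def map_poly_pCons)

lemma laurent_eval_1 [simp]: "laurent_eval x 1 = 1"
  by (simp add: one_pCons)

lemma laurent_eval_add [simp]: "laurent_eval x (p + q) = laurent_eval x p + laurent_eval x q"
  by (induction p q rule: poly_induct2) (simp_all add: algebra_simps flip: fls_plus_const)

lemma laurent_eval_smult [simp]: "laurent_eval x (smult c p) = fls_const c * laurent_eval x p"
  by (induction p) (simp_all add: algebra_simps flip: fls_const_mult_const)

lemma laurent_eval_mult [simp]: "laurent_eval x (p * q) = laurent_eval x p * laurent_eval x q"
  by (induction p) (simp_all add: algebra_simps)

lemma laurent_eval_uminus [simp]: "laurent_eval x (- p) = - laurent_eval x p"
  using laurent_eval_add[of x p "- p"] by (simp add: eq_neg_iff_add_eq_0 add.commute)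

lemma laurent_eval_diff [simp]: "laurent_eval x (p - q) = laurent_eval x p - laurent_eval x q"
  using laurent_eval_add[of x p "- q"] by simp

lemma laurent_eval_power [simp]: "laurent_eval x (p ^ n) = laurent_eval x p ^ n"
  by (induction n) simp_all

lemma fls_deriv_laurent_eval:
  "fls_deriv (laurent_eval x p) = laurent_eval x (pderiv p) * fls_deriv x"
  by (induction p) (simp_all add: pderiv_pCons algebra_simps)

lemma fls_subdegree_add_ge0:
  "fls_subdegree f \<ge> 0 \<Longrightarrow> fls_subdegree g \<ge> 0 \<Longrightarrow> fls_subdegree (f + g) \<ge> 0"
  by (rule fls_subdegree_ge0I) simp

lemma laurent_eval_subdegree_ge0:
  assumes "fls_subdegree x \<ge> 0"
  shows "fls_subdegree (laurent_eval x p) \<ge> 0"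
proof (induction p)
  case (pCons c p)
  have "fls_subdegree (x * laurent_eval x p) \<ge> 0"
    using assms pCons by (cases "x * laurent_eval x p = 0") auto
  then show ?case by (simp add: fls_subdegree_add_ge0)
qed simp

lemma laurent_eval_finite_point_unit:
  fixes x :: "'a::field fls"
  assumes x: "fls_subdegree (x - fls_const c) > 0" and nz: "poly p c \<noteq> 0"
  shows "laurent_eval x p \<noteq> 0" "fls_subdegree (laurent_eval x p) = 0"
proof -
  have x0: "fls_subdegree x \<ge> 0"
    using fls_subdegree_add_ge0[of "x - fls_const c" "fls_const c"] x by simp
  have "[:-c, 1:] dvd p - [:poly p c:]"
    by (simp add: poly_eq_0_iff_dvd[symmetric])
  then obtain q where q: "p - [:poly p c:] = [:-c, 1:] * q" by blast
  have e: "laurent_eval x p = fls_const (poly p c) + (x - fls_const c) * laurent_eval x q"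
    using arg_cong[OF q, of "laurent_eval x"] by (simp add: algebra_simps)
  have "fls_nth (laurent_eval x p) 0 = poly p c \<and> (\<forall>k<0. fls_nth (laurent_eval x p) k = 0)"
  proof (cases "(x - fls_const c) * laurent_eval x q = 0")
    case True
    then show ?thesis unfolding e by auto
  next
    case False
    then have "fls_subdegree ((x - fls_const c) * laurent_eval x q) > 0"
      using x laurent_eval_subdegree_ge0[OF x0, of q] by simp
    then show ?thesis by (simp add: e)
  qed
  then show "laurent_eval x p \<noteq> 0" "fls_subdegree (laurent_eval x p) = 0"
    using nz by (auto intro: fls_subdegree_eqI)
qed

text \<open>
  Let \<open>x = c + O(t\<^sup>e)\<close> with exact exponent \<open>e > 0\<close>. Then \<open>x\<close> meets the point \<open>c\<close> with ramification index \<open>e\<close>: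
  split off the factor \<open>(X - c)\<^bsup>order c p\<^esup>\<close>, the cofactor becomes a unit.
\<close>

lemma laurent_eval_finite_point:
  fixes x :: "'a::field fls"
  assumes x: "fls_subdegree (x - fls_const c) > 0" and nz: "p \<noteq> 0"
  shows "laurent_eval x p \<noteq> 0"
    "fls_subdegree (laurent_eval x p) = int (order c p) * fls_subdegree (x - fls_const c)"
proof -
  obtain q where q: "p = [:-c, 1:] ^ order c p * q" "\<not> [:-c, 1:] dvd q"
    using order_decomp[OF nz] by blast
  then have qc: "poly q c \<noteq> 0" by (simp add: poly_eq_0_iff_dvd)
  have x0: "x - fls_const c \<noteq> 0" using x by auto
  have "laurent_eval x p = (x - fls_const c) ^ order c p * laurent_eval x q"
    by (subst q(1)) simp
  then show "laurent_eval x p \<noteq> 0"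
    "fls_subdegree (laurent_eval x p) = int (order c p) * fls_subdegree (x - fls_const c)"
    using laurent_eval_finite_point_unit[OF x qc] x0 by (simp_all add: fls_subdegree_pow)
qed

text \<open>
  The point at infinity has the parameter \<open>t = 1/x\<close>, and reversing the coefficients moves it to 0.
\<close>

lemma laurent_eval_infinity:
  fixes p :: "'a::field poly"
  shows "fls_X ^ degree p * laurent_eval fls_X_inv p = laurent_eval fls_X (reflect_poly p)"
proof -
  have "reflect_poly (map_poly fls_const p) = map_poly fls_const (reflect_poly p)"
    by (rule poly_eqI) (simp add: coeff_reflect_poly coeff_map_poly degree_map_poly)
  moreover have "degree (map_poly fls_const p) = degree p"
    by (rule degree_map_poly) simp
  ultimately show ?thesis
    using poly_reflect_poly_nz[of fls_X "map_poly fls_const p"]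
    by (simp add: laurent_eval_def fls_inverse_X)
qed

lemma laurent_eval_infinity_subdegree:
  fixes p :: "'a::field poly"
  assumes "p \<noteq> 0"
  shows "laurent_eval fls_X_inv p \<noteq> 0" "fls_subdegree (laurent_eval fls_X_inv p) = - int (degree p)"
proof -
  have "poly (reflect_poly p) 0 \<noteq> 0" using assms by simp
  then have 1: "laurent_eval fls_X (reflect_poly p) \<noteq> 0"
    and 2: "fls_subdegree (laurent_eval fls_X (reflect_poly p)) = 0"
    using laurent_eval_finite_point_unit[of fls_X 0 "reflect_poly p"] by simp_all
  show 3: "laurent_eval fls_X_inv p \<noteq> 0" using 1 laurent_eval_infinity[of p] by auto
  have "fls_subdegree (fls_X ^ degree p * laurent_eval fls_X_inv p) = 0"
    using 2 laurent_eval_infinity[of p] by simp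
  then show "fls_subdegree (laurent_eval fls_X_inv p) = - int (degree p)"
    using 3 by simp
qed

text \<open>
  The substitution of a Laurent series into a rational function. The value does not depend on the chosen
  representation when the series is a root of no nonzero polynomial (see \<open>eval_fract\<close> below), which is the
  only case of interest.
\<close>

definition laurent_eval_fract :: "'a::field fls \<Rightarrow> 'a poly fract \<Rightarrow> 'a fls" where
  "laurent_eval_fract x r =
     (THE z. \<exists>p q. q \<noteq> 0 \<and> r = Fract p q \<and> z = laurent_eval x p / laurent_eval x q)"

text \<open>
  A point \<open>(x, y)\<close> of the curve over the field of Laurent series, with transcendental \<open>x\<close>. That \<open>F\<close> is not a
  square of a rational function makes the curve irreducible, so that substitution embeds the whole
  function field.
\<close>

locale laurent_point =
  fixes F :: "'a::field poly" and x y :: "'a fls"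
  assumes eval_nonzero: "p \<noteq> 0 \<Longrightarrow> laurent_eval x p \<noteq> 0"
    and y_square: "y\<^sup>2 = laurent_eval x F"
    and F_no_square: "p\<^sup>2 = q\<^sup>2 * F \<Longrightarrow> q = 0"
    and F_nonzero: "F \<noteq> 0"
begin

lemma eval_fract: "q \<noteq> 0 \<Longrightarrow> laurent_eval_fract x (Fract p q) = laurent_eval x p / laurent_eval x q"
  unfolding laurent_eval_fract_def
proof (rule the_equality)
  fix z assume "q \<noteq> 0" and "\<exists>p' q'. q' \<noteq> 0 \<and> Fract p q = Fract p' q' \<and> z = laurent_eval x p' / laurent_eval x q'"
  then obtain p' q' where *: "q' \<noteq> 0" "Fract p q = Fract p' q'" "z = laurent_eval x p' / laurent_eval x q'"
    by blast
  then have "p * q' = p' * q" using \<open>q \<noteq> 0\<close> by (simp add: eq_fract)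
  then have "laurent_eval x p * laurent_eval x q' = laurent_eval x p' * laurent_eval x q"
    by (metis laurent_eval_mult)
  then show "z = laurent_eval x p / laurent_eval x q"
    using * \<open>q \<noteq> 0\<close> by (simp add: eval_nonzero frac_eq_eq)
qed auto

lemma eval_fract_add: "laurent_eval_fract x (r + s) = laurent_eval_fract x r + laurent_eval_fract x s"
  by (cases r rule: Fract_cases; cases s rule: Fract_cases)
     (simp add: eval_fract eval_nonzero add_frac_eq)

lemma eval_fract_mult: "laurent_eval_fract x (r * s) = laurent_eval_fract x r * laurent_eval_fract x s"
  by (cases r rule: Fract_cases; cases s rule: Fract_cases)
     (simp add: eval_fract eval_nonzero)

lemma eval_fract_poly: "laurent_eval_fract x (to_fract p) = laurent_eval x p"
  unfolding to_fract_def by (simp add: eval_fract)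

definition embed :: "'a poly fract \<times> 'a poly fract \<Rightarrow> 'a fls" where
  "embed f = laurent_eval_fract x (fst f) + laurent_eval_fract x (snd f) * y"

lemma embed_poly: "embed (to_fract p, to_fract q) = laurent_eval x p + laurent_eval x q * y"
  by (simp add: embed_def eval_fract_poly)

lemma embed_add: "embed (f \<oplus>\<^bsub>function_field F\<^esub> g) = embed f + embed g"
  by (cases f; cases g) (simp add: embed_def function_field_def eval_fract_add algebra_simps)

lemma embed_mult: "embed (f \<otimes>\<^bsub>function_field F\<^esub> g) = embed f * embed g"
proof -
  obtain a b where f: "f = (a, b)" by (cases f)
  obtain c d where g: "g = (c, d)" by (cases g)
  have "(laurent_eval_fract x b * y) * (laurent_eval_fract x d * y)
      = laurent_eval_fract x b * laurent_eval_fract x d * laurent_eval x F"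
    unfolding y_square[symmetric] power2_eq_square by (simp only: mult_ac)
  then show ?thesis
    by (simp add: f g embed_def function_field_def eval_fract_add eval_fract_mult eval_fract_poly
        distrib_left distrib_right) (auto simp: algebra_simps)
qed

lemma embed_nonzero:
  assumes "f \<noteq> (0, 0)"
  shows "embed f \<noteq> 0"
proof
  assume 0: "embed f = 0"
  obtain a b where f: "f = (a, b)" by (cases f)
  obtain p q where a: "a = Fract p q" "q \<noteq> 0" by (rule Fract_cases)
  obtain r s where b: "b = Fract r s" "s \<noteq> 0" by (rule Fract_cases)
  have "embed f = laurent_eval x p / laurent_eval x q + laurent_eval x r / laurent_eval x s * y"
    using a b by (simp add: f embed_def eval_fract)
  then have "laurent_eval x (p * s) = - laurent_eval x (r * q) * y"
    using 0 a b eval_nonzero[of q] eval_nonzero[of s] by (simp add: field_simps eq_neg_iff_add_eq_0)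
  from arg_cong[OF this, of "\<lambda>z. z\<^sup>2"]
  have "laurent_eval x ((p * s)\<^sup>2) = laurent_eval x ((r * q)\<^sup>2 * F)"
    by (simp add: power_mult_distrib y_square)
  then have e: "(p * s)\<^sup>2 = (r * q)\<^sup>2 * F"
    using eval_nonzero[of "(p * s)\<^sup>2 - (r * q)\<^sup>2 * F"] by auto
  then have "r * q = 0" by (rule F_no_square)
  moreover have "(p * s)\<^sup>2 = 0" unfolding e using calculation by (simp only: power2_eq_square mult_zero_left)
  ultimately show False using assms a b by (simp add: f fract_collapse)
qed

definition place :: "'a poly fract \<times> 'a poly fract \<Rightarrow> int" where
  "place = restrict (\<lambda>f. fls_subdegree (embed f)) (UNIV - {(0, 0)})"

lemma place_eq: "f \<noteq> (0, 0) \<Longrightarrow> place f = fls_subdegree (embed f)"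
  by (simp add: place_def)

lemma place_in_places:
  assumes surj: "\<And>n::int. \<exists>f. f \<noteq> (0, 0) \<and> fls_subdegree (embed f) = n"
  shows "place \<in> places (function_field F) constants"
proof -
  define L where "L = function_field F"
  have carr: "carrier L = UNIV" by (simp add: L_def function_field_def)
  have zero: "\<zero>\<^bsub>L\<^esub> = (0, 0)" by (simp add: L_def function_field_def)
  have mult: "f \<otimes>\<^bsub>L\<^esub> g \<noteq> (0, 0) \<and> place (f \<otimes>\<^bsub>L\<^esub> g) = place f + place g"
    if "f \<noteq> (0, 0)" "g \<noteq> (0, 0)" for f g
  proof -
    have "embed (f \<otimes>\<^bsub>L\<^esub> g) = embed f * embed g" unfolding L_def by (rule embed_mult)
    moreover have "embed (0, 0) = 0" using embed_poly[of 0 0] by simp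
    ultimately have "f \<otimes>\<^bsub>L\<^esub> g \<noteq> (0, 0)" using embed_nonzero that by fastforce
    then show ?thesis using that embed_nonzero \<open>embed (f \<otimes>\<^bsub>L\<^esub> g) = embed f * embed g\<close>
      by (simp add: place_eq)
  qed
  have add: "place (f \<oplus>\<^bsub>L\<^esub> g) \<ge> min (place f) (place g)"
    if "f \<noteq> (0, 0)" "g \<noteq> (0, 0)" "f \<oplus>\<^bsub>L\<^esub> g \<noteq> (0, 0)" for f g
    using that embed_add[of f g] embed_nonzero[of "f \<oplus>\<^bsub>L\<^esub> g"] unfolding L_def
    by (simp add: place_eq fls_plus_subdegree)
  have const: "place f = 0" if f: "f \<in> constants - {(0, 0)}" for f :: "'a poly fract \<times> 'a poly fract"
  proof -
    obtain c where c: "f = (to_fract [:c:], 0)" using f unfolding constants_def by blast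
    then have "embed f = fls_const c" using embed_poly[of "[:c:]" 0] by simp
    then show ?thesis using f by (simp add: place_eq)
  qed
  have "place ` (UNIV - {(0, 0)}) = UNIV"
  proof (intro equalityI subsetI)
    fix n :: int
    obtain f where "f \<noteq> (0, 0)" "fls_subdegree (embed f) = n" using surj by blast
    then show "n \<in> place ` (UNIV - {(0, 0)})" by (intro image_eqI[of _ _ f]) (auto simp: place_eq)
  qed simp
  moreover have "place \<in> extensional (UNIV - {(0, 0)})" by (simp add: place_def)
  ultimately show ?thesis
    unfolding places_def L_def[symmetric] carr zero mem_Collect_eq
    by (intro conjI ballI impI) (use mult add const in blast)+
qed

end

section \<open>Functions whose orders are divisible by 3\<close>

lemma fls_two_neq_0:
  assumes "(2::'a::field) \<noteq> 0"
  shows "(2::'a fls) \<noteq> 0"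
proof -
  have "fls_nth (fls_const (2::'a)) 0 \<noteq> fls_nth 0 0" using assms by simp
  then show ?thesis by (metis fls_const_numeral)
qed

text \<open>
  Differentiation lowers the order of a series unless the characteristic divides the order; the leading
  coefficient is multiplied by the order, which is 0 here.
\<close>

lemma fls_deriv_subdegree_char3:
  fixes g :: "'a::field fls"
  assumes "(3::'a) = 0" "3 dvd fls_subdegree g" "fls_deriv g \<noteq> 0"
  shows "fls_subdegree (fls_deriv g) \<ge> fls_subdegree g"
proof (rule fls_subdegree_geI[OF assms(3)])
  fix k assume k: "k < fls_subdegree g"
  show "fls_nth (fls_deriv g) k = 0"
  proof (cases "k + 1 = fls_subdegree g")
    case True
    then obtain m where "k + 1 = 3 * m" using assms(2) by (metis dvdE)
    then have "of_int (k + 1) = (3::'a) * of_int m" by (metis of_int_mult of_int_numeral)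
    then show ?thesis using assms(1) by simp
  next
    case False
    then show ?thesis using k by simp
  qed
qed

lemma dvd_if_order_le:
  fixes p q :: "'a::alg_closed_field poly"
  assumes "p \<noteq> 0" "q \<noteq> 0" "\<And>c. order c p \<le> order c q"
  shows "p dvd q"
  using assms
proof (induction "degree p" arbitrary: p q rule: less_induct)
  case less
  show ?case
  proof (cases "degree p = 0")
    case True
    then show ?thesis using less.prems(1) is_unit_iff_degree unit_imp_dvd by blast
  next
    case False
    then obtain c where c: "poly p c = 0" using alg_closed_imp_poly_has_root[of p] by auto
    then have "order c p \<noteq> 0" using less.prems(1) order_root by blast
    then have "order c q \<noteq> 0" using less.prems(3)[of c] by simp
    then have "poly q c = 0" using order_root by blast
    obtain p' q' where p': "p = [:-c, 1:] * p'" and q': "q = [:-c, 1:] * q'"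
      using c \<open>poly q c = 0\<close> by (metis dvdE poly_eq_0_iff_dvd)
    have nz: "p' \<noteq> 0" "q' \<noteq> 0" using less.prems p' q' by auto
    have "order d p' \<le> order d q'" for d
      using less.prems(3)[of d] order_mult[of "[:-c, 1:]" p' d] order_mult[of "[:-c, 1:]" q' d]
        less.prems(1,2) unfolding p' q' by linarith
    moreover have "degree p = 1 + degree p'" unfolding p' using nz by (subst degree_mult_eq) auto
    ultimately have "p' dvd q'" using less.hyps nz by auto
    then show ?thesis unfolding p' q' by (rule mult_dvd_mono[OF dvd_refl])
  qed
qed

lemma cube_if_orders_divisible:
  fixes p :: "'a::alg_closed_field poly"
  assumes "p \<noteq> 0" "\<And>c. 3 dvd order c p"
  shows "\<exists>q. p = q ^ 3"
  using assms
proof (induction "degree p" arbitrary: p rule: less_induct)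
  case less
  show ?case
  proof (cases "degree p = 0")
    case True
    then obtain a where a: "p = [:a:]" by (metis degree_eq_zeroE)
    obtain b where "b ^ 3 = a" using nth_root_exists[of 3 a] by auto
    then have "p = [:b:] ^ 3" by (simp add: a power3_eq_cube mult.assoc)
    then show ?thesis by blast
  next
    case False
    then obtain c where c: "poly p c = 0" using alg_closed_imp_poly_has_root[of p] by auto
    then have "order c p \<noteq> 0" using less.prems(1) order_root by blast
    then have "3 \<le> order c p" using less.prems(2)[of c] by (simp add: dvd_imp_le)
    then have "[:-c, 1:] ^ 3 dvd p" using order_1[of c p] by (meson dvd_trans le_imp_power_dvd)
    then obtain p' where p': "p = [:-c, 1:] ^ 3 * p'" by blast
    have nz: "p' \<noteq> 0" using less.prems p' by auto
    have ord: "order d ([:-c, 1:] ^ 3 * p') = (if d = c then 3 else 0) + order d p'" for d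
    proof -
      have "order d ([:-c, 1:] ^ 3) = (if d = c then 3 else 0)"
        using order_power_n_n[of c 3] by (auto intro: order_0I)
      then show ?thesis using nz order_mult[of "[:-c, 1:] ^ 3" p' d] by simp
    qed
    have "3 dvd order d p'" for d
      using less.prems(2)[of d] ord[of d] unfolding p' by (auto split: if_splits)
    moreover have "degree p = 3 + degree p'"
      unfolding p' using nz by (subst degree_mult_eq) (auto simp: degree_power_eq)
    ultimately obtain q where "p' = q ^ 3" using less.hyps[of p'] nz by force
    then show ?thesis unfolding p' by (metis power_mult_distrib)
  qed
qed

context laurent_point
begin

lemma laurent_point_uminus: "laurent_point F x (- y)"
  using laurent_point_axioms unfolding laurent_point_def by simp

lemma embed_uminus: "laurent_point.embed x (- y) (a, - b) = embed (a, b)"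
proof -
  interpret m: laurent_point F x "- y" by (rule laurent_point_uminus)
  have "laurent_eval_fract x (- b) = - laurent_eval_fract x b"
    using eval_fract_add[of b "- b"] eval_fract_poly[of 0] by (simp add: eq_neg_iff_add_eq_0 add.commute)
  then show ?thesis by (simp add: embed_def m.embed_def)
qed

lemma eval_fract_subdegree_multiple:
  assumes "p \<noteq> 0"
  shows "\<exists>r. r \<noteq> 0 \<and> fls_subdegree (laurent_eval_fract x r) = n * fls_subdegree (laurent_eval x p)"
proof -
  have p: "laurent_eval x p \<noteq> 0" using assms by (rule eval_nonzero)
  show ?thesis
  proof (cases "n \<ge> 0")
    case True
    have "laurent_eval_fract x (to_fract (p ^ nat n)) = laurent_eval x p ^ nat n"
      by (simp only: eval_fract_poly laurent_eval_power)
    then show ?thesis using True p assms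
      by (intro exI[of _ "to_fract (p ^ nat n)"]) (simp add: fls_subdegree_pow)
  next
    case False
    have "p ^ nat (- n) \<noteq> 0" using assms by simp
    then have "laurent_eval_fract x (Fract 1 (p ^ nat (- n))) = inverse (laurent_eval x p ^ nat (- n))"
      by (simp add: eval_fract divide_inverse)
    moreover have "Fract 1 (p ^ nat (- n)) \<noteq> 0"
      using \<open>p ^ nat (- n) \<noteq> 0\<close> by (simp add: Zero_fract_def eq_fract)
    ultimately show ?thesis using False p
      by (intro exI[of _ "Fract 1 (p ^ nat (- n))"]) (simp add: fls_subdegree_pow)
  qed
qed

lemma y_nonzero: "y \<noteq> 0"
  using y_square eval_nonzero[OF F_nonzero] by auto

lemma embed_surj_unramified:
  assumes "p \<noteq> 0" "\<bar>fls_subdegree (laurent_eval x p)\<bar> = 1"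
  shows "\<exists>f. f \<noteq> (0, 0) \<and> fls_subdegree (embed f) = n"
proof -
  obtain r where "r \<noteq> 0"
    "fls_subdegree (laurent_eval_fract x r) = (n * fls_subdegree (laurent_eval x p)) * fls_subdegree (laurent_eval x p)"
    using eval_fract_subdegree_multiple[OF assms(1)] by blast
  moreover have "fls_subdegree (laurent_eval x p) * fls_subdegree (laurent_eval x p) = 1"
    using assms(2) by (metis abs_mult_self_eq mult_1)
  moreover have "laurent_eval_fract x 0 = 0" using eval_fract_poly[of 0] by simp
  ultimately show ?thesis
    by (intro exI[of _ "(r, 0)"]) (simp add: embed_def mult.assoc)
qed

text \<open>
  Functions of \<open>x\<close> alone have even order at a ramified point, and multiplication by \<open>y\<close> supplies the odd orders.
\<close>

lemma embed_surj_ramified: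
  assumes "p \<noteq> 0" "fls_subdegree (laurent_eval x p) = 2" "fls_subdegree y = 1"
  shows "\<exists>f. f \<noteq> (0, 0) \<and> fls_subdegree (embed f) = n"
proof -
  obtain r where r: "r \<noteq> 0" "fls_subdegree (laurent_eval_fract x r) = (n div 2) * 2"
    using eval_fract_subdegree_multiple[OF assms(1), of "n div 2"] assms(2) by metis
  have z: "laurent_eval_fract x 0 = 0" using eval_fract_poly[of 0] by simp
  have "laurent_eval_fract x r \<noteq> 0"
    using embed_nonzero[of "(r, 0)"] r z by (auto simp: embed_def)
  then have "fls_subdegree (embed (0, r)) = (n div 2) * 2 + 1"
    using r z assms(3) y_nonzero by (simp add: embed_def)
  moreover have "fls_subdegree (embed (r, 0)) = (n div 2) * 2"
    using r z by (simp add: embed_def)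
  moreover have "n = (n div 2) * 2 \<or> n = (n div 2) * 2 + 1" by presburger
  ultimately show ?thesis using r(1) by (metis prod.inject)
qed

text \<open>
  Put \<open>g = a + by\<^sup>3\<close> and \<open>h = a - by\<^sup>3\<close>, evaluated at the point. They come from the same function at the two
  points \<open>(x, y)\<close> and \<open>(x, -y)\<close>, so both have order divisible by 3, and their product is the norm \<open>N\<close>. By
  \<open>fls_deriv_subdegree_char3\<close> the expression \<open>g'h - gh'\<close> has order at least that of \<open>gh\<close>. On the other hand it
  equals \<open>2y\<^sup>3W\<close> times the derivative of \<open>x\<close>, since \<open>y\<^sup>3\<close> has derivative 0. The last claim thus bounds the pole of
  the differential \<open>df/f\<close> at the point.
\<close>

lemma local_divisibility:
  assumes char: "(3::'a) = 0" and two: "(2::'a) \<noteq> 0"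
    and surj: "\<forall>n::int. \<exists>f. f \<noteq> (0, 0) \<and> fls_subdegree (embed f) = n"
    and div3: "\<forall>v \<in> places (function_field F) constants. 3 dvd v (to_fract a, to_fract (b * F))"
    and nz: "a \<noteq> 0 \<or> b \<noteq> 0"
    and dx: "fls_deriv x \<noteq> 0"
  defines "N \<equiv> a\<^sup>2 - b\<^sup>2 * F ^ 3" and "W \<equiv> a * pderiv b - pderiv a * b"
  shows "N \<noteq> 0" and "3 dvd fls_subdegree (laurent_eval x N)"
    and "W \<noteq> 0 \<Longrightarrow> fls_subdegree (laurent_eval x N) \<le>
           fls_subdegree (laurent_eval x W) + 3 * fls_subdegree y + fls_subdegree (fls_deriv x)"
proof -
  interpret m: laurent_point F x "- y" by (rule laurent_point_uminus)
  define f where "f = (to_fract a, to_fract (b * F))"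
  have f0: "f \<noteq> (0, 0)" using nz F_nonzero by (auto simp: f_def)
  define A B z g h where "A = laurent_eval x a" and "B = laurent_eval x b" and "z = y ^ 3"
    and "g = A + B * z" and "h = A - B * z"
  have g: "embed f = g"
    unfolding f_def embed_poly
    by (simp add: g_def A_def B_def z_def y_square[symmetric] power3_eq_cube power2_eq_square)
  have h: "m.embed f = h"
    unfolding f_def m.embed_poly
    by (simp add: h_def A_def B_def z_def y_square[symmetric] power3_eq_cube power2_eq_square)
  have g0: "g \<noteq> 0" and h0: "h \<noteq> 0" using embed_nonzero[OF f0] m.embed_nonzero[OF f0] g h by auto
  have surj': "\<exists>f. f \<noteq> (0, 0) \<and> fls_subdegree (m.embed f) = n" for n
  proof -
    obtain f' where "f' \<noteq> (0, 0)" "fls_subdegree (embed f') = n" using surj by blast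
    then show ?thesis using embed_uminus[of "fst f'" "snd f'"]
      by (intro exI[of _ "(fst f', - snd f')"]) (auto simp: prod_eq_iff)
  qed
  have dg: "3 dvd fls_subdegree g"
    using bspec[OF div3 place_in_places, folded f_def] surj place_eq[OF f0] g by simp
  have dh: "3 dvd fls_subdegree h"
    using bspec[OF div3 m.place_in_places, folded f_def] surj' m.place_eq[OF f0] h by simp
  have N: "laurent_eval x N = g * h"
  proof -
    have "laurent_eval x F ^ 3 = z * z"
      by (simp add: y_square[symmetric] z_def flip: power_mult power_add)
    then show ?thesis
      by (simp add: N_def g_def h_def A_def B_def power2_eq_square algebra_simps)
  qed
  then show "N \<noteq> 0" using g0 h0 by auto
  show "3 dvd fls_subdegree (laurent_eval x N)" using N g0 h0 dg dh by simp
  show "fls_subdegree (laurent_eval x N) \<le>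
           fls_subdegree (laurent_eval x W) + 3 * fls_subdegree y + fls_subdegree (fls_deriv x)"
    if W: "W \<noteq> 0"
  proof -
    have "fls_deriv z = 0"
    proof -
      have "(3::'a fls) = fls_const 3" by (metis fls_const_numeral)
      then have 3: "(3::'a fls) = 0" using char by simp
      have "fls_deriv z = 3 * (y * y * fls_deriv y)"
        by (simp add: z_def power3_eq_cube algebra_simps)
      then show ?thesis using 3 by simp
    qed
    then have dgh: "fls_deriv g * h - g * fls_deriv h = 2 * (laurent_eval x W * z * fls_deriv x)"
      unfolding g_def h_def W_def A_def B_def
      by (simp add: fls_deriv_laurent_eval algebra_simps)
    have two': "(2::'a fls) \<noteq> 0" using two by (rule fls_two_neq_0)
    have nz: "2 * (laurent_eval x W * z * fls_deriv x) \<noteq> 0"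
      using two' W eval_nonzero y_nonzero dx by (simp add: z_def)
    have ge: "fls_subdegree (fls_deriv g' * h') \<ge> fls_subdegree g' + fls_subdegree h'"
      if "3 dvd fls_subdegree g'" "fls_deriv g' * h' \<noteq> 0" for g' h' :: "'a fls"
      using fls_deriv_subdegree_char3[OF char that(1)] that(2) by simp
    have "fls_subdegree (fls_deriv g * h - g * fls_deriv h) \<ge> fls_subdegree g + fls_subdegree h"
    proof (rule fls_subdegree_geI)
      show "fls_deriv g * h - g * fls_deriv h \<noteq> 0" using nz dgh by simp
      fix k assume k: "k < fls_subdegree g + fls_subdegree h"
      have "fls_nth (fls_deriv g * h) k = 0"
        using ge[OF dg, of h] k by (cases "fls_deriv g * h = 0") (simp_all only: fls_zero_nth, simp add: fls_eq0_below_subdegree)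
      moreover have "fls_nth (fls_deriv h * g) k = 0"
        using ge[OF dh, of g] k by (cases "fls_deriv h * g = 0") (simp_all only: fls_zero_nth, simp add: fls_eq0_below_subdegree)
      ultimately show "fls_nth (fls_deriv g * h - g * fls_deriv h) k = 0"
        by (simp add: mult.commute)
    qed
    moreover have "fls_subdegree (2 * (laurent_eval x W * z * fls_deriv x)) =
        fls_subdegree (laurent_eval x W) + 3 * fls_subdegree y + fls_subdegree (fls_deriv x)"
      using nz by (simp add: z_def fls_subdegree_pow)
    ultimately show ?thesis using N g0 h0 dgh by simp
  qed
qed

end

section \<open>Regularity of the logarithmic differential\<close>

text \<open>
  A simple root of \<open>F\<close> would have both even and odd multiplicity.
\<close>

lemma squarefree_not_square:
  fixes F p q :: "'a::alg_closed_field poly"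
  assumes sf: "rsquarefree F" and deg: "degree F > 0" and e: "p\<^sup>2 = q\<^sup>2 * F"
  shows "q = 0"
proof (rule ccontr)
  assume q: "q \<noteq> 0"
  obtain c where c: "poly F c = 0" using alg_closed_imp_poly_has_root[OF deg] by blast
  have F: "F \<noteq> 0" using deg by auto
  then have "order c F = 1" using sf c unfolding rsquarefree_def by (metis order_root)
  moreover have "q\<^sup>2 * F \<noteq> 0" using q F by simp
  then have "p \<noteq> 0" using e by auto
  then have "order c (p\<^sup>2) = 2 * order c p" by (simp add: power2_eq_square order_mult)
  moreover have "order c (q\<^sup>2 * F) = 2 * order c q + order c F"
    using q F order_mult[of "q\<^sup>2" F c] order_mult[of q q c] by (simp add: power2_eq_square)
  ultimately have "2 * order c p = 2 * order c q + 1" using e by simp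
  then show False by presburger
qed

lemma laurent_point_unramified:
  fixes F :: "'a::alg_closed_field poly"
  assumes two: "(2::'a) \<noteq> 0" and sf: "rsquarefree F" and deg: "degree F > 0" and c: "poly F c \<noteq> 0"
  obtains y where "laurent_point F (fls_const c + fls_X) y" "fls_subdegree y = 0"
proof -
  let ?x = "fls_const c + fls_X"
  have x: "fls_subdegree (?x - fls_const c) = 1" by simp
  obtain y where "y\<^sup>2 = laurent_eval ?x F" "fls_subdegree y = 0"
    using fls_sqrt_of_unit_exists[OF two laurent_eval_finite_point_unit[of ?x c F]] x c by auto
  moreover have "laurent_eval ?x p \<noteq> 0" if "p \<noteq> 0" for p
    using laurent_eval_finite_point(1)[of ?x c p] x that by simp
  moreover have "F \<noteq> 0" using deg by auto
  ultimately have "laurent_point F ?x y"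
    unfolding laurent_point_def using squarefree_not_square[OF sf deg] by blast
  then show ?thesis using \<open>fls_subdegree y = 0\<close> by (rule that)
qed

text \<open>
  At a root \<open>c\<close> of \<open>F = (X - c)G\<close> the parameter is \<open>t\<close> with \<open>x = c + t\<^sup>2\<close>, which makes \<open>F(x) = t\<^sup>2G(x)\<close> a square.
\<close>

lemma laurent_point_ramified:
  fixes F :: "'a::alg_closed_field poly"
  assumes two: "(2::'a) \<noteq> 0" and sf: "rsquarefree F" and deg: "degree F > 0" and c: "poly F c = 0"
  obtains y where "laurent_point F (fls_const c + fls_X\<^sup>2) y" "fls_subdegree y = 1"
proof -
  let ?x = "fls_const c + fls_X\<^sup>2"
  have x: "fls_subdegree (?x - fls_const c) = 2" by simp
  have F: "F \<noteq> 0" using deg by auto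
  then have "order c F = 1" using sf c unfolding rsquarefree_def by (metis order_root)
  then obtain G where G: "F = [:-c, 1:] * G" "\<not> [:-c, 1:] dvd G"
    using order_decomp[OF F, of c] by auto
  then have "poly G c \<noteq> 0" by (simp add: poly_eq_0_iff_dvd)
  then obtain r where r: "r\<^sup>2 = laurent_eval ?x G" "r \<noteq> 0" "fls_subdegree r = 0"
    using fls_sqrt_of_unit_exists[OF two laurent_eval_finite_point_unit[of ?x c G]] x by auto
  have "laurent_eval ?x [:-c, 1:] = fls_X\<^sup>2" by simp
  then have "(fls_X * r)\<^sup>2 = laurent_eval ?x F"
    unfolding G(1) laurent_eval_mult power_mult_distrib r(1) by simp
  moreover have "fls_subdegree (fls_X * r) = 1" using r by simp
  ultimately show ?thesis
    using that[of "fls_X * r"] laurent_eval_finite_point(1)[of ?x c] squarefree_not_square[OF sf deg] F x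
    unfolding laurent_point_def by (metis zero_less_numeral)
qed

lemma laurent_point_infinity:
  fixes F :: "'a::alg_closed_field poly"
  assumes two: "(2::'a) \<noteq> 0" and sf: "rsquarefree F" and deg: "degree F = 6"
  obtains y where "laurent_point F fls_X_inv y" "fls_subdegree y = - 3"
proof -
  have F: "F \<noteq> 0" using deg by auto
  then have "poly (reflect_poly F) 0 \<noteq> 0" by simp
  then obtain r where r: "r\<^sup>2 = laurent_eval fls_X (reflect_poly F)" "r \<noteq> 0" "fls_subdegree r = 0"
    using fls_sqrt_of_unit_exists[OF two laurent_eval_finite_point_unit[of fls_X 0 "reflect_poly F"]]
    by auto
  have "(fls_X_inv ^ 3 * r)\<^sup>2 = fls_X_inv ^ 6 * (fls_X ^ 6 * laurent_eval fls_X_inv F)"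
    by (simp add: power_mult_distrib r laurent_eval_infinity[of F, unfolded deg] flip: power_mult)
  also have "\<dots> = (fls_X_inv * fls_X) ^ 6 * laurent_eval fls_X_inv F"
    by (simp only: power_mult_distrib mult.assoc)
  finally have "(fls_X_inv ^ 3 * r)\<^sup>2 = laurent_eval fls_X_inv F"
    by (simp add: fls_inverse_X[symmetric])
  moreover have "fls_subdegree (fls_X_inv ^ 3 * r) = - 3" using r by simp
  ultimately show ?thesis
    using that[of "fls_X_inv ^ 3 * r"] laurent_eval_infinity_subdegree(1) squarefree_not_square[OF sf] F deg
    unfolding laurent_point_def by (metis zero_less_numeral)
qed

lemma coeff_second_pderiv:
  fixes p :: "'a::field poly"
  shows "coeff (pderiv (pderiv p)) n = of_nat ((n + 1) * (n + 2)) * coeff p (n + 2)"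
  by (simp add: coeff_pderiv algebra_simps)

text \<open>
  If \<open>3D = div f\<close> with \<open>f = a + bFy\<close>, then \<open>df/f = u dx/y\<close> is regular at every place and so \<open>u\<close> is a polynomial
  of degree at most 1. At the finite points all roots of the norm \<open>N\<close> have multiplicity divisible by 3, so
  \<open>N\<close> is a cube and has derivative 0, and \<open>N\<close> divides \<open>WF\<^sup>2\<close>. The degree of \<open>u\<close> is bounded by
  the behaviour at infinity if \<open>deg F = 6\<close>, and by the Cartier equation if \<open>deg F = 5\<close>.
\<close>

theorem logarithmic_differential_holomorphic:
  fixes F a b :: "'a::alg_closed_field poly"
  assumes char: "CHAR('a) = 3" and sf: "rsquarefree F" and deg: "degree F = 5 \<or> degree F = 6"
    and div3: "\<forall>v \<in> places (function_field F) constants. 3 dvd v (to_fract a, to_fract (b * F))"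
    and nz: "a \<noteq> 0 \<or> b \<noteq> 0"
  obtains u where "degree u \<le> 1" "a\<^sup>2 - b\<^sup>2 * F ^ 3 \<noteq> 0"
    "(a\<^sup>2 - b\<^sup>2 * F ^ 3) * u = (a * pderiv b - pderiv a * b) * F\<^sup>2"
    "a * pderiv a = F ^ 3 * (b * pderiv b)"
    "pderiv (pderiv (u * F)) = - (u ^ 3)"
proof -
  note three = three_eq_0[OF char] and two = two_neq_0[OF char]
  have F: "F \<noteq> 0" and degF: "degree F > 0" using deg by auto
  define N W where "N = a\<^sup>2 - b\<^sup>2 * F ^ 3" and "W = a * pderiv b - pderiv a * b"
  have local: "N \<noteq> 0 \<and> 3 dvd order c N \<and> (W \<noteq> 0 \<longrightarrow> order c N \<le> order c (W * F\<^sup>2))" for c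
  proof (cases "poly F c = 0")
    case False
    obtain y where y: "laurent_point F (fls_const c + fls_X) y" "fls_subdegree y = 0"
      using laurent_point_unramified[OF two sf degF False] .
    interpret laurent_point F "fls_const c + fls_X" y by (rule y(1))
    have ord: "fls_subdegree (laurent_eval (fls_const c + fls_X) p) = int (order c p)" if "p \<noteq> 0" for p
      using laurent_eval_finite_point(2)[of "fls_const c + fls_X" c p] that by simp
    have surj: "\<forall>n. \<exists>f. f \<noteq> (0, 0) \<and> fls_subdegree (embed f) = n"
      by (intro allI, rule embed_surj_unramified[of "[:-c, 1:]"]) simp_all
    note loc = local_divisibility[where a = a and b = b, OF three two surj div3 nz, folded N_def W_def]
    have "N \<noteq> 0" "3 dvd int (order c N)" using loc(1,2) ord by simp_all
    moreover from this(2) have "3 dvd order c N" by presburger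
    moreover have "order c N \<le> order c (W * F\<^sup>2)" if "W \<noteq> 0"
    proof -
      have "order c N \<le> order c W" using loc(1) loc(3)[OF _ that] ord that y(2) by simp
      then show ?thesis using that F by (simp add: order_mult)
    qed
    ultimately show ?thesis by blast
  next
    case True
    obtain y where y: "laurent_point F (fls_const c + fls_X\<^sup>2) y" "fls_subdegree y = 1"
      using laurent_point_ramified[OF two sf degF True] .
    interpret laurent_point F "fls_const c + fls_X\<^sup>2" y by (rule y(1))
    have ord: "fls_subdegree (laurent_eval (fls_const c + fls_X\<^sup>2) p) = int (order c p) * 2" if "p \<noteq> 0" for p
      using laurent_eval_finite_point(2)[of "fls_const c + fls_X\<^sup>2" c p] that by simp
    have surj: "\<forall>n. \<exists>f. f \<noteq> (0, 0) \<and> fls_subdegree (embed f) = n"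
      by (intro allI, rule embed_surj_ramified[of "[:-c, 1:]"]) (simp_all add: y)
    have two': "(2::'a fls) \<noteq> 0" using two by (rule fls_two_neq_0)
    have dx: "fls_deriv (fls_const c + fls_X\<^sup>2) = 2 * fls_X"
      by (simp add: power2_eq_square)
    have dx0: "fls_deriv (fls_const c + fls_X\<^sup>2) \<noteq> 0" unfolding dx using two' by simp
    note loc = local_divisibility[where a = a and b = b, OF three two surj div3 nz dx0, folded N_def W_def]
    have "N \<noteq> 0" using loc(1) by simp
    have "3 dvd int (order c N) * 2" using loc(1,2) ord by simp
    then have "3 dvd int (order c N)" by presburger
    then have "3 dvd order c N" by presburger
    moreover have "order c N \<le> order c (W * F\<^sup>2)" if "W \<noteq> 0"
    proof -
      have "fls_subdegree (2 * fls_X :: 'a fls) = 1" using two' by simp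
      then have "order c N \<le> order c W + 2" using loc(1) loc(3)[OF that, unfolded dx] ord that y(2) by simp
      moreover have "order c F = 1" using sf True unfolding rsquarefree_def by (metis order_root)
      ultimately show ?thesis using that F by (simp add: order_mult power2_eq_square)
    qed
    ultimately show ?thesis using \<open>N \<noteq> 0\<close> by simp
  qed
  then have N0: "N \<noteq> 0" by blast
  obtain n where "N = n ^ 3" using cube_if_orders_divisible[OF N0] local by blast
  then have "pderiv N = 0" using pderiv_cube_eq_0[OF three] by simp
  moreover have "pderiv N = 2 * (a * pderiv a - F ^ 3 * (b * pderiv b))"
    unfolding N_def by (simp add: pderiv_diff pderiv_mult pderiv_cube_eq_0[OF three] power2_eq_square algebra_simps)
  moreover have "(2::'a poly) \<noteq> 0" using two by (metis numeral_poly pCons_eq_0_iff)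
  ultimately have tr: "a * pderiv a = F ^ 3 * (b * pderiv b)" by simp
  have "N dvd W * F\<^sup>2"
  proof (cases "W = 0")
    case False
    then show ?thesis using local N0 F by (intro dvd_if_order_le) auto
  qed simp
  then obtain u where u: "W * F\<^sup>2 = N * u" by blast
  have cartier: "pderiv (pderiv (u * F)) = - (u ^ 3)"
    using cartier_equation[OF three tr] N0 u unfolding N_def W_def by simp
  have "degree u \<le> 1"
  proof (cases "u = 0")
    case False
    then have W0: "W \<noteq> 0" using u N0 by auto
    from deg show ?thesis
    proof
      assume 6: "degree F = 6"
      obtain y where y: "laurent_point F fls_X_inv y" "fls_subdegree y = - 3"
        using laurent_point_infinity[OF two sf 6] .
      interpret laurent_point F fls_X_inv y by (rule y(1))
      have surj: "\<forall>n. \<exists>f. f \<noteq> (0, 0) \<and> fls_subdegree (embed f) = n"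
        by (intro allI, rule embed_surj_unramified[of "[:0, 1:]"]) simp_all
      have dx0: "fls_deriv (fls_X_inv :: 'a fls) \<noteq> 0" by simp
      have "fls_subdegree (fls_deriv (fls_X_inv :: 'a fls)) = - 2" by simp
      then have "degree N \<ge> degree W + 11"
        using local_divisibility(3)[where a = a and b = b, OF three two surj div3 nz dx0, folded N_def W_def] W0 N0 y(2)
        by (simp add: laurent_eval_infinity_subdegree(2))
      moreover have "degree (W * F\<^sup>2) = degree W + 12"
        using W0 F 6 by (simp add: degree_mult_eq degree_power_eq)
      moreover have "degree (N * u) = degree N + degree u"
        using N0 False by (rule degree_mult_eq)
      ultimately show ?thesis using u by simp
    next
      assume 5: "degree F = 5"
      have "degree (u ^ 3) = 3 * degree u" using False by (simp add: degree_power_eq)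
      then have "coeff (u ^ 3) (3 * degree u) \<noteq> 0"
        using False by (metis leading_coeff_0_iff power_not_zero)
      then have "coeff (pderiv (pderiv (u * F))) (3 * degree u) \<noteq> 0"
        unfolding cartier by simp
      then have "coeff (u * F) (3 * degree u + 2) \<noteq> 0"
        unfolding coeff_second_pderiv by simp
      then have "3 * degree u + 2 \<le> degree (u * F)" by (rule le_degree)
      moreover have "degree (u * F) = degree u + 5" using False F 5 by (simp add: degree_mult_eq)
      ultimately show ?thesis by simp
    qed
  qed simp
  then show ?thesis using that[of u] N0 u tr cartier unfolding N_def W_def by simp
qed

section \<open>Counting the solutions of the Cartier equations\<close>

lemma card_cube_eq_scaled_le_3:
  fixes t :: "'a::field"
  shows "finite {z. z ^ 3 = t * z} \<and> card {z. z ^ 3 = t * z} \<le> 3"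
proof -
  define p where "p = monom 1 3 - [:0, t:]"
  have "coeff p 3 = 1" by (simp add: p_def coeff_pCons numeral_3_eq_3)
  then have p0: "p \<noteq> 0" by auto
  have "degree p \<le> 3" unfolding p_def by (intro degree_diff_le) (simp_all add: degree_monom_le)
  moreover have "{z. z ^ 3 = t * z} = {z. poly p z = 0}"
    by (auto simp: p_def poly_monom mult.commute)
  moreover have "card {z. poly p z = 0} \<le> degree p" by (rule card_poly_roots_bound[OF p0])
  ultimately show ?thesis using poly_roots_finite[OF p0] by auto
qed

lemma cube_inj_char3:
  fixes x y :: "'a::field"
  assumes "(3::'a) = 0" "x ^ 3 = y ^ 3"
  shows "x = y"
proof -
  have "(x - y) ^ 3 + y ^ 3 = (x - y + y) ^ 3"
    by (rule freshmans_dream_3[OF assms(1), symmetric])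
  then have "(x - y) ^ 3 = 0" using assms(2) by simp
  then show ?thesis by simp
qed

text \<open>
  A matrix of rank at most 1 is a product of a column \<open>(p, q)\<close> and a row \<open>(s, t)\<close>. With \<open>z = s\<alpha> + t\<beta>\<close> the
  equations become \<open>\<alpha>\<^sup>3 = pz\<close> and \<open>\<beta>\<^sup>3 = qz\<close>, so \<open>z\<close> determines the solution because cube roots are unique, and
  \<open>z\<^sup>3 = (s\<^sup>3p + t\<^sup>3q)z\<close> leaves at most three values for \<open>z\<close>.
\<close>

lemma frobenius_linear_solutions:
  fixes c1 c2 c4 c5 :: "'a::field"
  assumes three: "(3::'a) = 0" and det: "c1 * c5 = c2 * c4"
  defines "S \<equiv> {(\<alpha>, \<beta>). \<alpha> ^ 3 = c2 * \<alpha> + c1 * \<beta> \<and> \<beta> ^ 3 = c5 * \<alpha> + c4 * \<beta>}"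
  shows "finite S \<and> card S \<le> 3"
proof -
  \<comment> \<open>The factorization of the singular coefficient matrix.\<close>
  obtain p q s t :: 'a where c: "c2 = p * s" "c1 = p * t" "c5 = q * s" "c4 = q * t"
  proof (cases "c2 = 0 \<and> c1 = 0")
    case True
    then show ?thesis using that[of 0 c5 c4 1] by simp
  next
    case False
    show ?thesis
    proof (cases "c2 = 0")
      case True
      then have "c1 \<noteq> 0" "c5 = 0" using False det by auto
      then show ?thesis using that[of 1 c2 c1 "c4 / c1"] True by simp
    next
      case c2: False
      then have "c4 = c5 / c2 * c1" using det by (simp add: field_simps)
      then show ?thesis using that[of 1 c2 c1 "c5 / c2"] c2 by simp
    qed
  qed
  define \<tau> where "\<tau> = s ^ 3 * p + t ^ 3 * q"
  define w where "w = (\<lambda>(\<alpha>, \<beta>). s * \<alpha> + t * \<beta>)"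
  have key: "\<alpha> ^ 3 = p * w (\<alpha>, \<beta>)" "\<beta> ^ 3 = q * w (\<alpha>, \<beta>)" if "(\<alpha>, \<beta>) \<in> S" for \<alpha> \<beta>
    using that by (simp_all add: S_def w_def c algebra_simps)
  have "w ` S \<subseteq> {z. z ^ 3 = \<tau> * z}"
  proof safe
    fix \<alpha> \<beta> assume "(\<alpha>, \<beta>) \<in> S"
    have "w (\<alpha>, \<beta>) ^ 3 = s ^ 3 * \<alpha> ^ 3 + t ^ 3 * \<beta> ^ 3"
      using freshmans_dream_3[OF three, of "s * \<alpha>" "t * \<beta>"]
      by (simp add: w_def power_mult_distrib)
    then show "w (\<alpha>, \<beta>) ^ 3 = \<tau> * w (\<alpha>, \<beta>)"
      using key[OF \<open>(\<alpha>, \<beta>) \<in> S\<close>] by (simp add: \<tau>_def algebra_simps)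
  qed
  moreover have "inj_on w S"
  proof (rule inj_onI, safe)
    fix \<alpha> \<beta> \<alpha>' \<beta>' assume "(\<alpha>, \<beta>) \<in> S" "(\<alpha>', \<beta>') \<in> S" and eq: "w (\<alpha>, \<beta>) = w (\<alpha>', \<beta>')"
    then show "\<alpha> = \<alpha>'" "\<beta> = \<beta>'"
      using key[of \<alpha> \<beta>] key[of \<alpha>' \<beta>'] cube_inj_char3[OF three] by metis+
  qed
  ultimately show ?thesis
    using card_cube_eq_scaled_le_3[of \<tau>]
    by (meson card_inj_on_le finite_subset inj_on_finite order_trans)
qed

section \<open>Principal divisors and divisor classes\<close>

lemma carrier_function_field [simp]: "carrier (function_field F) = UNIV"
  and zero_function_field [simp]: "\<zero>\<^bsub>function_field F\<^esub> = (0, 0)"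
  and one_function_field [simp]: "\<one>\<^bsub>function_field F\<^esub> = (1, 0)"
  and mult_function_field: "(a, b) \<otimes>\<^bsub>function_field F\<^esub> (c, d) = (a * c + b * d * to_fract F, a * d + b * c)"
  by (simp_all add: function_field_def)

lemma fract_no_square:
  fixes F :: "'a::field poly"
  assumes "\<forall>p q. p\<^sup>2 = q\<^sup>2 * F \<longrightarrow> q = 0" and e: "r\<^sup>2 = s\<^sup>2 * to_fract F"
  shows "s = 0"
proof -
  obtain p q where r: "r = Fract p q" "q \<noteq> 0" by (rule Fract_cases)
  obtain p' q' where s: "s = Fract p' q'" "q' \<noteq> 0" by (rule Fract_cases)
  have "(p * q')\<^sup>2 = (p' * q)\<^sup>2 * F"
    using e r s by (simp add: to_fract_def power2_eq_square eq_fract algebra_simps)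
  then have "p' * q = 0" using assms(1) by blast
  then show ?thesis using r s by (simp add: fract_collapse)
qed

text \<open>
  The norm \<open>a\<^sup>2 - b\<^sup>2F\<close> is what makes the ring of pairs a field.
\<close>

lemma function_field_norm_nonzero:
  fixes F :: "'a::field poly"
  assumes F: "\<forall>p q. p\<^sup>2 = q\<^sup>2 * F \<longrightarrow> q = 0" and nz: "(a, b) \<noteq> (0, 0)"
  shows "a\<^sup>2 - b\<^sup>2 * to_fract F \<noteq> 0"
proof
  assume "a\<^sup>2 - b\<^sup>2 * to_fract F = 0"
  then have "a\<^sup>2 = b\<^sup>2 * to_fract F" by simp
  moreover from F this have "b = 0" by (rule fract_no_square)
  ultimately show False using nz by simp
qed

lemma function_field_inverse:
  fixes F :: "'a::field poly"
  assumes F: "\<forall>p q. p\<^sup>2 = q\<^sup>2 * F \<longrightarrow> q = 0" and nz: "f \<noteq> (0, 0)"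
  obtains g where "g \<noteq> (0, 0)" "f \<otimes>\<^bsub>function_field F\<^esub> g = (1, 0)"
proof -
  obtain a b where f: "f = (a, b)" by (cases f)
  define n where "n = a\<^sup>2 - b\<^sup>2 * to_fract F"
  have n: "n \<noteq> 0" unfolding n_def using function_field_norm_nonzero[OF F] nz f by blast
  have "a * (a / n) + b * (- b / n) * to_fract F = n / n"
    by (simp only: n_def power2_eq_square diff_divide_distrib) (simp add: algebra_simps)
  then have "f \<otimes>\<^bsub>function_field F\<^esub> (a / n, - b / n) = (1, 0)"
    using n by (simp add: f mult_function_field)
  moreover have "(a / n, - b / n) \<noteq> (0, 0)" using n nz f by simp
  ultimately show ?thesis using that by blast
qed

lemma function_field_mult_nonzero:
  fixes F :: "'a::field poly"
  assumes F: "\<forall>p q. p\<^sup>2 = q\<^sup>2 * F \<longrightarrow> q = 0" and nz: "f \<noteq> (0, 0)" "g \<noteq> (0, 0)"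
  shows "f \<otimes>\<^bsub>function_field F\<^esub> g \<noteq> (0, 0)"
proof
  assume e: "f \<otimes>\<^bsub>function_field F\<^esub> g = (0, 0)"
  obtain a b where f: "f = (a, b)" by (cases f)
  obtain c d where g: "g = (c, d)" by (cases g)
  have "a * c + b * d * to_fract F = 0" "a * d + b * c = 0"
    using e by (simp_all add: f g mult_function_field)
  then have "(a\<^sup>2 - b\<^sup>2 * to_fract F) * (c\<^sup>2 - d\<^sup>2 * to_fract F) = 0"
    by Groebner_Basis.algebra
  then show False
    using function_field_norm_nonzero[OF F] nz f g by fastforce
qed

lemma place_mult:
  assumes "v \<in> places (function_field F) k" "f \<noteq> (0, 0)" "g \<noteq> (0, 0)"
  shows "v (f \<otimes>\<^bsub>function_field F\<^esub> g) = v f + v g"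
  using assms by (simp add: places_def)

lemma place_one:
  assumes "v \<in> places (function_field F) k"
  shows "v (1, 0) = 0"
  using place_mult[OF assms, of "(1, 0)" "(1, 0)"] by (simp add: mult_function_field)

lemma principal_divisors_normal:
  fixes F :: "'a::field poly"
  assumes F: "\<forall>p q. p\<^sup>2 = q\<^sup>2 * F \<longrightarrow> q = 0"
  shows "principal_divisors (function_field F) k \<lhd> div_group (function_field F) k"
proof -
  let ?L = "function_field F"
  let ?G = "div_group ?L k"
  interpret comm_group ?G unfolding div_group_def by (rule abelian_free_Abelian_group)
  have "subgroup (principal_divisors ?L k) ?G"
  proof (rule subgroupI)
    show "principal_divisors ?L k \<subseteq> carrier ?G" by (auto simp: principal_divisors_def)
    have "0 \<in> principal_divisors ?L k"
      by (auto simp: principal_divisors_def div_group_def place_one intro!: bexI[of _ "(1, 0)"])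
    then show "principal_divisors ?L k \<noteq> {}" by blast
  next
    fix D assume D: "D \<in> principal_divisors ?L k"
    then obtain f where f: "f \<noteq> (0, 0)" "\<forall>v \<in> places ?L k. Poly_Mapping.lookup D v = v f"
      by (auto simp: principal_divisors_def)
    obtain g where g: "g \<noteq> (0, 0)" "f \<otimes>\<^bsub>?L\<^esub> g = (1, 0)"
      using function_field_inverse[OF F f(1)] .
    have "Poly_Mapping.lookup (- D) v = v g" if "v \<in> places ?L k" for v
      using place_mult[OF that f(1) g(1)] place_one[OF that] f(2) that g(2) by simp
    moreover have "inv\<^bsub>?G\<^esub> D = - D" "Poly_Mapping.keys D \<subseteq> places ?L k"
      using D by (auto simp: principal_divisors_def div_group_def)
    ultimately show "inv\<^bsub>?G\<^esub> D \<in> principal_divisors ?L k"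
      using g(1) by (auto simp: principal_divisors_def div_group_def)
  next
    fix D E assume D: "D \<in> principal_divisors ?L k" and E: "E \<in> principal_divisors ?L k"
    then obtain f g where f: "f \<noteq> (0, 0)" "\<forall>v \<in> places ?L k. Poly_Mapping.lookup D v = v f"
      and g: "g \<noteq> (0, 0)" "\<forall>v \<in> places ?L k. Poly_Mapping.lookup E v = v g"
      by (auto simp: principal_divisors_def)
    have "Poly_Mapping.lookup (D + E) v = v (f \<otimes>\<^bsub>?L\<^esub> g)" if "v \<in> places ?L k" for v
      using f g that place_mult by (simp add: lookup_add place_mult)
    moreover have "D \<otimes>\<^bsub>?G\<^esub> E \<in> carrier ?G"
      using D E by (intro m_closed) (auto simp: principal_divisors_def)
    ultimately show "D \<otimes>\<^bsub>?G\<^esub> E \<in> principal_divisors ?L k"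
      using function_field_mult_nonzero[OF F f(1) g(1)]
      by (auto simp: principal_divisors_def div_group_def)
  qed
  then show ?thesis by (rule subgroup_imp_normal)
qed

lemma nat_pow_3: "x [^]\<^bsub>G\<^esub> (3::nat) = ((\<one>\<^bsub>G\<^esub> \<otimes>\<^bsub>G\<^esub> x) \<otimes>\<^bsub>G\<^esub> x) \<otimes>\<^bsub>G\<^esub> x"
  by (simp add: nat_pow_def numeral_3_eq_3)

text \<open>
  The third power of the class of \<open>D\<close> in the quotient group is the class of \<open>D + D + D\<close>; it is trivial only if
  this divisor is principal.
\<close>

lemma three_torsion_class:
  fixes F :: "'a::field poly"
  assumes F: "\<forall>p q. p\<^sup>2 = q\<^sup>2 * F \<longrightarrow> q = 0"
    and c: "c \<in> carrier (torsion_part (class_group0 (function_field F) k) 3)"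
  obtains D f where "D \<in> carrier (div_group (function_field F) k)"
    "c = principal_divisors (function_field F) k #>\<^bsub>div_group (function_field F) k\<^esub> D"
    "f \<noteq> (0, 0)" "\<And>v. v \<in> places (function_field F) k \<Longrightarrow> v f = 3 * Poly_Mapping.lookup D v"
proof -
  let ?L = "function_field F"
  define G H where "G = div_group ?L k" and "H = principal_divisors ?L k"
  interpret normal H G unfolding G_def H_def by (rule principal_divisors_normal[OF F])
  have G: "x \<otimes>\<^bsub>G\<^esub> y = x + y" for x y by (simp add: G_def div_group_def)
  obtain D where D: "D \<in> carrier G" "c = H #>\<^bsub>G\<^esub> D"
    and c3: "c [^]\<^bsub>class_group0 ?L k\<^esub> (3::nat) = \<one>\<^bsub>class_group0 ?L k\<^esub>"
    using c unfolding torsion_part_def class_group0_def G_def H_def by auto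
  have one: "\<one>\<^bsub>class_group0 ?L k\<^esub> = H"
    by (simp add: class_group0_def class_group_def FactGroup_def H_def)
  have mult: "x \<otimes>\<^bsub>class_group0 ?L k\<^esub> y = x <#>\<^bsub>G\<^esub> y" for x y
    by (simp add: class_group0_def class_group_def FactGroup_def G_def)
  have "H = H #>\<^bsub>G\<^esub> \<one>\<^bsub>G\<^esub>" using coset_mult_one[OF subset] by simp
  then have one_D: "H <#>\<^bsub>G\<^esub> (H #>\<^bsub>G\<^esub> D) = H #>\<^bsub>G\<^esub> D"
    using rcos_sum[of "\<one>\<^bsub>G\<^esub>" D] D(1) by simp
  have DD: "D \<otimes>\<^bsub>G\<^esub> D \<in> carrier G" using D(1) by (rule m_closed[OF _ D(1)])
  have "c [^]\<^bsub>class_group0 ?L k\<^esub> (3::nat) = ((H <#>\<^bsub>G\<^esub> c) <#>\<^bsub>G\<^esub> c) <#>\<^bsub>G\<^esub> c"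
    unfolding nat_pow_3 one mult ..
  also have "\<dots> = H #>\<^bsub>G\<^esub> (D \<otimes>\<^bsub>G\<^esub> D \<otimes>\<^bsub>G\<^esub> D)"
    unfolding D(2) one_D rcos_sum[OF D(1) D(1)] rcos_sum[OF DD D(1)] ..
  finally have "c [^]\<^bsub>class_group0 ?L k\<^esub> (3::nat) = H #>\<^bsub>G\<^esub> (D \<otimes>\<^bsub>G\<^esub> D \<otimes>\<^bsub>G\<^esub> D)" .
  then have "D \<otimes>\<^bsub>G\<^esub> D \<otimes>\<^bsub>G\<^esub> D \<in> H"
    using c3 one m_closed[OF DD D(1)] is_subgroup by (metis coset_join1)
  then obtain f where "f \<noteq> (0, 0)" "\<And>v. v \<in> places ?L k \<Longrightarrow> Poly_Mapping.lookup (D + D + D) v = v f"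
    unfolding H_def principal_divisors_def G by auto
  then show ?thesis using that[of D f] D by (simp add: G_def H_def lookup_add)
qed

lemma class_eqI:
  fixes F :: "'a::field poly"
  assumes F: "\<forall>p q. p\<^sup>2 = q\<^sup>2 * F \<longrightarrow> q = 0"
    and D: "D \<in> carrier (div_group (function_field F) k)"
    and E: "E \<in> carrier (div_group (function_field F) k)"
    and h: "h \<noteq> (0, 0)"
      "\<And>v. v \<in> places (function_field F) k \<Longrightarrow> Poly_Mapping.lookup D v = Poly_Mapping.lookup E v + v h"
  shows "principal_divisors (function_field F) k #>\<^bsub>div_group (function_field F) k\<^esub> D
       = principal_divisors (function_field F) k #>\<^bsub>div_group (function_field F) k\<^esub> E"
proof -
  let ?L = "function_field F"
  define G H where "G = div_group ?L k" and "H = principal_divisors ?L k"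
  interpret normal H G unfolding G_def H_def by (rule principal_divisors_normal[OF F])
  have G: "x \<otimes>\<^bsub>G\<^esub> y = x + y" for x y by (simp add: G_def div_group_def)
  have keys: "D - E \<in> carrier G"
    using D E keys_diff[of D E] by (auto simp: G_def div_group_def)
  then have "D - E \<in> H"
    using h unfolding H_def principal_divisors_def by (auto simp: G_def lookup_minus intro!: bexI[of _ h])
  then have "H #>\<^bsub>G\<^esub> (D - E) = H" using coset_join2[OF keys is_subgroup] by blast
  then have "H #>\<^bsub>G\<^esub> E = (H #>\<^bsub>G\<^esub> (D - E)) #>\<^bsub>G\<^esub> E" by simp
  also have "\<dots> = H #>\<^bsub>G\<^esub> D"
    using coset_mult_assoc[OF subset keys, of E] E by (simp add: G flip: G_def)
  finally show ?thesis by (simp add: G_def H_def)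
qed

section \<open>The 3-torsion of the Jacobian\<close>

lemma place_cube:
  assumes v: "v \<in> places (function_field F) k" and g: "g \<noteq> (0, 0)"
    and F: "\<forall>p q. p\<^sup>2 = q\<^sup>2 * F \<longrightarrow> q = 0"
  shows "g \<otimes>\<^bsub>function_field F\<^esub> (g \<otimes>\<^bsub>function_field F\<^esub> g) \<noteq> (0, 0)"
    "v (g \<otimes>\<^bsub>function_field F\<^esub> (g \<otimes>\<^bsub>function_field F\<^esub> g)) = 3 * v g"
  using place_mult[OF v] function_field_mult_nonzero[OF F] g by auto

text \<open>
  Cubing is additive, and \<open>(\<beta>y)\<^sup>3 = \<beta>\<^sup>3Fy\<close>.
\<close>

lemma cube_in_function_field:
  fixes \<alpha> \<beta> F :: "'a::field poly"
  assumes "(3::'a) = 0"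
  defines "g \<equiv> (to_fract \<alpha>, to_fract \<beta>)"
  shows "g \<otimes>\<^bsub>function_field F\<^esub> (g \<otimes>\<^bsub>function_field F\<^esub> g) = (to_fract (\<alpha> ^ 3), to_fract (\<beta> ^ 3 * F))"
proof -
  have 3: "(3::'a poly) = 0" by (rule poly_three_eq_0) fact
  have "\<alpha> * (\<alpha> * \<alpha> + \<beta> * \<beta> * F) + \<beta> * (\<alpha> * \<beta> + \<beta> * \<alpha>) * F = \<alpha> ^ 3 + 3 * (\<alpha> * \<beta>\<^sup>2 * F)"
    "\<alpha> * (\<alpha> * \<beta> + \<beta> * \<alpha>) + \<beta> * (\<alpha> * \<alpha> + \<beta> * \<beta> * F) = \<beta> ^ 3 * F + 3 * (\<alpha>\<^sup>2 * \<beta>)"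
    by Groebner_Basis.algebra+
  then have "\<alpha> * (\<alpha> * \<alpha> + \<beta> * \<beta> * F) + \<beta> * (\<alpha> * \<beta> + \<beta> * \<alpha>) * F = \<alpha> ^ 3"
    "\<alpha> * (\<alpha> * \<beta> + \<beta> * \<alpha>) + \<beta> * (\<alpha> * \<alpha> + \<beta> * \<beta> * F) = \<beta> ^ 3 * F"
    using 3 by simp_all
  then show ?thesis
    unfolding g_def mult_function_field by (simp flip: to_fract_mult to_fract_add)
qed

text \<open>
  Multiplying \<open>f\<close> by the cube of a common denominator, and of \<open>F\<close>, changes the divisor by three times a principal
  divisor and makes the coordinates of \<open>f\<close> with respect to \<open>1\<close> and \<open>w = Fy\<close> polynomials.
\<close>

lemma polynomial_representative:
  fixes F :: "'a::field poly"
  assumes F0: "F \<noteq> 0" and F: "\<forall>p q. p\<^sup>2 = q\<^sup>2 * F \<longrightarrow> q = 0" and f: "f \<noteq> (0, 0)"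
  obtains a b d where "a \<noteq> 0 \<or> b \<noteq> 0" "d \<noteq> 0"
    "\<And>v. v \<in> places (function_field F) k \<Longrightarrow>
       v (to_fract a, to_fract (b * F)) = v f + 3 * v (to_fract d, 0)"
proof -
  obtain r s where fe: "f = (r, s)" by (cases f)
  obtain p q where r: "r = Fract p q" "q \<noteq> 0" by (rule Fract_cases)
  obtain p' q' where s: "s = Fract p' q'" "q' \<noteq> 0" by (rule Fract_cases)
  \<comment> \<open>The coordinates of \<open>d\<^sup>3f\<close> are \<open>a\<close> and \<open>bF\<close>.\<close>
  define d a b where "d = q * q' * F" and "a = p * (q\<^sup>2 * q' ^ 3 * F ^ 3)" and "b = p' * (q ^ 3 * q'\<^sup>2 * F\<^sup>2)"
  have d: "d \<noteq> 0" using r s F0 by (simp add: d_def)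
  have rq: "r * to_fract q = to_fract p" and sq: "s * to_fract q' = to_fract p'"
    using r s by (simp_all add: to_fract_def eq_fract)
  have "r * to_fract d ^ 3 = to_fract a"
    unfolding d_def a_def power2_eq_square power3_eq_cube to_fract_mult rq[symmetric] by Groebner_Basis.algebra
  moreover have "s * to_fract d ^ 3 = to_fract (b * F)"
    unfolding d_def b_def power2_eq_square power3_eq_cube to_fract_mult sq[symmetric] by Groebner_Basis.algebra
  ultimately have e: "f \<otimes>\<^bsub>function_field F\<^esub> ((to_fract d, 0) \<otimes>\<^bsub>function_field F\<^esub>
      ((to_fract d, 0) \<otimes>\<^bsub>function_field F\<^esub> (to_fract d, 0))) = (to_fract a, to_fract (b * F))"
    by (simp add: fe mult_function_field power3_eq_cube algebra_simps)
  have g: "(to_fract d, 0) \<noteq> (0, 0 :: 'a poly fract)" using d by simp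
  have "a \<noteq> 0 \<or> b \<noteq> 0"
    using f r s F0 unfolding fe a_def b_def by (auto simp: fract_collapse)
  moreover have "v (to_fract a, to_fract (b * F)) = v f + 3 * v (to_fract d, 0)"
    if v: "v \<in> places (function_field F) k" for v
    using place_mult[OF v f place_cube(1)[OF v g F]] place_cube(2)[OF v g F] unfolding e by simp
  ultimately show ?thesis using that d by blast
qed

text \<open>
  By \<open>quotient_derivative_0\<close> the product of \<open>f\<^sub>1\<close> with the conjugate of \<open>f\<^sub>2\<close> has derivative 0, so it is
  the cube of some \<open>g = \<alpha> + \<beta>y\<close>; likewise the norm of \<open>f\<^sub>2\<close> is the cube of some polynomial \<open>\<nu>\<close>. Therefore
  \<open>f\<^sub>1\<nu>\<^sup>3 = f\<^sub>2g\<^sup>3\<close>.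
\<close>

lemma equal_differentials_imp_quotient_cube:
  fixes F :: "'a::alg_closed_field poly"
  assumes char: "CHAR('a) = 3" and F0: "F \<noteq> 0" and F: "\<forall>p q. p\<^sup>2 = q\<^sup>2 * F \<longrightarrow> q = 0"
    and nz1: "a1 \<noteq> 0 \<or> b1 \<noteq> 0" and nz2: "a2 \<noteq> 0 \<or> b2 \<noteq> 0"
    and tr1: "a1 * pderiv a1 = F ^ 3 * (b1 * pderiv b1)"
    and tr2: "a2 * pderiv a2 = F ^ 3 * (b2 * pderiv b2)"
    and N1: "a1\<^sup>2 - b1\<^sup>2 * F ^ 3 \<noteq> 0" and N2: "a2\<^sup>2 - b2\<^sup>2 * F ^ 3 \<noteq> 0"
    and u1: "(a1\<^sup>2 - b1\<^sup>2 * F ^ 3) * u = (a1 * pderiv b1 - pderiv a1 * b1) * F\<^sup>2"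
    and u2: "(a2\<^sup>2 - b2\<^sup>2 * F ^ 3) * u = (a2 * pderiv b2 - pderiv a2 * b2) * F\<^sup>2"
  obtains h where "h \<noteq> (0, 0)" "\<And>v. v \<in> places (function_field F) k \<Longrightarrow>
       v (to_fract a1, to_fract (b1 * F)) = v (to_fract a2, to_fract (b2 * F)) + 3 * v h"
proof -
  let ?L = "function_field F"
  note three = three_eq_0[OF char]
  have phi: "pderiv (F ^ 3) = 0" by (rule pderiv_cube_eq_0[OF three])
  obtain \<alpha> where \<alpha>: "a1 * a2 - b1 * b2 * F ^ 3 = \<alpha> ^ 3"
    using pderiv_0_imp_cube[OF char quotient_derivative_0(1)[OF phi tr1 tr2 N1 N2 F0 u1 u2]] by blast
  obtain \<beta> where \<beta>: "b1 * a2 - a1 * b2 = \<beta> ^ 3"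
    using pderiv_0_imp_cube[OF char quotient_derivative_0(2)[OF phi tr1 tr2 N1 N2 F0 u1 u2]] by blast
  obtain \<nu> where \<nu>: "a2\<^sup>2 - b2\<^sup>2 * F ^ 3 = \<nu> ^ 3"
    using pderiv_0_imp_cube[OF char norm_pderiv_eq_0[OF phi tr2]] by blast
  define f1 f2 g n where "f1 = (to_fract a1, to_fract (b1 * F))" and "f2 = (to_fract a2, to_fract (b2 * F))"
    and "g = (to_fract \<alpha>, to_fract \<beta>)" and "n = (to_fract \<nu>, to_fract (0 :: 'a poly))"
  have "a1 * \<nu> ^ 3 = a2 * \<alpha> ^ 3 + b2 * \<beta> ^ 3 * F ^ 3" "b1 * F * \<nu> ^ 3 = a2 * (\<beta> ^ 3 * F) + b2 * F * \<alpha> ^ 3"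
    unfolding \<alpha>[symmetric] \<beta>[symmetric] \<nu>[symmetric] by Groebner_Basis.algebra+
  then have "a1 * \<nu> ^ 3 + b1 * F * (0 ^ 3 * F) * F = a2 * \<alpha> ^ 3 + (b2 * F) * (\<beta> ^ 3 * F) * F"
    "a1 * (0 ^ 3 * F) + b1 * F * \<nu> ^ 3 = a2 * (\<beta> ^ 3 * F) + b2 * F * \<alpha> ^ 3"
    by (simp_all add: power3_eq_cube mult_ac)
  then have e: "f1 \<otimes>\<^bsub>?L\<^esub> (n \<otimes>\<^bsub>?L\<^esub> (n \<otimes>\<^bsub>?L\<^esub> n)) = f2 \<otimes>\<^bsub>?L\<^esub> (g \<otimes>\<^bsub>?L\<^esub> (g \<otimes>\<^bsub>?L\<^esub> g))"
    unfolding n_def g_def cube_in_function_field[OF three]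
    unfolding f1_def f2_def mult_function_field
    by (simp only: to_fract_mult[symmetric] to_fract_add[symmetric])
  have f1: "f1 \<noteq> (0, 0)" and f2: "f2 \<noteq> (0, 0)" using nz1 nz2 F0 by (auto simp: f1_def f2_def)
  have n: "n \<noteq> (0, 0)" using N2 \<nu> by (auto simp: n_def)
  have "\<alpha> ^ 3 \<noteq> 0 \<or> \<beta> ^ 3 \<noteq> 0"
  proof (rule ccontr)
    assume "\<not> ?thesis"
    then have "a1 * \<nu> ^ 3 = 0" "b1 * F * \<nu> ^ 3 = 0"
      using \<open>a1 * \<nu> ^ 3 = _\<close> \<open>b1 * F * \<nu> ^ 3 = _\<close> by auto
    moreover have "\<nu> ^ 3 \<noteq> 0" using N2 \<nu> by simp
    ultimately show False using nz1 F0 by simp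
  qed
  then have g: "g \<noteq> (0, 0)" by (auto simp: g_def)
  obtain m where m: "m \<noteq> (0, 0)" "n \<otimes>\<^bsub>?L\<^esub> m = (1, 0)" using function_field_inverse[OF F n] .
  have "v f1 = v f2 + 3 * v (g \<otimes>\<^bsub>?L\<^esub> m)" if v: "v \<in> places ?L k" for v
  proof -
    have "v f1 + 3 * v n = v f2 + 3 * v g"
      using place_mult[OF v f1 place_cube(1)[OF v n F]] place_mult[OF v f2 place_cube(1)[OF v g F]]
        place_cube(2)[OF v n F] place_cube(2)[OF v g F] e by simp
    moreover have "v n + v m = 0" using place_mult[OF v n m(1)] m(2) place_one[OF v] by simp
    moreover have "v (g \<otimes>\<^bsub>?L\<^esub> m) = v g + v m" by (rule place_mult[OF v g m(1)])
    ultimately show ?thesis by simp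
  qed
  moreover have "g \<otimes>\<^bsub>?L\<^esub> m \<noteq> (0, 0)" by (rule function_field_mult_nonzero[OF F g m(1)])
  ultimately show ?thesis using that unfolding f1_def f2_def by blast
qed

text \<open>
  The second derivative of \<open>x\<^sup>n\<close> is \<open>-x\<^bsup>n-2\<^esup>\<close> if \<open>n\<close> is 2 modulo 3 and 0 otherwise, while \<open>u\<^sup>3\<close> has only the
  terms of degree 0 and 3. Comparing these two coefficients turns the differential equation into the
  Hasse-Witt matrix.
\<close>

lemma cartier_coefficients:
  fixes F u :: "'a::field poly"
  assumes char: "CHAR('a) = 3" and deg: "degree u \<le> 1" and eq: "pderiv (pderiv (u * F)) = - (u ^ 3)"
  shows "coeff u 0 ^ 3 = coeff F 2 * coeff u 0 + coeff F 1 * coeff u 1"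
    and "coeff u 1 ^ 3 = coeff F 5 * coeff u 0 + coeff F 4 * coeff u 1"
proof -
  note 3 = three_eq_0[OF char]
  define \<alpha> \<beta> where "\<alpha> = coeff u 0" and "\<beta> = coeff u 1"
  have u: "u = [:\<alpha>:] + monom \<beta> 1"
  proof (rule poly_eqI)
    fix n show "coeff u n = coeff ([:\<alpha>:] + monom \<beta> 1) n"
    proof (cases "n \<le> 1")
      case True
      then have "n = 0 \<or> n = 1" by auto
      then show ?thesis by (auto simp: \<alpha>_def \<beta>_def)
    next
      case False
      then show ?thesis using deg by (auto simp: coeff_eq_0 coeff_pCons split: nat.split)
    qed
  qed
  have "u ^ 3 = [:\<alpha>:] ^ 3 + monom \<beta> 1 ^ 3"
    unfolding u by (rule freshmans_dream_3[OF poly_three_eq_0[OF 3]])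
  moreover have "monom \<beta> 1 ^ 3 = monom (\<beta> ^ 3) 3" by (simp add: monom_power)
  moreover have "[:\<alpha>:] ^ 3 = [:\<alpha> ^ 3:]" by (simp add: power3_eq_cube mult.assoc)
  ultimately have u3: "u ^ 3 = [:\<alpha> ^ 3:] + monom (\<beta> ^ 3) 3" by simp
  have uF: "coeff (u * F) (Suc n) = \<alpha> * coeff F (Suc n) + \<beta> * coeff F n" for n
    unfolding u by (simp add: distrib_right coeff_monom_mult)
  have c: "of_nat ((n + 1) * (n + 2)) * coeff (u * F) (n + 2) = - coeff (u ^ 3) n" for n
    using arg_cong[OF eq, of "\<lambda>p. coeff p n"] by (simp only: coeff_second_pderiv coeff_minus)
  have "2 * coeff (u * F) 2 = - (\<alpha> ^ 3)"
    using c[of 0] unfolding u3 by (simp add: numeral_2_eq_2)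
  then have "\<alpha> ^ 3 = coeff (u * F) 2 - 3 * coeff (u * F) 2" by (simp add: algebra_simps)
  then have 0: "\<alpha> ^ 3 = coeff (u * F) 2" using 3 by simp
  have "20 * coeff (u * F) 5 = - (\<beta> ^ 3)"
    using c[of 3] unfolding u3 by (simp add: coeff_pCons)
  then have "\<beta> ^ 3 = coeff (u * F) 5 - 3 * (7 * coeff (u * F) 5)" by (simp add: algebra_simps)
  then have 1: "\<beta> ^ 3 = coeff (u * F) 5" using 3 by simp
  show "coeff u 0 ^ 3 = coeff F 2 * coeff u 0 + coeff F 1 * coeff u 1"
    using 0 uF[of 1] by (simp add: \<alpha>_def \<beta>_def numeral_2_eq_2 mult.commute)
  show "coeff u 1 ^ 3 = coeff F 5 * coeff u 0 + coeff F 4 * coeff u 1"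
    using 1 uF[of 4] by (simp add: \<alpha>_def \<beta>_def mult.commute)
qed

text \<open>
  Each 3-torsion class is sent to the coefficients of \<open>u\<close>, where \<open>df/f = u dx/y\<close> for a function \<open>f\<close> attached to the
  class. This map is injective into the solution set of the Cartier equations.
\<close>

theorem card_three_torsion_le:
  fixes F :: "'a::alg_closed_field poly"
  assumes char: "CHAR('a) = 3" and sf: "rsquarefree F" and deg: "degree F = 5 \<or> degree F = 6"
    and det: "coeff F 1 * coeff F 5 = coeff F 2 * coeff F 4"
  shows "card (carrier (torsion_part (class_group0 (function_field F) constants) 3)) \<le> 3"
proof -
  let ?L = "function_field F"
  define T where "T = carrier (torsion_part (class_group0 ?L constants) 3)"
  have F0: "F \<noteq> 0" using deg by auto
  have F: "\<forall>p q. p\<^sup>2 = q\<^sup>2 * F \<longrightarrow> q = 0"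
    using squarefree_not_square[OF sf] deg by auto
  \<comment> \<open>\<open>R c u\<close> relates a class to a differential \<open>u dx/y\<close> through some divisor and some function with polynomial
    coordinates. The function \<open>d\<close> accounts for the cubed denominator.\<close>
  define R where "R = (\<lambda>c u. \<exists>D a b d. D \<in> carrier (div_group ?L constants) \<and>
      c = principal_divisors ?L constants #>\<^bsub>div_group ?L constants\<^esub> D \<and>
      (a \<noteq> 0 \<or> b \<noteq> 0) \<and> d \<noteq> 0 \<and>
      (\<forall>v \<in> places ?L constants. v (to_fract a, to_fract (b * F)) =
          3 * (Poly_Mapping.lookup D v + v (to_fract d, 0))) \<and>
      degree u \<le> 1 \<and> a\<^sup>2 - b\<^sup>2 * F ^ 3 \<noteq> 0 \<and>
      (a\<^sup>2 - b\<^sup>2 * F ^ 3) * u = (a * pderiv b - pderiv a * b) * F\<^sup>2 \<and>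
      a * pderiv a = F ^ 3 * (b * pderiv b) \<and> pderiv (pderiv (u * F)) = - (u ^ 3))"
  have ex: "\<exists>u. R c u" if c: "c \<in> T" for c
  proof -
    obtain D f where D: "D \<in> carrier (div_group ?L constants)"
      "c = principal_divisors ?L constants #>\<^bsub>div_group ?L constants\<^esub> D"
      and f: "f \<noteq> (0, 0)" "\<And>v. v \<in> places ?L constants \<Longrightarrow> v f = 3 * Poly_Mapping.lookup D v"
      by (rule three_torsion_class[OF F c[unfolded T_def]]) blast
    obtain a b d where ab: "a \<noteq> 0 \<or> b \<noteq> 0" "d \<noteq> 0"
      "\<And>v. v \<in> places ?L constants \<Longrightarrow> v (to_fract a, to_fract (b * F)) = v f + 3 * v (to_fract d, 0)"
      by (rule polynomial_representative[OF F0 F f(1)]) blast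
    have v3: "\<forall>v \<in> places ?L constants. v (to_fract a, to_fract (b * F)) =
          3 * (Poly_Mapping.lookup D v + v (to_fract d, 0))"
      using ab(3) f(2) by simp
    then have dvd3: "\<forall>v \<in> places ?L constants. 3 dvd v (to_fract a, to_fract (b * F))"
      by (metis dvd_triv_left)
    obtain u where "degree u \<le> 1" "a\<^sup>2 - b\<^sup>2 * F ^ 3 \<noteq> 0"
      "(a\<^sup>2 - b\<^sup>2 * F ^ 3) * u = (a * pderiv b - pderiv a * b) * F\<^sup>2"
      "a * pderiv a = F ^ 3 * (b * pderiv b)" "pderiv (pderiv (u * F)) = - (u ^ 3)"
      using logarithmic_differential_holomorphic[OF char sf deg dvd3 ab(1)] .
    then show ?thesis unfolding R_def using D ab(1,2) v3 by blast
  qed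
  then obtain U where U: "R c (U c)" if "c \<in> T" for c by metis
  define S where "S = {(\<alpha>, \<beta>). \<alpha> ^ 3 = coeff F 2 * \<alpha> + coeff F 1 * \<beta> \<and> \<beta> ^ 3 = coeff F 5 * \<alpha> + coeff F 4 * \<beta>}"
  have S: "finite S" "card S \<le> 3"
    using frobenius_linear_solutions[OF three_eq_0[OF char] det] unfolding S_def by auto
  have inj: "c1 = c2" if c: "c1 \<in> T" "c2 \<in> T" and e: "U c1 = U c2" for c1 c2
  proof -
    obtain D1 a1 b1 d1 where 1: "D1 \<in> carrier (div_group ?L constants)"
      "c1 = principal_divisors ?L constants #>\<^bsub>div_group ?L constants\<^esub> D1"
      "a1 \<noteq> 0 \<or> b1 \<noteq> 0" "d1 \<noteq> 0"
      "\<forall>v \<in> places ?L constants. v (to_fract a1, to_fract (b1 * F)) =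
          3 * (Poly_Mapping.lookup D1 v + v (to_fract d1, 0))"
      "a1\<^sup>2 - b1\<^sup>2 * F ^ 3 \<noteq> 0"
      "(a1\<^sup>2 - b1\<^sup>2 * F ^ 3) * U c1 = (a1 * pderiv b1 - pderiv a1 * b1) * F\<^sup>2"
      "a1 * pderiv a1 = F ^ 3 * (b1 * pderiv b1)"
      using U[OF c(1)] unfolding R_def by blast
    obtain D2 a2 b2 d2 where 2: "D2 \<in> carrier (div_group ?L constants)"
      "c2 = principal_divisors ?L constants #>\<^bsub>div_group ?L constants\<^esub> D2"
      "a2 \<noteq> 0 \<or> b2 \<noteq> 0" "d2 \<noteq> 0"
      "\<forall>v \<in> places ?L constants. v (to_fract a2, to_fract (b2 * F)) =
          3 * (Poly_Mapping.lookup D2 v + v (to_fract d2, 0))"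
      "a2\<^sup>2 - b2\<^sup>2 * F ^ 3 \<noteq> 0"
      "(a2\<^sup>2 - b2\<^sup>2 * F ^ 3) * U c1 = (a2 * pderiv b2 - pderiv a2 * b2) * F\<^sup>2"
      "a2 * pderiv a2 = F ^ 3 * (b2 * pderiv b2)"
      using U[OF c(2)] unfolding R_def e by blast
    obtain h where h: "h \<noteq> (0, 0)" "\<And>v. v \<in> places ?L constants \<Longrightarrow>
       v (to_fract a1, to_fract (b1 * F)) = v (to_fract a2, to_fract (b2 * F)) + 3 * v h"
      by (rule equal_differentials_imp_quotient_cube[OF char F0 F 1(3) 2(3) 1(8) 2(8) 1(6) 2(6) 1(7) 2(7)]) blast
    have g1: "(to_fract d1, 0 :: 'a poly fract) \<noteq> (0, 0)" and g2: "(to_fract d2, 0 :: 'a poly fract) \<noteq> (0, 0)"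
      using 1(4) 2(4) by simp_all
    obtain m where m: "m \<noteq> (0, 0)" "(to_fract d1, 0) \<otimes>\<^bsub>?L\<^esub> m = (1, 0)"
      using function_field_inverse[OF F g1] .
    let ?h = "(h \<otimes>\<^bsub>?L\<^esub> (to_fract d2, 0)) \<otimes>\<^bsub>?L\<^esub> m"
    have hd: "h \<otimes>\<^bsub>?L\<^esub> (to_fract d2, 0) \<noteq> (0, 0)" by (rule function_field_mult_nonzero[OF F h(1) g2])
    have "?h \<noteq> (0, 0)" by (rule function_field_mult_nonzero[OF F hd m(1)])
    moreover have "Poly_Mapping.lookup D1 v = Poly_Mapping.lookup D2 v + v ?h" if v: "v \<in> places ?L constants" for v
    proof -
      have "v ?h = v h + v (to_fract d2, 0) + v m"
        using place_mult[OF v hd m(1)] place_mult[OF v h(1) g2] by simp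
      moreover have "v (to_fract d1, 0) + v m = 0"
        using place_mult[OF v g1 m(1)] m(2) place_one[OF v] by simp
      moreover have "3 * (Poly_Mapping.lookup D1 v + v (to_fract d1, 0)) =
          3 * (Poly_Mapping.lookup D2 v + v (to_fract d2, 0)) + 3 * v h"
        using h(2)[OF v] 1(5) 2(5) v by simp
      ultimately show ?thesis by simp
    qed
    ultimately show ?thesis unfolding 1(2) 2(2) by (rule class_eqI[OF F 1(1) 2(1)])
  qed
  define \<Phi> where "\<Phi> = (\<lambda>c. (coeff (U c) 0, coeff (U c) 1))"
  have "inj_on \<Phi> T"
  proof (rule inj_onI)
    fix c1 c2 assume c: "c1 \<in> T" "c2 \<in> T" and e: "\<Phi> c1 = \<Phi> c2"
    have "degree (U c1) \<le> 1" "degree (U c2) \<le> 1" using U[OF c(1)] U[OF c(2)] unfolding R_def by blast+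
    have "coeff (U c1) n = coeff (U c2) n" for n
    proof (cases "n \<le> 1")
      case True
      then have "n = 0 \<or> n = 1" by auto
      then show ?thesis using e by (auto simp: \<Phi>_def)
    next
      case False
      then show ?thesis using \<open>degree (U c1) \<le> 1\<close> \<open>degree (U c2) \<le> 1\<close> by (simp add: coeff_eq_0)
    qed
    then have "U c1 = U c2" by (simp add: poly_eq_iff)
    then show "c1 = c2" by (rule inj[OF c])
  qed
  moreover have "\<Phi> ` T \<subseteq> S"
  proof (rule image_subsetI)
    fix c assume "c \<in> T"
    from U[OF this] have "degree (U c) \<le> 1" "pderiv (pderiv (U c * F)) = - (U c ^ 3)"
      unfolding R_def by blast+
    from cartier_coefficients[OF char this] show "\<Phi> c \<in> S" by (simp add: S_def \<Phi>_def)
  qed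
  ultimately have "card T \<le> card S" using S(1) by (rule card_inj_on_le)
  then show ?thesis using S(2) unfolding T_def by simp
qed

section \<open>Integral polynomials in the coefficients of a sextic\<close>

definition monomial_value :: "(nat \<Rightarrow> 'a::comm_monoid_mult) \<Rightarrow> (nat \<Rightarrow>\<^sub>0 nat) \<Rightarrow> 'a" where
  "monomial_value c m = (\<Prod>i \<in> Poly_Mapping.keys m. c i ^ Poly_Mapping.lookup m i)"

definition mpoly_eval :: "(nat \<Rightarrow> 'a::comm_ring_1) \<Rightarrow> ((nat \<Rightarrow>\<^sub>0 nat) \<Rightarrow>\<^sub>0 int) \<Rightarrow> 'a" where
  "mpoly_eval c P = (\<Sum>m \<in> Poly_Mapping.keys P. of_int (Poly_Mapping.lookup P m) * monomial_value c m)"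

lemma monomial_value_superset:
  assumes "finite A" "Poly_Mapping.keys m \<subseteq> A"
  shows "monomial_value c m = (\<Prod>i \<in> A. c i ^ Poly_Mapping.lookup m i)"
  unfolding monomial_value_def using assms
  by (intro prod.mono_neutral_left) (auto simp: in_keys_iff)

lemma monomial_value_add: "monomial_value c (m + n) = monomial_value c m * monomial_value c n"
proof -
  let ?A = "Poly_Mapping.keys m \<union> Poly_Mapping.keys n"
  have "Poly_Mapping.keys (m + n) \<subseteq> ?A" by (rule Poly_Mapping.keys_add)
  then show ?thesis
    by (simp add: monomial_value_superset[of ?A] lookup_add power_add prod.distrib)
qed

lemma mpoly_eval_superset:
  assumes "finite A" "Poly_Mapping.keys P \<subseteq> A"
  shows "mpoly_eval c P = (\<Sum>m \<in> A. of_int (Poly_Mapping.lookup P m) * monomial_value c m)"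
  unfolding mpoly_eval_def using assms
  by (intro sum.mono_neutral_left) (auto simp: in_keys_iff)

lemma mpoly_eval_add: "mpoly_eval c (P + Q) = mpoly_eval c P + mpoly_eval c Q"
proof -
  let ?A = "Poly_Mapping.keys P \<union> Poly_Mapping.keys Q"
  have "Poly_Mapping.keys (P + Q) \<subseteq> ?A" by (rule Poly_Mapping.keys_add)
  then show ?thesis
    by (simp add: mpoly_eval_superset[of ?A] lookup_add distrib_right sum.distrib)
qed

lemma mpoly_eval_0: "mpoly_eval c 0 = 0"
  by (simp add: mpoly_eval_def)

lemma mpoly_eval_single: "mpoly_eval c (Poly_Mapping.single m a) = of_int a * monomial_value c m"
  by (subst mpoly_eval_superset[of "{m}"]) auto

lemma mpoly_eval_sum: "mpoly_eval c (\<Sum>i\<in>I. P i) = (\<Sum>i\<in>I. mpoly_eval c (P i))"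
  by (induction I rule: infinite_finite_induct) (simp_all add: mpoly_eval_add mpoly_eval_0)

lemma mpoly_expansion: "P = (\<Sum>m\<in>Poly_Mapping.keys P. Poly_Mapping.single m (Poly_Mapping.lookup P m))"
  by (rule poly_mapping_eqI) (simp add: lookup_sum lookup_single when_def in_keys_iff)

lemma mpoly_eval_mult: "mpoly_eval c (P * Q) = mpoly_eval c P * mpoly_eval c Q"
proof -
  let ?s = "\<lambda>P m. Poly_Mapping.single m (Poly_Mapping.lookup P m)"
  have "P * Q = (\<Sum>m\<in>Poly_Mapping.keys P. \<Sum>n\<in>Poly_Mapping.keys Q. ?s P m * ?s Q n)"
    by (subst mpoly_expansion[of P], subst mpoly_expansion[of Q]) (rule sum_product)
  then have "mpoly_eval c (P * Q) = (\<Sum>m\<in>Poly_Mapping.keys P. \<Sum>n\<in>Poly_Mapping.keys Q.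
      mpoly_eval c (?s P m) * mpoly_eval c (?s Q n))"
    by (simp add: mpoly_eval_sum mult_single mpoly_eval_single monomial_value_add algebra_simps)
  also have "\<dots> = (\<Sum>m\<in>Poly_Mapping.keys P. mpoly_eval c (?s P m)) * (\<Sum>n\<in>Poly_Mapping.keys Q. mpoly_eval c (?s Q n))"
    by (rule sum_product[symmetric])
  also have "\<dots> = mpoly_eval c P * mpoly_eval c Q"
    unfolding mpoly_eval_sum[symmetric] mpoly_expansion[symmetric] ..
  finally show ?thesis .
qed

lemma mpoly_eval_1: "mpoly_eval c 1 = 1"
  by (simp add: mpoly_eval_single monomial_value_def flip: single_one)

lemma mpoly_eval_uminus: "mpoly_eval c (- P) = - mpoly_eval c P"
  using mpoly_eval_add[of c P "- P"] by (simp add: mpoly_eval_0 eq_neg_iff_add_eq_0 add.commute)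

lemma mpoly_eval_diff: "mpoly_eval c (P - Q) = mpoly_eval c P - mpoly_eval c Q"
  using mpoly_eval_add[of c P "- Q"] by (simp add: mpoly_eval_uminus)

lemma mpoly_eval_of_nat: "mpoly_eval c (of_nat n) = of_nat n"
  by (induction n) (simp_all add: mpoly_eval_0 mpoly_eval_1 mpoly_eval_add)

lemma mpoly_eval_numeral: "mpoly_eval c (numeral n) = numeral n"
  using mpoly_eval_of_nat[of c "numeral n"] by simp

definition mpoly_var :: "nat \<Rightarrow> (nat \<Rightarrow>\<^sub>0 nat) \<Rightarrow>\<^sub>0 int" where
  "mpoly_var i = Poly_Mapping.single (Poly_Mapping.single i 1) 1"

lemma mpoly_eval_var: "mpoly_eval c (mpoly_var i) = c i"
  by (simp add: mpoly_var_def mpoly_eval_single monomial_value_def)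

text \<open>
  The reduced fraction has as denominator another power of 2, which is invertible in the field.
\<close>

lemma rat_to_field_half_integer:
  assumes "(2::'a::field) \<noteq> 0"
  shows "rat_to_field (of_int z / 2 ^ n) = (of_int z / 2 ^ n :: 'a)"
proof -
  obtain p q where pq: "quotient_of (of_int z / 2 ^ n) = (p, q)" by (cases "quotient_of (of_int z / 2 ^ n)")
  have q: "q > 0" using quotient_of_denom_pos[OF pq] .
  have cop: "coprime p q" using quotient_of_coprime[OF pq] .
  have "of_int z / 2 ^ n = (of_int p / of_int q :: rat)" using quotient_of_div[OF pq] .
  then have "(of_int (z * q) :: rat) = of_int (p * 2 ^ n)" using q by (simp add: field_simps)
  then have e: "z * q = p * 2 ^ n" by (simp only: of_int_eq_iff)
  then have "q dvd 2 ^ n" using cop by (metis coprime_commute coprime_dvd_mult_right_iff dvd_triv_right)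
  then obtain k where k: "2 ^ n = q * k" by blast
  have "(of_int (2 ^ n) :: 'a) \<noteq> 0" using assms by simp
  then have "(of_int q :: 'a) \<noteq> 0" unfolding k by simp
  moreover have "of_int z * of_int q = of_int p * (2 ^ n :: 'a)"
    using arg_cong[OF e, of "of_int :: int \<Rightarrow> 'a"] by simp
  ultimately show ?thesis using assms pq by (simp add: rat_to_field_def field_simps)
qed

definition mpoly_div_2power :: "nat \<Rightarrow> ((nat \<Rightarrow>\<^sub>0 nat) \<Rightarrow>\<^sub>0 int) \<Rightarrow> rat_mpoly" where
  "mpoly_div_2power n = Poly_Mapping.map (\<lambda>z. of_int z / 2 ^ n)"

lemma lookup_mpoly_div_2power:
  "Poly_Mapping.lookup (mpoly_div_2power n P) m = of_int (Poly_Mapping.lookup P m) / 2 ^ n"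
  by (simp add: mpoly_div_2power_def Poly_Mapping.map.rep_eq when_def)

lemma keys_mpoly_div_2power: "Poly_Mapping.keys (mpoly_div_2power n P) = Poly_Mapping.keys P"
  by (auto simp: in_keys_iff lookup_mpoly_div_2power)

lemma eval_mpoly_div_2power:
  assumes "(2::'a::field) \<noteq> 0"
  shows "eval_mpoly c (mpoly_div_2power n P) = mpoly_eval c P / (2 ^ n :: 'a)"
  unfolding eval_mpoly_def mpoly_eval_def monomial_value_def keys_mpoly_div_2power sum_divide_distrib
  by (simp add: lookup_mpoly_div_2power rat_to_field_half_integer[OF assms])

lemma eval_mpoly_map_to_ac:
  "eval_mpoly (coeff (map_poly to_ac F)) P = to_ac (eval_mpoly (coeff F) P)"
  by (simp add: eval_mpoly_def coeff_map_poly rat_to_field_def to_ac_sum to_ac_prod)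

definition sextic_mpolys :: "((nat \<Rightarrow>\<^sub>0 nat) \<Rightarrow>\<^sub>0 int) set" where
  "sextic_mpolys = {P. \<forall>m \<in> Poly_Mapping.keys P. Poly_Mapping.keys m \<subseteq> {..6}}"

lemma mpoly_div_2power_in:
  "P \<in> sextic_mpolys \<Longrightarrow> mpoly_div_2power n P \<in> half_integer_sextic_mpolys"
  by (auto simp: sextic_mpolys_def half_integer_sextic_mpolys_def keys_mpoly_div_2power
      half_integers_def lookup_mpoly_div_2power)

lemma sextic_mpolys_closed:
  shows "P \<in> sextic_mpolys \<Longrightarrow> Q \<in> sextic_mpolys \<Longrightarrow> P + Q \<in> sextic_mpolys"
    and "P \<in> sextic_mpolys \<Longrightarrow> Q \<in> sextic_mpolys \<Longrightarrow> P * Q \<in> sextic_mpolys"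
    and "P \<in> sextic_mpolys \<Longrightarrow> - P \<in> sextic_mpolys"
    and "0 \<in> sextic_mpolys" "1 \<in> sextic_mpolys"
    and "i \<le> 6 \<Longrightarrow> mpoly_var i \<in> sextic_mpolys"
proof -
  show "P + Q \<in> sextic_mpolys" if P: "P \<in> sextic_mpolys" and Q: "Q \<in> sextic_mpolys"
    using P Q Poly_Mapping.keys_add[of P Q] unfolding sextic_mpolys_def by blast
  show "P * Q \<in> sextic_mpolys" if P: "P \<in> sextic_mpolys" and Q: "Q \<in> sextic_mpolys"
    unfolding sextic_mpolys_def mem_Collect_eq
  proof (intro ballI subsetI)
    fix k i assume "k \<in> Poly_Mapping.keys (P * Q)" and i: "i \<in> Poly_Mapping.keys k"
    then obtain m n where "k = m + n" "m \<in> Poly_Mapping.keys P" "n \<in> Poly_Mapping.keys Q"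
      using keys_mult[of P Q] by blast
    then show "i \<in> {..6}"
      using P Q i Poly_Mapping.keys_add[of m n] unfolding sextic_mpolys_def by blast
  qed
qed (auto simp: sextic_mpolys_def mpoly_var_def)

lemma sextic_mpolys_sum: "(\<And>i. i \<in> I \<Longrightarrow> f i \<in> sextic_mpolys) \<Longrightarrow> sum f I \<in> sextic_mpolys"
  by (induction I rule: infinite_finite_induct) (simp_all add: sextic_mpolys_closed)

lemma sextic_mpolys_prod: "(\<And>i. i \<in> I \<Longrightarrow> f i \<in> sextic_mpolys) \<Longrightarrow> prod f I \<in> sextic_mpolys"
  by (induction I rule: infinite_finite_induct) (simp_all add: sextic_mpolys_closed)

lemma sextic_mpolys_of_nat: "of_nat n \<in> sextic_mpolys"
  by (induction n) (simp_all add: sextic_mpolys_closed)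

lemma sextic_mpolys_numeral: "numeral n \<in> sextic_mpolys"
  using sextic_mpolys_of_nat[of "numeral n"] by simp

lemma sextic_mpolys_diff: "P \<in> sextic_mpolys \<Longrightarrow> Q \<in> sextic_mpolys \<Longrightarrow> P - Q \<in> sextic_mpolys"
  using sextic_mpolys_closed(1)[of P "- Q"] sextic_mpolys_closed(3)[of Q] by simp

section \<open>Uniqueness of the coefficient polynomials\<close>

text \<open>
  Uniqueness of the expansion in base \<open>B\<close>. It makes the Kronecker substitution \<open>c\<^sub>i = t\<^bsup>B^i\<^esup>\<close> in \<open>mpoly_unique\<close>
  injective on monomials with exponents below \<open>B\<close>.
\<close>

lemma digits_unique:
  fixes a b :: "nat \<Rightarrow> nat"
  assumes "\<And>i. i < n \<Longrightarrow> a i < B" "\<And>i. i < n \<Longrightarrow> b i < B"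
    and "(\<Sum>i<n. a i * B ^ i) = (\<Sum>i<n. b i * B ^ i)" and "i < n"
  shows "a i = b i"
  using assms
proof (induction n arbitrary: a b i)
  case (Suc n)
  have split: "(\<Sum>i<Suc n. c i * B ^ i) = c 0 + B * (\<Sum>i<n. c (Suc i) * B ^ i)" for c :: "nat \<Rightarrow> nat"
    by (simp only: sum.lessThan_Suc_shift) (simp add: sum_distrib_left algebra_simps)
  have e: "a 0 + B * (\<Sum>i<n. a (Suc i) * B ^ i) = b 0 + B * (\<Sum>i<n. b (Suc i) * B ^ i)"
    using Suc.prems(3) by (simp only: split)
  have ab: "a 0 < B" "b 0 < B" using Suc.prems by auto
  have 0: "a 0 = b 0" using arg_cong[OF e, of "\<lambda>k. k mod B"] ab by simp
  then have "(\<Sum>i<n. a (Suc i) * B ^ i) = (\<Sum>i<n. b (Suc i) * B ^ i)" using e ab by simp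
  then have "a (Suc j) = b (Suc j)" if "j < n" for j
    using Suc.IH[of "\<lambda>i. a (Suc i)" "\<lambda>i. b (Suc i)" j] Suc.prems(1,2) that by simp
  then show ?case using 0 Suc.prems(4) by (cases i) auto
qed simp

lemma rat_to_field_complex: "rat_to_field q = (of_rat q :: complex)"
proof -
  obtain a b where ab: "quotient_of q = (a, b)" by (cases "quotient_of q")
  show ?thesis unfolding quotient_of_div[OF ab] of_rat_divide
    by (simp add: rat_to_field_def ab flip: quotient_of_div[OF ab])
qed

lemma sextic_with_roots:
  fixes c :: "nat \<Rightarrow> complex"
  assumes "c 6 \<noteq> 0"
  obtains x :: "nat \<Rightarrow> complex" where "\<And>k. k \<le> 6 \<Longrightarrow> coeff (smult (c 6) (\<Prod>i \<in> {1..6}. [:- x i, 1:])) k = c k"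
proof -
  define p where "p = (\<Sum>i\<le>6. monom (c i) i)"
  have cp: "coeff p k = (if k \<le> 6 then c k else 0)" for k
    by (simp add: p_def coeff_sum when_def sum.delta if_distrib cong: if_cong)
  have deg: "degree p = 6"
    using assms by (intro antisym degree_le le_degree) (auto simp: cp)
  have "p \<noteq> 0" using deg by auto
  then obtain M where M: "size M = 6" "p = smult (lead_coeff p) (\<Prod>a\<in>#M. [:- a, 1:])"
    using alg_closed_imp_factorization[of p] deg by auto
  obtain as where "mset as = M" using ex_mset by blast
  then have as: "smult (lead_coeff p) (\<Prod>a\<leftarrow>as. [:- a, 1:]) = p" "length as = 6"
    using M by (auto simp: prod_mset_prod_list simp flip: mset_map)
  have "(\<Prod>a\<leftarrow>as. [:- a, 1:]) = (\<Prod>i<6. [:- (as ! i), 1:])"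
    by (simp add: prod.list_conv_set_nth as(2) atLeast0LessThan)
  also have "\<dots> = (\<Prod>i \<in> {1..6}. [:- (as ! (i - 1)), 1:])"
    by (rule prod.reindex_bij_witness[of _ "\<lambda>i. i - 1" Suc]) auto
  finally have "smult (c 6) (\<Prod>i \<in> {1..6}. [:- (as ! (i - 1)), 1:]) = p"
    using as(1) by (simp add: deg cp)
  then show ?thesis using that[of "\<lambda>i. as ! (i - 1)"] cp by auto
qed

lemma monomial_value_power_substitution:
  assumes "Poly_Mapping.keys m \<subseteq> {..<7}"
  shows "monomial_value (\<lambda>i. t ^ (B ^ i)) m = (t :: 'a::comm_monoid_mult) ^ (\<Sum>i<7. Poly_Mapping.lookup m i * B ^ i)"
proof -
  have "monomial_value (\<lambda>i. t ^ (B ^ i)) m = (\<Prod>i<7. t ^ (Poly_Mapping.lookup m i * B ^ i))"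
    using assms by (simp add: monomial_value_superset[of "{..<7}"] mult.commute flip: power_mult)
  then show ?thesis by (simp add: power_sum)
qed

text \<open>
  Every complex coefficient vector with \<open>c\<^sub>6 \<noteq> 0\<close> belongs to a sextic that splits into linear factors, so the
  two polynomials agree at all such vectors. Substituting \<open>c\<^sub>i = t\<^bsup>B^i\<^esup>\<close> with \<open>B\<close> larger than all exponents sends
  different monomials to different powers of \<open>t\<close>. The resulting polynomials in \<open>t\<close> agree for all
  \<open>t \<noteq> 0\<close>, hence have equal coefficients.
\<close>

lemma mpoly_unique:
  assumes P: "P \<in> half_integer_sextic_mpolys" and Q: "Q \<in> half_integer_sextic_mpolys"
    and eq: "\<And>a (x :: nat \<Rightarrow> complex). a \<noteq> 0 \<Longrightarrow>
      eval_mpoly (coeff (smult a (\<Prod>i \<in> {1..6}. [:- x i, 1:]))) P =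
      (eval_mpoly (coeff (smult a (\<Prod>i \<in> {1..6}. [:- x i, 1:]))) Q :: complex)"
  shows "P = Q"
proof -
  have 6: "{..6} = {..<7::nat}" by auto
  define A where "A = Poly_Mapping.keys P \<union> Poly_Mapping.keys Q"
  have fin: "finite A" by (simp add: A_def)
  have keys: "Poly_Mapping.keys m \<subseteq> {..<7}" if "m \<in> A" for m
    using that P Q unfolding A_def half_integer_sextic_mpolys_def 6[symmetric] by blast
  \<comment> \<open>Any bound exceeding all exponents that occur will do.\<close>
  define B where "B = Suc (\<Sum>m\<in>A. \<Sum>i<7. Poly_Mapping.lookup m i)"
  have B: "Poly_Mapping.lookup m i < B" if "m \<in> A" "i < 7" for m i
  proof -
    have "Poly_Mapping.lookup m i \<le> (\<Sum>i<7. Poly_Mapping.lookup m i)"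
      using that by (intro member_le_sum) auto
    also have "\<dots> \<le> (\<Sum>m\<in>A. \<Sum>i<7. Poly_Mapping.lookup m i)"
      using that fin by (intro member_le_sum[of m A "\<lambda>m. \<Sum>i<7. Poly_Mapping.lookup m i"]) auto
    finally show ?thesis by (simp add: B_def)
  qed
  define e where "e = (\<lambda>m. \<Sum>i<7. Poly_Mapping.lookup m i * B ^ i)"
  have inj: "m = n" if "m \<in> A" "n \<in> A" "e m = e n" for m n
  proof (rule poly_mapping_eqI)
    fix i show "Poly_Mapping.lookup m i = Poly_Mapping.lookup n i"
    proof (cases "i < 7")
      case True
      then show ?thesis using digits_unique[of 7 "Poly_Mapping.lookup m" B "Poly_Mapping.lookup n" i] that B
        by (simp add: e_def)
    next
      case False
      then show ?thesis using keys that by (metis in_keys_iff lessThan_iff subsetD)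
    qed
  qed
  define r where "r = (\<lambda>R::rat_mpoly. \<Sum>m\<in>A. monom (of_rat (Poly_Mapping.lookup R m) :: complex) (e m))"
  have eval: "eval_mpoly c R = (\<Sum>m\<in>A. of_rat (Poly_Mapping.lookup R m) * monomial_value c m)"
    if "R = P \<or> R = Q" for c :: "nat \<Rightarrow> complex" and R
    unfolding eval_mpoly_def monomial_value_def rat_to_field_complex
    using that fin by (intro sum.mono_neutral_left) (auto simp: A_def in_keys_iff)
  have "poly (r P) t = poly (r Q) t" if "t \<noteq> 0" for t
  proof -
    define c where "c = (\<lambda>i. t ^ (B ^ i))"
    have "c 6 \<noteq> 0" using that by (simp add: c_def)
    then obtain x :: "nat \<Rightarrow> complex" where x: "\<And>k. k \<le> 6 \<Longrightarrow> coeff (smult (c 6) (\<Prod>i \<in> {1..6}. [:- x i, 1:])) k = c k"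
      using sextic_with_roots by blast
    have val: "monomial_value (coeff (smult (c 6) (\<Prod>i \<in> {1..6}. [:- x i, 1:]))) m = t ^ e m" if "m \<in> A" for m
    proof -
      have "monomial_value (coeff (smult (c 6) (\<Prod>i \<in> {1..6}. [:- x i, 1:]))) m = monomial_value c m"
        unfolding monomial_value_def using keys[OF that] x by (intro prod.cong) (auto simp: 6[symmetric])
      then show ?thesis using monomial_value_power_substitution[OF keys[OF that], of t B] by (simp add: c_def e_def)
    qed
    have "poly (r R) t = eval_mpoly (coeff (smult (c 6) (\<Prod>i \<in> {1..6}. [:- x i, 1:]))) R" if "R = P \<or> R = Q" for R
      unfolding eval[OF that] r_def poly_sum poly_monom by (intro sum.cong refl) (simp only: val)
    then show ?thesis using eq[OF \<open>c 6 \<noteq> 0\<close>] by simp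
  qed
  then have "{t. t \<noteq> 0} \<subseteq> {t. poly (r P - r Q) t = 0}" by auto
  moreover have "infinite {t :: complex. t \<noteq> 0}"
  proof -
    have "{t :: complex. t \<noteq> 0} = UNIV - {0}" by auto
    then show ?thesis by (simp add: infinite_UNIV_char_0)
  qed
  ultimately have "r P - r Q = 0" using poly_roots_finite finite_subset by blast
  moreover have "coeff (r R) (e m) = of_rat (Poly_Mapping.lookup R m)" if "m \<in> A" for R m
  proof -
    have "coeff (r R) (e m) = (\<Sum>n\<in>A. if n = m then of_rat (Poly_Mapping.lookup R n) else 0)"
      unfolding r_def coeff_sum using inj that by (intro sum.cong refl) auto
    then show ?thesis using that fin by simp
  qed
  ultimately have A: "Poly_Mapping.lookup P m = Poly_Mapping.lookup Q m" if "m \<in> A" for m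
    using that by (metis eq_iff_diff_eq_0 of_rat_eq_iff)
  show ?thesis
  proof (rule poly_mapping_eqI)
    fix m show "Poly_Mapping.lookup P m = Poly_Mapping.lookup Q m"
      using A[of m] by (cases "m \<in> A") (auto simp: A_def in_keys_iff)
  qed
qed

text \<open>
  Identifies a coefficient polynomial from an integral polynomial \<open>P\<close> that computes \<open>2\<^sup>n\<close> times the invariant.
\<close>

theorem coefficient_mpoly_eqI:
  assumes P: "P \<in> sextic_mpolys"
    and eq: "\<And>a x. a \<noteq> 0 \<Longrightarrow>
      mpoly_eval (coeff (smult a (\<Prod>i \<in> {1..6}. [:- x i, 1:]))) P = 2 ^ n * J a x"
  shows "coefficient_mpoly J = mpoly_div_2power n P"
  unfolding coefficient_mpoly_def
proof (rule the_equality)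
  show *: "mpoly_div_2power n P \<in> half_integer_sextic_mpolys \<and> (\<forall>a x. a \<noteq> 0 \<longrightarrow>
           eval_mpoly (coeff (smult a (\<Prod>i \<in> {1..6}. [:- x i, 1:]))) (mpoly_div_2power n P) = J a x)"
    using mpoly_div_2power_in[OF P] eq by (simp add: eval_mpoly_div_2power)
  fix Q assume "Q \<in> half_integer_sextic_mpolys \<and> (\<forall>a x. a \<noteq> 0 \<longrightarrow>
           eval_mpoly (coeff (smult a (\<Prod>i \<in> {1..6}. [:- x i, 1:]))) Q = J a x)"
  with * show "Q = mpoly_div_2power n P" by (intro mpoly_unique) auto
qed

section \<open>The invariant of degree 2\<close>

text \<open>
  The 15 perfect matchings of \<open>{1, \<dots>, 6}\<close> in a normal form: the tuple \<open>(b, c, d, e, f)\<close> stands for the pairs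
  \<open>{1, b}\<close>, \<open>{c, d}\<close>, \<open>{e, f}\<close> with \<open>c < d\<close>, \<open>e < f\<close> and \<open>c < e\<close>.
\<close>

definition matchings :: "(nat \<times> nat \<times> nat \<times> nat \<times> nat) list" where
  "matchings = [(2,3,4,5,6), (2,3,5,4,6), (2,3,6,4,5),
                (3,2,4,5,6), (3,2,5,4,6), (3,2,6,4,5),
                (4,2,3,5,6), (4,2,5,3,6), (4,2,6,3,5),
                (5,2,3,4,6), (5,2,4,3,6), (5,2,6,3,4),
                (6,2,3,4,5), (6,2,4,3,5), (6,2,5,3,4)]"

definition matching_expression :: "nat \<times> nat \<times> nat \<times> nat \<times> nat \<Rightarrow> nat set set" where
  "matching_expression = (\<lambda>(b, c, d, e, f). {{1, b}, {c, d}, {e, f}})"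

lemma ordered_matching_in_matchings:
  fixes a b c d e f :: nat
  assumes "{a, b, c, d, e, f} = {1..6}" "a < b" "c < d" "e < f" "a < c" "c < e"
  shows "a = 1 \<and> (b, c, d, e, f) \<in> set matchings"
proof -
  have rng: "1 \<le> n \<and> n \<le> 6" if "n \<in> {a, b, c, d, e, f}" for n
    using that unfolding assms(1) by simp
  have mem: "n \<in> {a, b, c, d, e, f}" if "1 \<le> n" "n \<le> 6" for n
    unfolding assms(1) using that by simp
  have "card {a, b, c, d, e, f} = 6" unfolding assms(1) by simp
  then have dist: "distinct [a, b, c, d, e, f]"
    using card_distinct[of "[a, b, c, d, e, f]"] by simp
  have ge: "1 \<le> a" "b \<le> 6" "d \<le> 6" "f \<le> 6" using rng[of a] rng[of b] rng[of d] rng[of f] by simp_all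
  have a: "a = 1"
  proof -
    have "1 = a \<or> 1 = b \<or> 1 = c \<or> 1 = d \<or> 1 = e \<or> 1 = f" using mem[of 1] by simp
    then show ?thesis using assms(2-6) ge by linarith
  qed
  have b: "b = 2 \<or> b = 3 \<or> b = 4 \<or> b = 5 \<or> b = 6" using a assms(2) ge by auto
  have "c = 2 \<or> c = 3 \<or> c = 4" "d = 3 \<or> d = 4 \<or> d = 5 \<or> d = 6"
    using a assms(3-6) ge by auto
  then have cd: "(c, d) \<in> {(2,3), (2,4), (2,5), (2,6), (3,4), (3,5), (3,6), (4,5), (4,6)}"
    using assms(3) by auto
  have "e = 3 \<or> e = 4 \<or> e = 5" "f = 4 \<or> f = 5 \<or> f = 6"
    using a assms(4-6) ge by auto
  then have ef: "(e, f) \<in> {(3,4), (3,5), (3,6), (4,5), (4,6), (5,6)}" using assms(4) by auto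
  have "d \<noteq> e" "d \<noteq> f" using dist by auto
  then have "(c, d, e, f) \<in> {(2,3,4,5), (2,3,4,6), (2,3,5,6), (2,4,3,5), (2,4,3,6), (2,4,5,6),
      (2,5,3,4), (2,5,3,6), (2,5,4,6), (2,6,3,4), (2,6,3,5), (2,6,4,5),
      (3,4,5,6), (3,5,4,6), (3,6,4,5)}"
    using cd ef assms(6) unfolding insert_iff empty_iff prod.inject by (elim disjE conjE) simp_all
  moreover have "b \<noteq> c" "b \<noteq> d" "b \<noteq> e" "b \<noteq> f" using dist by auto
  ultimately have "(b, c, d, e, f) \<in> set matchings"
    using b unfolding insert_iff empty_iff prod.inject
    by (elim disjE conjE) (simp_all add: matchings_def)
  then show ?thesis using a by blast
qed

lemma sort_pair:
  assumes "a \<noteq> (b :: nat)"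
  obtains a' b' where "{a, b} = {a', b'}" "a' < b'"
  using assms by (metis insert_commute linorder_neqE_nat)

lemma matching_in_matchings:
  fixes a b c d e f :: nat
  assumes "{a, b, c, d, e, f} = {1..6}"
  shows "{{a, b}, {c, d}, {e, f}} \<in> matching_expression ` set matchings"
proof -
  have "card {a, b, c, d, e, f} = 6" using assms by simp
  then have dist: "distinct [a, b, c, d, e, f]"
    using card_distinct[of "[a, b, c, d, e, f]"] by simp
  obtain a1 b1 where ab: "{a, b} = {a1, b1}" "a1 < b1" using sort_pair[of a b] dist by auto
  obtain c1 d1 where cd: "{c, d} = {c1, d1}" "c1 < d1" using sort_pair[of c d] dist by auto
  obtain e1 f1 where ef: "{e, f} = {e1, f1}" "e1 < f1" using sort_pair[of e f] dist by auto
  have all: "{a1, b1} \<union> {c1, d1} \<union> {e1, f1} = {1..6}"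
    unfolding ab(1)[symmetric] cd(1)[symmetric] ef(1)[symmetric] using assms by auto
  have ne: "a1 \<noteq> c1" "a1 \<noteq> e1" "c1 \<noteq> e1"
    using ab cd ef dist by (auto simp: doubleton_eq_iff)
  have key: "{{a, b}, {c, d}, {e, f}} \<in> matching_expression ` set matchings"
    if "{{a, b}, {c, d}, {e, f}} = {{p, p'}, {q, q'}, {r, r'}}"
      "{p, p', q, q', r, r'} = {1..6}" "p < p'" "q < q'" "r < r'" "p < q" "q < r" for p p' q q' r r'
  proof -
    note m = ordered_matching_in_matchings[OF that(2-7)]
    then have "matching_expression (p', q, q', r, r') = {{a, b}, {c, d}, {e, f}}"
      unfolding that(1) by (simp add: matching_expression_def)
    then show ?thesis using m by (metis imageI)
  qed
  have G: "{{a, b}, {c, d}, {e, f}} = {{a1, b1}, {c1, d1}, {e1, f1}}" using ab cd ef by simp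
  consider "a1 < c1 \<and> c1 < e1" | "a1 < e1 \<and> e1 < c1" | "c1 < a1 \<and> a1 < e1"
    | "c1 < e1 \<and> e1 < a1" | "e1 < a1 \<and> a1 < c1" | "e1 < c1 \<and> c1 < a1"
    using ne by linarith
  then show ?thesis
  proof cases
    case 1 then show ?thesis using ab(2) cd(2) ef(2) all by (intro key[of a1 b1 c1 d1 e1 f1]) (auto simp: G)
  next
    case 2 then show ?thesis using ab(2) cd(2) ef(2) all by (intro key[of a1 b1 e1 f1 c1 d1]) (auto simp: G)
  next
    case 3 then show ?thesis using ab(2) cd(2) ef(2) all by (intro key[of c1 d1 a1 b1 e1 f1]) (auto simp: G)
  next
    case 4 then show ?thesis using ab(2) cd(2) ef(2) all by (intro key[of c1 d1 e1 f1 a1 b1]) (auto simp: G)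
  next
    case 5 then show ?thesis using ab(2) cd(2) ef(2) all by (intro key[of e1 f1 a1 b1 c1 d1]) (auto simp: G)
  next
    case 6 then show ?thesis using ab(2) cd(2) ef(2) all by (intro key[of e1 f1 c1 d1 a1 b1]) (auto simp: G)
  qed
qed

lemma permutation_from_list:
  assumes "set xs = {1..n}" "length xs = n"
  obtains \<pi> where "\<pi> permutes {1..n}" "\<And>i. i < n \<Longrightarrow> \<pi> (Suc i) = xs ! i"
proof -
  define \<pi> where "\<pi> = (\<lambda>k. if k \<in> {1..n} then xs ! (k - 1) else k)"
  have dist: "distinct xs" using assms by (simp add: card_distinct)
  have "inj_on \<pi> {1..n}"
    using dist assms(2) by (auto simp: inj_on_def \<pi>_def nth_eq_iff_index_eq)
  moreover have sub: "\<pi> ` {1..n} \<subseteq> {1..n}"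
    using assms by (force simp: \<pi>_def simp flip: assms(1))
  ultimately have "bij_betw \<pi> {1..n} {1..n}"
    by (metis bij_betw_def endo_inj_surj finite_atLeastAtMost)
  then have "\<pi> permutes {1..n}" by (rule bij_imp_permutes) (auto simp: \<pi>_def)
  then show ?thesis by (rule that) (simp add: \<pi>_def)
qed

lemma permuted_matchings:
  "permuted_expressions {{1,2},{3,4},{5,6}} = matching_expression ` set matchings"
proof (intro equalityI subsetI)
  have six: "{1..6} = {1,2,3,4,5,6::nat}" by auto
  fix G assume "G \<in> permuted_expressions {{1,2},{3,4},{5,6}}"
  then obtain \<pi> where \<pi>: "\<pi> permutes {1..6}" "G = (\<lambda>e. \<pi> ` e) ` {{1,2},{3,4},{5,6}}"
    by (auto simp: permuted_expressions_def)
  have "{\<pi> 1, \<pi> 2, \<pi> 3, \<pi> 4, \<pi> 5, \<pi> 6} = {1..6}"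
    using permutes_image[OF \<pi>(1)] unfolding six by simp
  from matching_in_matchings[OF this] show "G \<in> matching_expression ` set matchings"
    unfolding \<pi>(2) by simp
next
  fix G assume "G \<in> matching_expression ` set matchings"
  then obtain b c d e f where G: "G = {{1, b}, {c, d}, {e, f}}" "(b, c, d, e, f) \<in> set matchings"
    by (auto simp: matching_expression_def)
  have "set [1, b, c, d, e, f] = {1..6}"
    using G(2) by (auto simp: matchings_def)
  then obtain \<pi> where \<pi>: "\<pi> permutes {1..6}" "\<And>i. i < 6 \<Longrightarrow> \<pi> (Suc i) = [1, b, c, d, e, f] ! i"
    by (rule permutation_from_list) auto
  have "\<pi> 1 = 1" "\<pi> 2 = b" "\<pi> 3 = c" "\<pi> 4 = d" "\<pi> 5 = e" "\<pi> 6 = f"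
    using \<pi>(2)[of 0] \<pi>(2)[of 1] \<pi>(2)[of 2] \<pi>(2)[of 3] \<pi>(2)[of 4] \<pi>(2)[of 5]
    by (simp_all add: eval_nat_numeral)
  then have "G = (\<lambda>e. \<pi> ` e) ` {{1,2},{3,4},{5,6}}" by (simp add: G)
  then show "G \<in> permuted_expressions {{1,2},{3,4},{5,6}}"
    using \<pi>(1) unfolding permuted_expressions_def by blast
qed

lemma inj_matching_expression: "inj_on matching_expression (set matchings)"
  by (simp add: matchings_def matching_expression_def set_eq_subset doubleton_eq_iff)

lemma expression_sum_matchings:
  "expression_sum {{1,2},{3,4},{5,6}} x =
     (\<Sum>(b, c, d, e, f)\<leftarrow>matchings. (x 1 - x b)\<^sup>2 * (x c - x d)\<^sup>2 * (x e - x f)\<^sup>2)"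
proof -
  let ?g = "\<lambda>G. \<Prod>e \<in> G. (x (Min e) - x (Max e))\<^sup>2"
  have g: "?g (matching_expression (b, c, d, e, f)) = (x 1 - x b)\<^sup>2 * (x c - x d)\<^sup>2 * (x e - x f)\<^sup>2"
    if m: "(b, c, d, e, f) \<in> set matchings" for b c d e f
  proof -
    have "distinct [1, b, c, d, e, f] \<and> 1 < b \<and> c < d \<and> e < f"
      using m by (auto simp: matchings_def)
    then show ?thesis
      by (simp add: matching_expression_def doubleton_eq_iff min_def max_def mult.assoc)
  qed
  have "expression_sum {{1,2},{3,4},{5,6}} x = (\<Sum>m\<in>set matchings. ?g (matching_expression m))"
    unfolding expression_sum_def permuted_matchings
    by (rule sum.reindex[OF inj_matching_expression, unfolded comp_def])
  also have "\<dots> = (\<Sum>m\<in>set matchings. (\<lambda>(b, c, d, e, f). (x 1 - x b)\<^sup>2 * (x c - x d)\<^sup>2 * (x e - x f)\<^sup>2) m)"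
    using g by (intro sum.cong) (auto simp del: One_nat_def)
  also have "\<dots> = (\<Sum>m\<leftarrow>matchings. (\<lambda>(b, c, d, e, f). (x 1 - x b)\<^sup>2 * (x c - x d)\<^sup>2 * (x e - x f)\<^sup>2) m)"
    by (rule sum.distinct_set_conv_list) (simp add: matchings_def)
  finally show ?thesis .
qed

lemma cubic_from_roots:
  "[:-a, 1:] * [:-b, 1:] * [:-c, 1:] =
     [:- (a * b * c), a * b + a * c + b * c, - (a + b + c), 1 :: 'a::comm_ring_1:]"
  by (simp add: algebra_simps)

lemma sextic_from_cubics:
  "[:- s3, s2, - s1, 1:] * [:- t3, t2, - t1, 1:] =
     [:s3 * t3, - (s3 * t2 + s2 * t3), s3 * t1 + s2 * t2 + s1 * t3, - (s3 + s2 * t1 + s1 * t2 + t3),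
       s2 + s1 * t1 + t2, - (s1 + t1), 1 :: 'a::comm_ring_1:]"
  by (simp add: algebra_simps)

text \<open>
  The elementary symmetric polynomials of six roots, arranged as products of those of the first and of the last
  three roots; this keeps the expansion small.
\<close>

lemma sextic_from_roots:
  fixes x :: "nat \<Rightarrow> 'a::comm_ring_1"
  defines "s1 \<equiv> x 1 + x 2 + x 3" and "s2 \<equiv> x 1 * x 2 + x 1 * x 3 + x 2 * x 3" and "s3 \<equiv> x 1 * x 2 * x 3"
    and "t1 \<equiv> x 4 + x 5 + x 6" and "t2 \<equiv> x 4 * x 5 + x 4 * x 6 + x 5 * x 6" and "t3 \<equiv> x 4 * x 5 * x 6"
  shows "(\<Prod>i \<in> {1..6}. [:- x i, 1:]) =
     [:s3 * t3, - (s3 * t2 + s2 * t3), s3 * t1 + s2 * t2 + s1 * t3, - (s3 + s2 * t1 + s1 * t2 + t3),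
       s2 + s1 * t1 + t2, - (s1 + t1), 1:]"
proof -
  have six: "{1..6} = {1,2,3,4,5,6::nat}" by auto
  have "(\<Prod>i \<in> {1..6}. g i) = (g 1 * g 2 * g 3) * (g 4 * g 5 * g 6)" for g :: "nat \<Rightarrow> 'a poly"
    unfolding six by (simp add: mult.assoc)
  from this[of "\<lambda>i. [:- x i, 1:]"]
  show ?thesis unfolding cubic_from_roots sextic_from_cubics s1_def s2_def s3_def t1_def t2_def t3_def .
qed

lemma coeff_sextic:
  "coeff (smult a [:e0, e1, e2, e3, e4, e5, e6:]) 0 = a * e0"
  "coeff (smult a [:e0, e1, e2, e3, e4, e5, e6:]) 1 = a * e1"
  "coeff (smult a [:e0, e1, e2, e3, e4, e5, e6:]) 2 = a * e2"
  "coeff (smult a [:e0, e1, e2, e3, e4, e5, e6:]) 3 = a * e3"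
  "coeff (smult a [:e0, e1, e2, e3, e4, e5, e6:]) 4 = a * e4"
  "coeff (smult a [:e0, e1, e2, e3, e4, e5, e6:]) 5 = a * e5"
  "coeff (smult a [:e0, e1, e2, e3, e4, e5, e6:]) 6 = a * e6"
  by (simp_all add: eval_nat_numeral)

text \<open>
  Four times the classical expression \<open>J\<^sub>2 = -30c\<^sub>0c\<^sub>6 + 5c\<^sub>1c\<^sub>5 - 2c\<^sub>2c\<^sub>4 + (3/4)c\<^sub>3\<^sup>2\<close>.
\<close>

definition J2_mpoly :: "(nat \<Rightarrow>\<^sub>0 nat) \<Rightarrow>\<^sub>0 int" where
  "J2_mpoly = 20 * (mpoly_var 1 * mpoly_var 5) + 3 * (mpoly_var 3 * mpoly_var 3)
     - 120 * (mpoly_var 0 * mpoly_var 6) - 8 * (mpoly_var 2 * mpoly_var 4)"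

lemma mpoly_eval_J2_mpoly:
  "mpoly_eval c J2_mpoly = 20 * (c 1 * c 5) + 3 * (c 3 * c 3) - 120 * (c 0 * c 6) - 8 * (c 2 * c 4)"
  unfolding J2_mpoly_def
  by (simp only: mpoly_eval_add mpoly_eval_diff mpoly_eval_mult mpoly_eval_numeral mpoly_eval_var)

lemma matching_sum_identity:
  fixes x1 x2 x3 x4 x5 x6 :: "'a::field"
  defines "s1 \<equiv> x1 + x2 + x3" and "s2 \<equiv> x1 * x2 + x1 * x3 + x2 * x3" and "s3 \<equiv> x1 * x2 * x3"
    and "t1 \<equiv> x4 + x5 + x6" and "t2 \<equiv> x4 * x5 + x4 * x6 + x5 * x6" and "t3 \<equiv> x4 * x5 * x6"
  shows "(x1 - x2)\<^sup>2 * (x3 - x4)\<^sup>2 * (x5 - x6)\<^sup>2 + (x1 - x2)\<^sup>2 * (x3 - x5)\<^sup>2 * (x4 - x6)\<^sup>2 + (x1 - x2)\<^sup>2 * (x3 - x6)\<^sup>2 * (x4 - x5)\<^sup>2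
   + (x1 - x3)\<^sup>2 * (x2 - x4)\<^sup>2 * (x5 - x6)\<^sup>2 + (x1 - x3)\<^sup>2 * (x2 - x5)\<^sup>2 * (x4 - x6)\<^sup>2 + (x1 - x3)\<^sup>2 * (x2 - x6)\<^sup>2 * (x4 - x5)\<^sup>2
   + (x1 - x4)\<^sup>2 * (x2 - x3)\<^sup>2 * (x5 - x6)\<^sup>2 + (x1 - x4)\<^sup>2 * (x2 - x5)\<^sup>2 * (x3 - x6)\<^sup>2 + (x1 - x4)\<^sup>2 * (x2 - x6)\<^sup>2 * (x3 - x5)\<^sup>2
   + (x1 - x5)\<^sup>2 * (x2 - x3)\<^sup>2 * (x4 - x6)\<^sup>2 + (x1 - x5)\<^sup>2 * (x2 - x4)\<^sup>2 * (x3 - x6)\<^sup>2 + (x1 - x5)\<^sup>2 * (x2 - x6)\<^sup>2 * (x3 - x4)\<^sup>2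
   + (x1 - x6)\<^sup>2 * (x2 - x3)\<^sup>2 * (x4 - x5)\<^sup>2 + (x1 - x6)\<^sup>2 * (x2 - x4)\<^sup>2 * (x3 - x5)\<^sup>2 + (x1 - x6)\<^sup>2 * (x2 - x5)\<^sup>2 * (x3 - x4)\<^sup>2
   = 2 * (20 * ((s3 * t2 + s2 * t3) * (s1 + t1)) + 3 * ((s3 + s2 * t1 + s1 * t2 + t3) * (s3 + s2 * t1 + s1 * t2 + t3))
     - 120 * (s3 * t3) - 8 * ((s3 * t1 + s2 * t2 + s1 * t3) * (s2 + s1 * t1 + t2)))"
  unfolding s1_def s2_def s3_def t1_def t2_def t3_def by Groebner_Basis.algebra

lemma coefficient_mpoly_J2: "coefficient_mpoly J2_roots = mpoly_div_2power 2 J2_mpoly"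
proof (rule coefficient_mpoly_eqI)
  show "J2_mpoly \<in> sextic_mpolys"
    unfolding J2_mpoly_def
    by (intro sextic_mpolys_diff sextic_mpolys_closed sextic_mpolys_numeral) simp_all
  fix a :: complex and x :: "nat \<Rightarrow> complex"
  let ?S = "expression_sum {{1,2},{3,4},{5,6}} x"
  define s1 s2 s3 where "s1 = x 1 + x 2 + x 3" and "s2 = x 1 * x 2 + x 1 * x 3 + x 2 * x 3" and "s3 = x 1 * x 2 * x 3"
  define t1 t2 t3 where "t1 = x 4 + x 5 + x 6" and "t2 = x 4 * x 5 + x 4 * x 6 + x 5 * x 6" and "t3 = x 4 * x 5 * x 6"
  define E where "E = 20 * ((s3 * t2 + s2 * t3) * (s1 + t1)) + 3 * ((s3 + s2 * t1 + s1 * t2 + t3) * (s3 + s2 * t1 + s1 * t2 + t3))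
     - 120 * (s3 * t3) - 8 * ((s3 * t1 + s2 * t2 + s1 * t3) * (s2 + s1 * t1 + t2))"
  have S: "?S = 2 * E"
    unfolding E_def s1_def s2_def s3_def t1_def t2_def t3_def matching_sum_identity[symmetric] expression_sum_matchings
    by (simp add: matchings_def add.assoc del: One_nat_def)
  have "mpoly_eval (coeff (smult a (\<Prod>i \<in> {1..6}. [:- x i, 1:]))) J2_mpoly = a\<^sup>2 * E"
    unfolding mpoly_eval_J2_mpoly sextic_from_roots s1_def[symmetric] s2_def[symmetric] s3_def[symmetric]
      t1_def[symmetric] t2_def[symmetric] t3_def[symmetric] coeff_sextic E_def
    by Groebner_Basis.algebra
  then show "mpoly_eval (coeff (smult a (\<Prod>i \<in> {1..6}. [:- x i, 1:]))) J2_mpoly = 2 ^ 2 * J2_roots a x"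
    unfolding J2_roots_def I2_roots_def S by simp
qed

text \<open>
  All coefficients of \<open>J2_mpoly\<close> except those of \<open>c\<^sub>1c\<^sub>5\<close> and \<open>c\<^sub>2c\<^sub>4\<close> are divisible by 3.
\<close>

theorem igusa_J2_char_3:
  fixes F :: "'a::field poly"
  assumes "CHAR('a) = 3"
  shows "igusa_J2 F = coeff F 2 * coeff F 4 - coeff F 1 * coeff F 5"
proof -
  have 3: "(3::'a) = 0" and 2: "(2::'a) \<noteq> 0"
    using three_eq_0[OF assms] two_neq_0[OF assms] .
  define c where "c = coeff F"
  \<comment> \<open>The denominator 4 of \<open>J\<^sub>2\<close> is 1 in characteristic 3.\<close>
  have "(2::'a) ^ 2 = 1 + 3" by simp
  then have "igusa_J2 F = mpoly_eval c J2_mpoly"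
    by (simp add: igusa_J2_def coefficient_mpoly_J2 eval_mpoly_div_2power[OF 2] c_def 3)
  also have "\<dots> = c 2 * c 4 - c 1 * c 5
      + 3 * (7 * (c 1 * c 5) + c 3 * c 3 - 40 * (c 0 * c 6) - 3 * (c 2 * c 4))"
    unfolding mpoly_eval_J2_mpoly by (simp add: algebra_simps)
  finally show ?thesis by (simp add: c_def 3)
qed

section \<open>The discriminant as a Bezoutian\<close>

text \<open>
  The coefficients of \<open>F'\<close>. The case distinction keeps variables beyond \<open>c\<^sub>6\<close> out of the entries below.
\<close>

definition derivative_coeff :: "(nat \<Rightarrow> 'a::comm_ring_1) \<Rightarrow> nat \<Rightarrow> 'a" where
  "derivative_coeff c m = (if m < 6 then of_nat (m + 1) * c (m + 1) else 0)"

text \<open>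
  The Bezoutian of \<open>F\<close> and \<open>F'\<close> is the symmetric matrix of the coefficients of \<open>x\<^sup>iy\<^sup>j\<close> in
  \<open>(F(x)F'(y) - F(y)F'(x))/(x - y)\<close>. Its determinant is \<open>c\<^sub>6\<^sup>2\<close> times the discriminant. Every entry of its last row
  and of its last column is divisible by \<open>c\<^sub>6\<close>, and the corner entry \<open>6c\<^sub>6\<^sup>2\<close> by \<open>c\<^sub>6\<^sup>2\<close>; dividing these factors out
  removes the factor \<open>c\<^sub>6\<^sup>2\<close> from the determinant, also for \<open>c\<^sub>6 = 0\<close>.
\<close>

definition bezout_entry :: "(nat \<Rightarrow> 'a::comm_ring_1) \<Rightarrow> nat \<Rightarrow> nat \<Rightarrow> 'a" where
  "bezout_entry c i j =
     (if i = 5 \<and> j = 5 then 6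
      else if i = 5 then derivative_coeff c j
      else if j = 5 then derivative_coeff c i
      else (\<Sum>k\<le>min i (5 - j). c (j + k + 1) * derivative_coeff c (i - k)
                             - c (i - k) * derivative_coeff c (j + k + 1)))"

definition bezout_mat :: "(nat \<Rightarrow> 'a::comm_ring_1) \<Rightarrow> 'a mat" where
  "bezout_mat c = mat 6 6 (\<lambda>(i, j). bezout_entry c i j)"

lemma bezout_mat_carrier [simp]: "bezout_mat c \<in> carrier_mat 6 6"
  by (simp add: bezout_mat_def)

definition sextic_value :: "(nat \<Rightarrow> 'a::comm_ring_1) \<Rightarrow> 'a \<Rightarrow> 'a" where
  "sextic_value c y = (\<Sum>k<7. c k * y ^ k)"

definition sextic_deriv :: "(nat \<Rightarrow> 'a::comm_ring_1) \<Rightarrow> 'a \<Rightarrow> 'a" where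
  "sextic_deriv c y = (\<Sum>k<6. derivative_coeff c k * y ^ k)"

text \<open>
  The vector of powers of \<open>y\<close>, scaled in its last coordinate to compensate the division by \<open>c\<^sub>6\<close>.
\<close>

definition power_vec :: "(nat \<Rightarrow> 'a::comm_ring_1) \<Rightarrow> 'a \<Rightarrow> nat \<Rightarrow> 'a" where
  "power_vec c y i = (if i = 5 then c 6 * y ^ 5 else y ^ i)"

text \<open>
  The coefficient of \<open>x\<^sup>i\<close> in \<open>(F(x) - F(y))/(x - y)\<close>, divided by \<open>c\<^sub>6\<close> for \<open>i = 5\<close>.
\<close>

definition horner_coeff :: "(nat \<Rightarrow> 'a::comm_ring_1) \<Rightarrow> 'a \<Rightarrow> nat \<Rightarrow> 'a" where
  "horner_coeff c y i = (if i = 5 then 1 else \<Sum>k<6 - i. c (i + k + 1) * y ^ k)"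

lemma less_6_cases: "i < 6 \<Longrightarrow> i = 0 \<or> i = 1 \<or> i = 2 \<or> i = 3 \<or> i = 4 \<or> i = (5::nat)"
  by auto

text \<open>
  This compares the coefficients of \<open>x\<^sup>i\<close> in the decomposition
  \<open>(F(x)F'(y) - F(y)F'(x))/(x - y) = F'(y) (F(x) - F(y))/(x - y) - F(y) (F'(x) - F'(y))/(x - y)\<close>.
\<close>

lemma bezout_power_vec_row_identity:
  fixes c :: "nat \<Rightarrow> 'a::field"
  assumes "i < 6"
  shows "(\<Sum>j<6. bezout_entry c i j * power_vec c y j) = horner_coeff c y i * sextic_deriv c y
      - (\<Sum>k<5 - i. derivative_coeff c (i + k + 1) * y ^ k) * sextic_value c y" (is "?P i")
proof -
  have "?P 0" "?P 1" "?P 2" "?P 3" "?P 4" "?P 5"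
    apply (simp_all add: bezout_entry_def power_vec_def horner_coeff_def sextic_deriv_def derivative_coeff_def
        sextic_value_def eval_nat_numeral)
    apply (Groebner_Basis.algebra)+
    done
  then show ?thesis using less_6_cases[OF assms] by blast
qed

lemma bezout_power_vec_row:
  fixes c :: "nat \<Rightarrow> 'a::field"
  assumes "i < 6" and "sextic_value c y = 0"
  shows "(\<Sum>j<6. bezout_entry c i j * power_vec c y j) = horner_coeff c y i * sextic_deriv c y"
  using bezout_power_vec_row_identity[OF assms(1), of c y] assms(2) by simp

lemma horner_power_vec:
  fixes c :: "nat \<Rightarrow> 'a::field"
  shows "(x - y) * (\<Sum>i<6. power_vec c x i * horner_coeff c y i) = sextic_value c x - sextic_value c y"
  apply (simp add: power_vec_def horner_coeff_def sextic_value_def eval_nat_numeral)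
  apply Groebner_Basis.algebra
  done

lemma horner_power_vec_diag:
  fixes c :: "nat \<Rightarrow> 'a::field"
  shows "(\<Sum>i<6. power_vec c y i * horner_coeff c y i) = sextic_deriv c y"
  apply (simp add: power_vec_def horner_coeff_def sextic_deriv_def derivative_coeff_def eval_nat_numeral)
  apply Groebner_Basis.algebra
  done

text \<open>
  For distinct roots \<open>x\<close> and \<open>y\<close> of \<open>F\<close> the quotient \<open>(F(x)F'(y) - F(y)F'(x))/(x - y)\<close> is 0. As a polynomial it has
  the value \<open>F'(y)\<^sup>2 - F(y)F''(y) = F'(y)\<^sup>2\<close> at \<open>x = y\<close>.
\<close>

lemma bezout_form_at_roots:
  fixes c :: "nat \<Rightarrow> 'a::field"
  assumes x: "sextic_value c x = 0" and y: "sextic_value c y = 0"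
  shows "(\<Sum>i<6. power_vec c x i * (\<Sum>j<6. bezout_entry c i j * power_vec c y j)) =
    (if x = y then (sextic_deriv c y)\<^sup>2 else 0)"
proof -
  let ?h = "\<Sum>i<6. power_vec c x i * horner_coeff c y i"
  have "(\<Sum>i<6. power_vec c x i * (\<Sum>j<6. bezout_entry c i j * power_vec c y j)) = ?h * sextic_deriv c y"
    unfolding sum_distrib_right
    by (intro sum.cong refl) (simp only: lessThan_iff bezout_power_vec_row[OF _ y] mult.assoc)
  moreover have "?h = sextic_deriv c y" if "x = y"
    using that horner_power_vec_diag by blast
  moreover have "?h = 0" if "x \<noteq> y"
  proof -
    have "(x - y) * ?h = 0" unfolding horner_power_vec x y by simp
    then show ?thesis using that by simp
  qed
  ultimately show ?thesis by (simp add: power2_eq_square)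
qed

definition power_mat :: "(nat \<Rightarrow> 'a::comm_ring_1) \<Rightarrow> (nat \<Rightarrow> 'a) \<Rightarrow> 'a mat" where
  "power_mat c r = mat 6 6 (\<lambda>(i, j). power_vec c (r j) i)"

lemma congruence_entry:
  fixes A W :: "'a::comm_ring_1 mat"
  assumes A: "A \<in> carrier_mat n n" and W: "W \<in> carrier_mat n n" and "a < n" "b < n"
  shows "(transpose_mat W * (A * W)) $$ (a, b) = (\<Sum>i<n. W $$ (i, a) * (\<Sum>j<n. A $$ (i, j) * W $$ (j, b)))"
  using assms by (simp add: scalar_prod_def lessThan_atLeast0)

lemma det_congruence:
  fixes A W :: "'a::comm_ring_1 mat"
  assumes A: "A \<in> carrier_mat n n" and W: "W \<in> carrier_mat n n"
  shows "det (transpose_mat W * (A * W)) = (det W)\<^sup>2 * det A"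
  using det_mult[of "transpose_mat W" n "A * W"] det_mult[OF A W] A W
  by (simp add: det_transpose[OF W] power2_eq_square algebra_simps)

text \<open>
  In the basis of the power vectors of the six roots the Bezoutian is the diagonal matrix with entries \<open>F'(r\<^sub>j)\<^sup>2\<close>.
\<close>

lemma bezout_congruence_diagonal:
  fixes c :: "nat \<Rightarrow> 'a::field"
  assumes root: "\<And>j. j < 6 \<Longrightarrow> sextic_value c (r j) = 0" and inj: "inj_on r {..<6}"
  shows "(det (power_mat c r))\<^sup>2 * det (bezout_mat c) = (\<Prod>j<6. (sextic_deriv c (r j))\<^sup>2)"
proof -
  let ?W = "power_mat c r" and ?A = "bezout_mat c"
  have W: "?W \<in> carrier_mat 6 6" by (simp add: power_mat_def)
  let ?D = "transpose_mat ?W * (?A * ?W)"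
  have D: "?D $$ (a, b) = (if a = b then (sextic_deriv c (r a))\<^sup>2 else 0)" if a: "a < 6" and b: "b < 6" for a b
  proof -
    have "?D $$ (a, b) = (\<Sum>i<6. power_vec c (r a) i * (\<Sum>j<6. bezout_entry c i j * power_vec c (r b) j))"
      using a b by (subst congruence_entry[OF bezout_mat_carrier W]) (auto simp: power_mat_def bezout_mat_def intro!: sum.cong)
    also have "\<dots> = (if a = b then (sextic_deriv c (r a))\<^sup>2 else 0)"
      unfolding bezout_form_at_roots[OF root[OF a] root[OF b]] using inj a b by (auto simp: inj_on_def)
    finally show ?thesis .
  qed
  have Dc: "?D \<in> carrier_mat 6 6" using mult_carrier_mat[OF _ mult_carrier_mat[OF bezout_mat_carrier W]] W by simp
  have "upper_triangular ?D" using D Dc by (intro upper_triangularI) auto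
  then have "det ?D = prod_list (diag_mat ?D)" using Dc by (rule det_upper_triangular)
  also have "\<dots> = (\<Prod>j<6. ?D $$ (j, j))"
    unfolding prod_list_diag_prod carrier_matD(1)[OF Dc] lessThan_atLeast0 ..
  also have "\<dots> = (\<Prod>j<6. (sextic_deriv c (r j))\<^sup>2)"
    using D by (intro prod.cong) auto
  finally show ?thesis unfolding det_congruence[OF bezout_mat_carrier W] .
qed

text \<open>
  The power vector of a double root lies in the kernel.
\<close>

lemma det_bezout_mat_double_root:
  fixes c :: "nat \<Rightarrow> 'a::field"
  assumes "sextic_value c y = 0" "sextic_deriv c y = 0"
  shows "det (bezout_mat c) = 0"
proof -
  define v where "v = vec 6 (power_vec c y)"
  have "bezout_mat c *\<^sub>v v = 0\<^sub>v 6"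
  proof (rule eq_vecI)
    fix i assume "i < dim_vec (0\<^sub>v 6 :: 'a vec)"
    then have i: "i < 6" by simp
    have "(bezout_mat c *\<^sub>v v) $ i = (\<Sum>j<6. bezout_entry c i j * power_vec c y j)"
      using i by (simp add: bezout_mat_def v_def scalar_prod_def lessThan_atLeast0)
    also have "\<dots> = 0" unfolding bezout_power_vec_row[OF i assms(1)] assms(2) by simp
    finally show "(bezout_mat c *\<^sub>v v) $ i = 0\<^sub>v 6 $ i" using i by simp
  qed (simp add: bezout_mat_def)
  moreover have "v $ 0 = 1" by (simp add: v_def power_vec_def)
  then have "v \<noteq> 0\<^sub>v 6" by auto
  moreover have "v \<in> carrier_vec 6" by (simp add: v_def)
  ultimately show ?thesis using det_0_iff_vec_prod_zero_field[OF bezout_mat_carrier] by blast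
qed

text \<open>
  For a quintic the sixth root is at infinity, and its power vector is replaced by the last unit vector. The
  Bezoutian then becomes an arrow matrix: diagonal entries \<open>d\<^sub>j\<^sup>2\<close> with \<open>d\<^sub>j = F'(r\<^sub>j)\<close>, border \<open>d\<^sub>j\<close> and corner 6. A
  kernel vector \<open>u\<close> satisfies \<open>d\<^sub>ju\<^sub>j = -u\<^sub>5\<close> for all five \<open>j\<close>, and the last row gives
  \<open>0 = -5u\<^sub>5 + 6u\<^sub>5 = u\<^sub>5\<close>, whence \<open>u = 0\<close>.
\<close>

lemma det_bezout_mat_degree_5:
  fixes c :: "nat \<Rightarrow> 'a::field" and r :: "nat \<Rightarrow> 'a"
  assumes c6: "c 6 = 0" and root: "\<And>j. j < 5 \<Longrightarrow> sextic_value c (r j) = 0" and inj: "inj_on r {..<5}"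
    and simple: "\<And>j. j < 5 \<Longrightarrow> sextic_deriv c (r j) \<noteq> 0"
  shows "det (bezout_mat c) \<noteq> 0"
proof
  assume det: "det (bezout_mat c) = 0"
  define W where "W = mat 6 6 (\<lambda>(i, j). if j = 5 then (if i = 5 then 1 else 0) else power_vec c (r j) i)"
  let ?A = "bezout_mat c"
  let ?D = "transpose_mat W * (?A * W)"
  have W: "W \<in> carrier_mat 6 6" by (simp add: W_def)
  have Dc: "?D \<in> carrier_mat 6 6" using mult_carrier_mat[OF _ mult_carrier_mat[OF bezout_mat_carrier W]] W by simp
  have "det ?D = 0" unfolding det_congruence[OF bezout_mat_carrier W] det by simp
  then obtain u where u: "u \<in> carrier_vec 6" "u \<noteq> 0\<^sub>v 6" "?D *\<^sub>v u = 0\<^sub>v 6"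
    using det_0_iff_vec_prod_zero_field[OF Dc] by blast
  have eq: "(\<Sum>b<6. ?D $$ (a, b) * u $ b) = 0" if a: "a < 6" for a
  proof -
    have "(\<Sum>b<6. ?D $$ (a, b) * u $ b) = (?D *\<^sub>v u) $ a"
      using a u(1) Dc by (simp add: scalar_prod_def lessThan_atLeast0 W_def bezout_mat_def)
    then show ?thesis using u(3) a by simp
  qed
  define d where "d = (\<lambda>j. sextic_deriv c (r j))"
  have D1: "?D $$ (a, b) = (if a = b then (d a)\<^sup>2 else 0)" if a: "a < 5" and b: "b < 5" for a b
  proof -
    have "?D $$ (a, b) = (\<Sum>i<6. power_vec c (r a) i * (\<Sum>j<6. bezout_entry c i j * power_vec c (r b) j))"
      using a b by (subst congruence_entry[OF bezout_mat_carrier W]) (auto simp: W_def bezout_mat_def intro!: sum.cong)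
    also have "\<dots> = (if a = b then (d a)\<^sup>2 else 0)"
      unfolding bezout_form_at_roots[OF root[OF a] root[OF b]] d_def using inj a b by (auto simp: inj_on_def)
    finally show ?thesis .
  qed
  have D2: "?D $$ (5, b) = d b" if b: "b < 5" for b
  proof -
    have "?D $$ (5, b) = (\<Sum>i<6. (if i = 5 then 1 else 0) * (\<Sum>j<6. bezout_entry c i j * power_vec c (r b) j))"
      using b by (subst congruence_entry[OF bezout_mat_carrier W]) (auto simp: W_def bezout_mat_def intro!: sum.cong)
    also have "\<dots> = (\<Sum>j<6. bezout_entry c 5 j * power_vec c (r b) j)"
      by (simp add: eval_nat_numeral)
    also have "\<dots> = d b"
      using bezout_power_vec_row[of 5 c, OF _ root[OF b]] by (simp add: horner_coeff_def d_def)
    finally show ?thesis .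
  qed
  have col5: "(\<Sum>j<6. bezout_entry c i j * (if j = 5 then 1 else 0)) = bezout_entry c i 5" for i
    by (simp add: eval_nat_numeral)
  have D3: "?D $$ (a, 5) = d a" if a: "a < 5" for a
  proof -
    have "?D $$ (a, 5) = (\<Sum>i<6. power_vec c (r a) i * (\<Sum>j<6. bezout_entry c i j * (if j = 5 then 1 else 0)))"
      using a by (subst congruence_entry[OF bezout_mat_carrier W]) (auto simp: W_def bezout_mat_def intro!: sum.cong)
    also have "\<dots> = d a"
      unfolding col5 d_def using c6
      by (simp add: bezout_entry_def power_vec_def sextic_deriv_def derivative_coeff_def eval_nat_numeral algebra_simps)
    finally show ?thesis .
  qed
  have D4: "?D $$ (5, 5) = 6"
  proof -
    have "?D $$ (5, 5) = (\<Sum>i<6. (if i = 5 then 1 else 0) * (\<Sum>j<6. bezout_entry c i j * (if j = 5 then 1 else 0)))"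
      by (subst congruence_entry[OF bezout_mat_carrier W]) (auto simp: W_def bezout_mat_def intro!: sum.cong)
    also have "\<dots> = 6" unfolding col5 by (simp add: eval_nat_numeral bezout_entry_def)
    finally show ?thesis .
  qed
  have six: "{..<6} = insert 5 {..<5::nat}" by auto
  have du: "d a * u $ a = - (u $ 5)" if a: "a < 5" for a
  proof -
    have "(\<Sum>b<5. ?D $$ (a, b) * u $ b) = (\<Sum>b<5. if b = a then (d a)\<^sup>2 * u $ a else 0)"
      using a D1 by (intro sum.cong) auto
    then have "d a * (d a * u $ a + u $ 5) = 0"
      using eq[of a] a D3[OF a] unfolding six by (simp add: power2_eq_square algebra_simps)
    then show ?thesis using simple[OF a] by (simp add: d_def eq_neg_iff_add_eq_0)
  qed
  \<comment> \<open>The last row of the arrow matrix.\<close>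
  have "(\<Sum>b<5. ?D $$ (5, b) * u $ b) = (\<Sum>b<(5::nat). - (u $ 5))"
    using D2 du by (intro sum.cong) auto
  then have "6 * u $ 5 - 5 * u $ 5 = 0"
    using eq[of 5] D4 unfolding six by simp
  then have u5: "u $ 5 = 0" by (simp add: algebra_simps)
  have "u $ i = 0" if "i < 6" for i
  proof (cases "i = 5")
    case False
    then have "i < 5" using that by simp
    then show ?thesis using du[of i] u5 simple[of i] by (simp add: d_def)
  qed (simp add: u5)
  then have "u = 0\<^sub>v 6" using u(1) by (intro eq_vecI) auto
  then show False using u(2) by blast
qed

section \<open>The invariant of degree 10\<close>

text \<open>
  The roots are listed with multiplicity by the factorization into linear factors, and a repetition
  would contradict squarefreeness.
\<close>

lemma alg_closed_distinct_roots:
  fixes F :: "'a::alg_closed_field poly"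
  assumes sf: "rsquarefree F"
  obtains r :: "nat \<Rightarrow> 'a" where "inj_on r {..<degree F}" "\<And>i. i < degree F \<Longrightarrow> poly F (r i) = 0"
proof -
  have F: "F \<noteq> 0" using sf by (simp add: rsquarefree_def)
  obtain M where M: "size M = degree F" "F = smult (lead_coeff F) (\<Prod>x\<in>#M. [:- x, 1:])"
    using alg_closed_imp_factorization[OF F] by blast
  obtain xs where xs: "mset xs = M" using ex_mset by blast
  have F': "F = smult (lead_coeff F) (\<Prod>x\<leftarrow>xs. [:- x, 1:])"
    using M(2) by (simp add: prod_mset_prod_list flip: xs mset_map)
  have "distinct xs"
  proof (rule ccontr)
    assume "\<not> distinct xs"
    then obtain ys zs ws y where split: "xs = ys @ [y] @ zs @ [y] @ ws" using not_distinct_decomp by blast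
    let ?p = "\<lambda>xs. \<Prod>x\<leftarrow>xs. [:- x, 1:]"
    have "?p xs = ?p ys * ([:- y, 1:] * (?p zs * ([:- y, 1:] * ?p ws)))"
      by (simp only: split map_append prod_list.append list.map prod_list.Cons append.simps)
    also have "\<dots> = [:- y, 1:] ^ 2 * (?p ys * (?p zs * ?p ws))"
      by (simp only: power2_eq_square mult_ac)
    finally have "[:- y, 1:] ^ 2 dvd ?p xs" by (rule dvdI)
    then have "[:- y, 1:] ^ 2 dvd F" by (subst F') (rule dvd_smult)
    then have "2 \<le> order y F" using F by (simp add: order_divides)
    moreover have "order y F = 0 \<or> order y F = 1" using sf by (simp add: rsquarefree_def)
    ultimately show False by auto
  qed
  moreover have "poly F y = 0" if "y \<in> set xs" for y
  proof -
    have "poly (\<Prod>x\<leftarrow>xs. [:- x, 1:]) y = 0" using that by (induction xs) auto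
    then show ?thesis by (subst F') simp
  qed
  ultimately show ?thesis
    using that[of "\<lambda>i. xs ! i"] M(1) xs by (auto simp: inj_on_nth)
qed

lemma poly_pderiv_linear_factor:
  fixes G :: "'a::field poly"
  shows "poly (pderiv ([:- y, 1:] * G)) y = poly G y"
  unfolding pderiv_mult by (simp add: pderiv_pCons)

lemma rsquarefree_pderiv_nonzero:
  fixes F :: "'a::field poly"
  assumes sf: "rsquarefree F" and root: "poly F y = 0"
  shows "poly (pderiv F) y \<noteq> 0"
proof -
  have F: "F \<noteq> 0" using sf by (simp add: rsquarefree_def)
  then have "order y F = 1" using sf root unfolding rsquarefree_def by (metis order_root)
  then obtain G where G: "F = [:- y, 1:] * G" "\<not> [:- y, 1:] dvd G"
    using order_decomp[OF F, of y] by auto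
  have "poly (pderiv F) y = poly G y" unfolding G(1) by (rule poly_pderiv_linear_factor)
  then show ?thesis using G(2) by (simp add: poly_eq_0_iff_dvd)
qed

lemma sextic_value_coeff:
  assumes "degree F \<le> 6"
  shows "sextic_value (coeff F) y = poly F y"
proof -
  have "poly F y = (\<Sum>k\<le>degree F. coeff F k * y ^ k)" by (rule poly_altdef)
  also have "\<dots> = (\<Sum>k<7. coeff F k * y ^ k)"
    using assms by (intro sum.mono_neutral_left) (auto simp: coeff_eq_0)
  finally show ?thesis by (simp add: sextic_value_def)
qed

lemma sextic_deriv_coeff:
  fixes F :: "'a::field poly"
  assumes "degree F \<le> 6"
  shows "sextic_deriv (coeff F) y = poly (pderiv F) y"
proof -
  have "degree (pderiv F) \<le> 5"
  proof (rule degree_le, intro allI impI)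
    fix i :: nat assume "5 < i"
    then show "coeff (pderiv F) i = 0" using assms by (simp add: coeff_pderiv coeff_eq_0)
  qed
  then have "poly (pderiv F) y = (\<Sum>k<6. coeff (pderiv F) k * y ^ k)"
    unfolding poly_altdef by (intro sum.mono_neutral_left) (auto simp: coeff_eq_0)
  also have "\<dots> = sextic_deriv (coeff F) y"
    unfolding sextic_deriv_def by (intro sum.cong refl) (simp add: derivative_coeff_def coeff_pderiv)
  finally show ?thesis by simp
qed

theorem det_bezout_mat_nonzero:
  fixes F :: "'a::alg_closed_field poly"
  assumes sf: "rsquarefree F" and deg: "degree F = 5 \<or> degree F = 6"
  shows "det (bezout_mat (coeff F)) \<noteq> 0"
proof -
  obtain r :: "nat \<Rightarrow> 'a" where r: "inj_on r {..<degree F}" "\<And>i. i < degree F \<Longrightarrow> poly F (r i) = 0"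
    using alg_closed_distinct_roots[OF sf] by blast
  have le: "degree F \<le> 6" using deg by auto
  have root: "sextic_value (coeff F) (r i) = 0" and simple: "sextic_deriv (coeff F) (r i) \<noteq> 0"
    if "i < degree F" for i
    using r(2)[OF that] rsquarefree_pderiv_nonzero[OF sf r(2)[OF that]]
    by (simp_all add: sextic_value_coeff[OF le] sextic_deriv_coeff[OF le])
  from deg show ?thesis
  proof
    assume 5: "degree F = 5"
    show ?thesis
      by (rule det_bezout_mat_degree_5[of _ r]) (use 5 r(1) root simple in \<open>auto simp: coeff_eq_0\<close>)
  next
    assume 6: "degree F = 6"
    have "(det (power_mat (coeff F) r))\<^sup>2 * det (bezout_mat (coeff F)) = (\<Prod>j<6. (sextic_deriv (coeff F) (r j))\<^sup>2)"
      by (rule bezout_congruence_diagonal) (use 6 r(1) root in auto)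
    moreover have "(\<Prod>j<6. (sextic_deriv (coeff F) (r j))\<^sup>2) \<noteq> 0"
      using simple 6 by simp
    ultimately show ?thesis by auto
  qed
qed

text \<open>
  Passing from the monomials to the Newton polynomials \<open>(X - x\<^sub>0)\<dots>(X - x\<^bsub>k-1\<^esub>)\<close> is a unitriangular change of
  basis, and the matrix of values of the Newton polynomials at the \<open>x\<^sub>j\<close> is triangular.
\<close>

lemma det_vandermonde:
  fixes x :: "nat \<Rightarrow> 'a::field"
  shows "det (mat n n (\<lambda>(i, j). x j ^ i)) = (\<Prod>j<n. \<Prod>i<j. x j - x i)"
proof -
  define N where "N = (\<lambda>k. \<Prod>i<k. [:- x i, 1:])"
  have deg: "degree (N k) = k" for k
    unfolding N_def by (subst degree_prod_sum_eq) auto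
  have lc: "coeff (N k) k = 1" for k
    using lead_coeff_prod[of "\<lambda>i. [:- x i, 1:]" "{..<k}"] deg[of k] by (simp add: N_def)
  define A where "A = mat n n (\<lambda>(k, i). coeff (N k) i)"
  define V where "V = mat n n (\<lambda>(i, j). x j ^ i)"
  have A: "A \<in> carrier_mat n n" and V: "V \<in> carrier_mat n n" by (simp_all add: A_def V_def)
  have AV: "A * V \<in> carrier_mat n n" using A V by simp
  have e: "(A * V) $$ (k, j) = (\<Prod>i<k. x j - x i)" if "k < n" "j < n" for k j
  proof -
    have "(A * V) $$ (k, j) = (\<Sum>i<n. coeff (N k) i * x j ^ i)"
      using that by (simp add: A_def V_def scalar_prod_def lessThan_atLeast0)
    also have "\<dots> = poly (N k) (x j)"
      unfolding poly_altdef using that deg[of k] by (intro sum.mono_neutral_right) (auto simp: coeff_eq_0)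
    also have "\<dots> = (\<Prod>i<k. x j - x i)"
      by (simp add: N_def poly_prod)
    finally show ?thesis .
  qed
  have "det A = prod_list (diag_mat A)"
    by (rule det_lower_triangular[OF _ A]) (simp add: A_def coeff_eq_0 deg)
  also have "\<dots> = 1"
    unfolding prod_list_diag_prod by (intro prod.neutral) (simp add: A_def lc)
  finally have "det V = det (A * V)" by (simp add: det_mult[OF A V])
  also have "\<dots> = prod_list (diag_mat (A * V))"
  proof (rule det_upper_triangular[OF _ AV])
    have "(A * V) $$ (k, j) = 0" if "j < k" "k < n" for j k
      using that by (subst e) (auto intro!: bexI[of _ j])
    then show "upper_triangular (A * V)" using AV by (intro upper_triangularI) auto
  qed
  also have "\<dots> = (\<Prod>j<n. \<Prod>i<j. x j - x i)"
    unfolding prod_list_diag_prod carrier_matD(1)[OF AV] lessThan_atLeast0[symmetric]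
    by (intro prod.cong refl e) auto
  finally show ?thesis by (simp add: V_def)
qed

lemma det_power_mat:
  fixes c :: "nat \<Rightarrow> 'a::field"
  shows "det (power_mat c r) = c 6 * (\<Prod>j<6. \<Prod>i<j. r j - r i)"
proof -
  define S where "S = mat 6 6 (\<lambda>(i, j). if i = j then (if i = 5 then c 6 else 1) else (0 :: 'a))"
  define V where "V = mat 6 6 (\<lambda>(i, j). r j ^ i)"
  have S: "S \<in> carrier_mat 6 6" and V: "V \<in> carrier_mat 6 6" by (simp_all add: S_def V_def)
  have "power_mat c r = S * V"
  proof (rule eq_matI)
    fix i j assume "i < dim_row (S * V)" "j < dim_col (S * V)"
    then have ij: "i < 6" "j < 6" using S V by auto
    have "(S * V) $$ (i, j) = (\<Sum>k<6. (if i = k then (if i = 5 then c 6 else 1) else 0) * r j ^ k)"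
      using ij by (simp add: S_def V_def scalar_prod_def lessThan_atLeast0)
    also have "\<dots> = (\<Sum>k<6. if k = i then (if i = 5 then c 6 else 1) * r j ^ i else 0)"
      by (intro sum.cong) auto
    also have "\<dots> = power_vec c (r j) i" using ij by (simp add: power_vec_def)
    finally show "power_mat c r $$ (i, j) = (S * V) $$ (i, j)" using ij by (simp add: power_mat_def)
  qed (simp_all add: power_mat_def S_def V_def)
  moreover have "det S = c 6"
  proof -
    have "det S = prod_list (diag_mat S)"
      by (rule det_lower_triangular[OF _ S]) (simp add: S_def)
    also have "\<dots> = (\<Prod>i<(6::nat). if i = 5 then c 6 else 1)"
      unfolding prod_list_diag_prod carrier_matD(1)[OF S] lessThan_atLeast0[symmetric]
      by (intro prod.cong) (auto simp: S_def)
    finally show ?thesis by simp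
  qed
  ultimately show ?thesis using det_mult[OF S V] by (simp add: V_def det_vandermonde)
qed

text \<open>
  For distinct roots the congruence with the diagonal matrix gives
  \<open>a\<^sup>2\<Delta>\<^sup>2 \<cdot> det = a\<^sup>1\<^sup>2\<Delta>\<^sup>4\<close>, where \<open>\<Delta>\<close> is the Vandermonde determinant, and one cancels. If two roots coincide
  both sides vanish.
\<close>

theorem det_bezout_mat_discriminant:
  fixes a :: "'a::field" and r :: "nat \<Rightarrow> 'a"
  assumes a: "a \<noteq> 0"
  defines "F \<equiv> smult a (\<Prod>i<6. [:- r i, 1:])"
  shows "det (bezout_mat (coeff F)) = a ^ 10 * (\<Prod>j<6. \<Prod>i<j. (r i - r j)\<^sup>2)"
proof -
  have degP: "degree (\<Prod>i<6. [:- r i, 1:]) = 6" by (subst degree_prod_sum_eq) auto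
  then have degF: "degree F = 6" using a by (simp add: F_def)
  then have le: "degree F \<le> 6" by simp
  have "lead_coeff (\<Prod>i<6. [:- r i, 1:]) = 1" by (simp add: lead_coeff_prod)
  then have c6: "coeff F 6 = a" using degP by (simp add: F_def)
  have root: "sextic_value (coeff F) (r i) = 0" if "i < 6" for i
    unfolding sextic_value_coeff[OF le] using that by (auto simp: F_def poly_prod)
  have deriv: "sextic_deriv (coeff F) (r i) = a * (\<Prod>j\<in>{..<6}-{i}. r i - r j)" if i: "i < 6" for i
  proof -
    have "F = [:- r i, 1:] * smult a (\<Prod>j\<in>{..<6}-{i}. [:- r j, 1:])"
      using i by (simp add: F_def prod.remove[of _ i])
    then have "poly (pderiv F) (r i) = poly (smult a (\<Prod>j\<in>{..<6}-{i}. [:- r j, 1:])) (r i)"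
      using poly_pderiv_linear_factor by metis
    then show ?thesis unfolding sextic_deriv_coeff[OF le] by (simp add: poly_prod)
  qed
  show ?thesis
  proof (cases "inj_on r {..<6}")
    case False
    then obtain i j where ij: "i < 6" "j < 6" "i \<noteq> j" "r i = r j" by (auto simp: inj_on_def)
    have "sextic_deriv (coeff F) (r i) = 0" unfolding deriv[OF ij(1)] using ij by auto
    then have "det (bezout_mat (coeff F)) = 0" by (rule det_bezout_mat_double_root[OF root[OF ij(1)]])
    moreover have "(\<Prod>j<6. \<Prod>i<j. (r i - r j)\<^sup>2) = 0"
    proof -
      have "\<exists>m<6. \<exists>l<m. r l = r m" using ij by (metis linorder_neqE_nat)
      then show ?thesis by auto
    qed
    ultimately show ?thesis by simp
  next
    case True
    define \<Delta> where "\<Delta> = (\<Prod>j<6. \<Prod>i<j. r j - r i)"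
    have "r j \<noteq> r i" if "j < 6" "i < j" for i j
      using inj_onD[OF True, of j i] that by auto
    then have "\<Delta> \<noteq> 0" by (simp add: \<Delta>_def)
    have "(\<Prod>j<6. (\<Prod>i\<in>{..<6}-{j}. r j - r i)) = (\<Prod>j<6. (\<Prod>i<j. r j - r i) * (\<Prod>i\<in>{j<..<6}. r j - r i))"
    proof (intro prod.cong refl)
      fix j :: nat assume "j \<in> {..<6}"
      then have split: "{..<6} - {j} = {..<j} \<union> {j<..<6}" by auto
      show "(\<Prod>i\<in>{..<6}-{j}. r j - r i) = (\<Prod>i<j. r j - r i) * (\<Prod>i\<in>{j<..<6}. r j - r i)"
        unfolding split by (rule prod.union_disjoint) auto
    qed
    also have "\<dots> = \<Delta> * (\<Prod>j<6. \<Prod>i\<in>{j<..<6}. r j - r i)" by (simp add: prod.distrib \<Delta>_def)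
    also have "(\<Prod>j<6. \<Prod>i\<in>{j<..<6}. r j - r i) = (\<Prod>i<6. \<Prod>j<i. r j - r i)"
      unfolding prod.Sigma[OF finite_lessThan ballI[OF finite_greaterThanLessThan]]
        prod.Sigma[OF finite_lessThan ballI[OF finite_lessThan]]
      by (rule prod.reindex_bij_witness[of _ prod.swap prod.swap]) auto
    finally have "(\<Prod>j<6. (\<Prod>i\<in>{..<6}-{j}. r j - r i))\<^sup>2 = \<Delta>\<^sup>2 * (\<Prod>i<6. \<Prod>j<i. r j - r i)\<^sup>2"
      by (simp only: power_mult_distrib)
    also have "(\<Prod>i<6. \<Prod>j<i. r j - r i)\<^sup>2 = \<Delta>\<^sup>2"
      unfolding \<Delta>_def prod_power_distrib by (intro prod.cong refl power2_commute)
    finally have P: "(\<Prod>j<6. (\<Prod>i\<in>{..<6}-{j}. r j - r i))\<^sup>2 = \<Delta>\<^sup>2 * \<Delta>\<^sup>2" .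
    have "(det (power_mat (coeff F) r))\<^sup>2 * det (bezout_mat (coeff F)) = (\<Prod>j<6. (sextic_deriv (coeff F) (r j))\<^sup>2)"
      by (rule bezout_congruence_diagonal[OF root True])
    also have "\<dots> = (\<Prod>j<6. a * (\<Prod>i\<in>{..<6}-{j}. r j - r i))\<^sup>2"
      unfolding prod_power_distrib using deriv by (intro prod.cong refl) simp
    also have "\<dots> = (a ^ 6)\<^sup>2 * (\<Delta>\<^sup>2 * \<Delta>\<^sup>2)"
      by (simp only: prod.distrib P power_mult_distrib) simp
    finally have "(a\<^sup>2 * \<Delta>\<^sup>2) * det (bezout_mat (coeff F)) = (a\<^sup>2 * \<Delta>\<^sup>2) * (a ^ 10 * \<Delta>\<^sup>2)"
      unfolding det_power_mat c6 \<Delta>_def[symmetric] by Groebner_Basis.algebra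
    then have "det (bezout_mat (coeff F)) = a ^ 10 * \<Delta>\<^sup>2" using a \<open>\<Delta> \<noteq> 0\<close> by simp
    also have "\<Delta>\<^sup>2 = (\<Prod>j<6. \<Prod>i<j. (r i - r j)\<^sup>2)"
      unfolding \<Delta>_def prod_power_distrib by (intro prod.cong refl power2_commute)
    finally show ?thesis .
  qed
qed

interpretation mpoly_eval_hom: comm_ring_hom "mpoly_eval c"
  by unfold_locales (simp_all add: mpoly_eval_add mpoly_eval_mult mpoly_eval_1 mpoly_eval_0)

lemma mpoly_eval_bezout_entry: "mpoly_eval c (bezout_entry mpoly_var i j) = bezout_entry c i j"
proof -
  have "mpoly_eval c (derivative_coeff mpoly_var m) = derivative_coeff c m" for m
    unfolding derivative_coeff_def
    by (cases "m < 6") (simp_all only: if_True if_False mpoly_eval_mult mpoly_eval_of_nat mpoly_eval_var mpoly_eval_0)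
  then show ?thesis
    by (simp add: bezout_entry_def mpoly_eval_sum mpoly_eval_diff mpoly_eval_mult mpoly_eval_numeral mpoly_eval_var)
qed

lemma mpoly_eval_det_bezout: "mpoly_eval c (det (bezout_mat mpoly_var)) = det (bezout_mat c)"
proof -
  have "map_mat (mpoly_eval c) (bezout_mat mpoly_var) = bezout_mat c"
    by (rule eq_matI) (simp_all add: bezout_mat_def mpoly_eval_bezout_entry)
  then show ?thesis by (metis mpoly_eval_hom.hom_det)
qed

lemma bezout_entry_sextic_mpoly:
  assumes "i < 6" "j < 6"
  shows "bezout_entry mpoly_var i j \<in> sextic_mpolys"
proof -
  have d: "derivative_coeff mpoly_var m \<in> sextic_mpolys" for m
    unfolding derivative_coeff_def
    by (auto intro!: sextic_mpolys_closed sextic_mpolys_of_nat simp del: of_nat_add of_nat_Suc)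
  show ?thesis
    unfolding bezout_entry_def using assms d
    by (auto intro!: sextic_mpolys_numeral sextic_mpolys_sum sextic_mpolys_diff sextic_mpolys_closed(2) sextic_mpolys_closed(6))
qed

lemma det_bezout_sextic_mpoly: "det (bezout_mat mpoly_var) \<in> sextic_mpolys"
proof -
  have "signof p \<in> sextic_mpolys" for p :: "nat \<Rightarrow> nat"
    by (auto simp: sign_def intro!: sextic_mpolys_closed)
  moreover have "(\<Prod>i = 0..<6. bezout_mat mpoly_var $$ (i, p i)) \<in> sextic_mpolys" if "p permutes {0..<6}" for p
    using permutes_in_image[OF that]
    by (intro sextic_mpolys_prod) (auto simp: bezout_mat_def intro!: bezout_entry_sextic_mpoly)
  ultimately show ?thesis
    unfolding det_def'[OF bezout_mat_carrier] by (intro sextic_mpolys_sum sextic_mpolys_closed(2)) auto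
qed

theorem coefficient_mpoly_J10: "coefficient_mpoly J10_roots = mpoly_div_2power 12 (det (bezout_mat mpoly_var))"
proof (rule coefficient_mpoly_eqI[OF det_bezout_sextic_mpoly])
  fix a :: complex and x :: "nat \<Rightarrow> complex"
  assume a: "a \<noteq> 0"
  have lin: "(\<Prod>i \<in> {1..6}. [:- x i, 1:]) = (\<Prod>i<6. [:- x (Suc i), 1:])"
    by (rule prod.reindex_bij_witness[of _ Suc "\<lambda>i. i - 1"]) auto
  have "(\<Prod>j\<in>{1..6}. \<Prod>i\<in>{1..<j}. (x i - x j)\<^sup>2) = (\<Prod>j<6. \<Prod>i\<in>{1..<Suc j}. (x i - x (Suc j))\<^sup>2)"
    by (rule prod.reindex_bij_witness[of _ Suc "\<lambda>i. i - 1"]) auto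
  also have "\<dots> = (\<Prod>j<6. \<Prod>i<j. (x (Suc i) - x (Suc j))\<^sup>2)"
    by (intro prod.cong refl prod.reindex_bij_witness[of _ Suc "\<lambda>i. i - 1"]) auto
  finally have disc: "(\<Prod>j\<in>{1..6}. \<Prod>i\<in>{1..<j}. (x i - x j)\<^sup>2) = (\<Prod>j<6. \<Prod>i<j. (x (Suc i) - x (Suc j))\<^sup>2)" .
  show "mpoly_eval (coeff (smult a (\<Prod>i \<in> {1..6}. [:- x i, 1:]))) (det (bezout_mat mpoly_var)) = 2 ^ 12 * J10_roots a x"
    unfolding mpoly_eval_det_bezout lin det_bezout_mat_discriminant[OF a] J10_roots_def I10_roots_def disc by simp
qed

theorem igusa_J10_nonzero:
  fixes F :: "'a::alg_closed_field poly"
  assumes two: "(2::'a) \<noteq> 0" and "rsquarefree F" and "degree F = 5 \<or> degree F = 6"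
  shows "igusa_J10 F \<noteq> 0"
  using det_bezout_mat_nonzero[OF assms(2,3)] power_not_zero[OF two, of 12]
  unfolding igusa_J10_def coefficient_mpoly_J10 eval_mpoly_div_2power[OF two] mpoly_eval_det_bezout divide_eq_0_iff
  by blast

section \<open>Ordinary genus 2 curves in characteristic 3\<close>

lemma ordinary_char_3_card_torsion:
  fixes F :: "'k::field poly"
  assumes "CHAR('k) = 3" "ordinary F"
  shows "card (carrier (torsion_part (jacobian_points F) 3)) = 9"
proof -
  let ?P = "product_group {..<2::nat} (\<lambda>_. integer_mod_group 3)"
  have "torsion_part (jacobian_points F) 3 \<cong> ?P"
    using assms unfolding ordinary_def has_p_rank_def by simp
  then obtain h where "bij_betw h (carrier (torsion_part (jacobian_points F) 3)) (carrier ?P)"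
    unfolding is_iso_def iso_def by blast
  then have "card (carrier (torsion_part (jacobian_points F) 3)) = card (carrier ?P)"
    by (rule bij_betw_same_card)
  also have "\<dots> = card ({..<2::nat} \<rightarrow>\<^sub>E {0..<3::int})"
    by (simp add: carrier_integer_mod_group)
  also have "\<dots> = 9" by (simp add: card_PiE)
  finally show ?thesis .
qed

theorem corollary2:
  fixes F :: "'k::{field, finite} poly"
    and g1 g2 g3 :: "'k alg_closure"
  assumes "CHAR('k) = 3"
    and "genus2_model F"
    and "ordinary F"
    and "absolute_invariants (map_poly to_ac F) = (g1, g2, g3)"
  shows "g1 \<in> to_ac ` (UNIV - {0}) \<and> g2 \<in> range to_ac \<and> g3 \<in> range to_ac"
proof -
  let ?F = "map_poly to_ac F"
  have char: "CHAR('k alg_closure) = 3" using assms(1) by simp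
  have sf: "rsquarefree ?F" and deg: "degree ?F = 5 \<or> degree ?F = 6"
    using assms(2) by (simp_all add: genus2_model_def degree_map_poly)
  have "card (carrier (torsion_part (jacobian_points F) 3)) = 9"
    by (rule ordinary_char_3_card_torsion[OF assms(1,3)])
  then have "coeff ?F 1 * coeff ?F 5 \<noteq> coeff ?F 2 * coeff ?F 4"
    using card_three_torsion_le[OF char sf deg] unfolding jacobian_points_def by fastforce
  then have "igusa_J2 ?F \<noteq> 0"
    unfolding igusa_J2_char_3[OF char] by simp
  moreover have "igusa_J10 ?F \<noteq> 0"
    by (rule igusa_J10_nonzero[OF two_neq_0[OF char] sf deg])
  moreover have "igusa_J2 ?F = to_ac (igusa_J2 F)" "igusa_J4 ?F = to_ac (igusa_J4 F)"
    "igusa_J6 ?F = to_ac (igusa_J6 F)" "igusa_J10 ?F = to_ac (igusa_J10 F)"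
    by (simp_all only: igusa_J2_def igusa_J4_def igusa_J6_def igusa_J10_def eval_mpoly_map_to_ac)
  ultimately have "igusa_J2 F \<noteq> 0" "igusa_J10 F \<noteq> 0"
    and "g1 = to_ac (igusa_J2 F ^ 5 / igusa_J10 F)"
      "g2 = to_ac (igusa_J2 F ^ 3 * igusa_J4 F / igusa_J10 F)"
      "g3 = to_ac (igusa_J2 F ^ 2 * igusa_J6 F / igusa_J10 F)"
    using assms(4) by (simp_all add: absolute_invariants_def Let_def)
  moreover from this(1,2) have "igusa_J2 F ^ 5 / igusa_J10 F \<in> UNIV - {0}" by simp
  ultimately show ?thesis by blast
qed

end
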